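(* For every $\epsilon>0$ and $M>0$ there exists an (explicit) dimensionless constant $C=C(\epsilon,M)>0$, i.e. depending only on $\epsilon$ and $M$ and not on the dimension $n$, such that for every $n\ge1$ and every $f\in\mathcal{F}(\epsilon,M)$ on $\mathbb{R}^n$ with unit mass ($\int_{\mathbb{R}^n}f\,d\gamma=1$) and zero barycenter ($\int_{\mathbb{R}^n}xf(x)\,d\gamma(x)=0$), $$W_2(f\,d\gamma,\,d\gamma)\le C\,\delta(f)^{1/2}.$$
   Context: $d\gamma:=(2\pi)^{-n/2}e^{-|x|^2/2}dx$ is the standard Gaussian measure on $\mathbb{R}^n$. For $\epsilon>0$, $M>0$, $$\mathcal{F}(\epsilon,M):=\{e^{-h}:\ (-1+\epsilon)\le D^2h\le M\},$$ where $h:\mathbb{R}^n\to\mathbb{R}$ is a $C^{1,1}$ function and the inequalities mean $(-1+\epsilon)\mathrm{Id}\le D^2h(x)\le M\,\mathrm{Id}$ as symmetric matrices for a.e. $x$. For a positive function $f$ the Fisher information, entropy and log-Sobolev deficit are $$I(f)=\int_{\mathbb{R}^n}\frac{|\nabla f|^2}{f}\,d\gamma,\qquad Ent(f)=\int_{\mathbb{R}^n}f\log f\,d\gamma-\|f\|_{L^1(d\gamma)}\log\big(\|f\|_{L^1(d\gamma)}\big),\qquad \delta(f)=\tfrac12 I(f)-Ent(f).$$ $W_2$ is the quadratic Wasserstein distance between probability measures on $\mathbb{R}^n$: $W_2^2(\rho,\nu)=\inf_\pi\int|x-y|^2d\pi(x,y)$ over couplings $\pi$ of $\rho$ and $\nu$.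 *)

theory Defs
  imports "HOL-Probability.Probability"
begin

text \<open>
  The constant in the theorem must not depend on the dimension, so the dimension \<open>n\<close> has to be
  quantified inside the formula and cannot be a type. The space \<open>\<real>\<^sup>n\<close> is therefore the set of
  extensional functions on \<open>{..<n}\<close>, the underlying set of the finite product measure \<open>Pi\<^sub>M\<close>.
  Scalar functions on it have type \<open>(nat \<Rightarrow> real) \<Rightarrow> real\<close>; only their values on \<open>Rn n\<close> matter.
\<close>

definition Rn :: "nat \<Rightarrow> (nat \<Rightarrow> real) set"
  where "Rn n = {..<n} \<rightarrow>\<^sub>E UNIV"

definition lebesgue_Rn :: "nat \<Rightarrow> (nat \<Rightarrow> real) measure"
  where "lebesgue_Rn n = (\<Pi>\<^sub>M i\<in>{..<n}. lborel)"

lemma space_lebesgue_Rn: "space (lebesgue_Rn n) = Rn n"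
  by (simp add: lebesgue_Rn_def Rn_def space_PiM)

definition norm_Rn :: "nat \<Rightarrow> (nat \<Rightarrow> real) \<Rightarrow> real"
  where "norm_Rn n x = L2_set x {..<n}"

definition dist_Rn :: "nat \<Rightarrow> (nat \<Rightarrow> real) \<Rightarrow> (nat \<Rightarrow> real) \<Rightarrow> real"
  where "dist_Rn n x y = norm_Rn n (\<lambda>i. x i - y i)"

definition gauss :: "nat \<Rightarrow> (nat \<Rightarrow> real) measure"
  where "gauss n = density (lebesgue_Rn n)
    (\<lambda>x. ennreal ((2 * pi) powr (- real n / 2) * exp (- (norm_Rn n x)\<^sup>2 / 2)))"

text \<open>Frechet differentiability of \<open>f\<close> at \<open>x\<close> with gradient \<open>g\<close>; the partial derivatives in \<open>grad\<close>
  are the entries of the gradient wherever it exists.\<close>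

definition has_gradient :: "nat \<Rightarrow> ((nat \<Rightarrow> real) \<Rightarrow> real) \<Rightarrow> (nat \<Rightarrow> real) \<Rightarrow> (nat \<Rightarrow> real) \<Rightarrow> bool"
  where "has_gradient n f g x \<longleftrightarrow>
    (\<forall>e>0. \<exists>d>0. \<forall>y\<in>Rn n. dist_Rn n y x < d \<longrightarrow>
       \<bar>f y - f x - (\<Sum>i<n. g i * (y i - x i))\<bar> \<le> e * dist_Rn n y x)"

definition grad :: "((nat \<Rightarrow> real) \<Rightarrow> real) \<Rightarrow> (nat \<Rightarrow> real) \<Rightarrow> (nat \<Rightarrow> real)"
  where "grad f x = (\<lambda>i. deriv (\<lambda>t. f (x(i := t))) (x i))"

definition C11 :: "nat \<Rightarrow> ((nat \<Rightarrow> real) \<Rightarrow> real) \<Rightarrow> bool"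
  where "C11 n h \<longleftrightarrow>
    (\<forall>x\<in>Rn n. has_gradient n h (grad h x) x) \<and>
    (\<exists>L. \<forall>x\<in>Rn n. \<forall>y\<in>Rn n. dist_Rn n (grad h x) (grad h y) \<le> L * dist_Rn n x y)"

text \<open>\<open>H\<close> is the matrix of the Frechet derivative of the gradient of \<open>h\<close> at \<open>x\<close>, with rows
  \<open>H i\<close>. For a \<open>C\<^sup>1\<^sup>,\<^sup>1\<close> function it exists at almost every point by Rademacher's theorem.\<close>

definition has_hessian ::
    "nat \<Rightarrow> ((nat \<Rightarrow> real) \<Rightarrow> real) \<Rightarrow> (nat \<Rightarrow> nat \<Rightarrow> real) \<Rightarrow> (nat \<Rightarrow> real) \<Rightarrow> bool"
  where "has_hessian n h H x \<longleftrightarrow> (\<forall>i<n. has_gradient n (\<lambda>y. grad h y i) (H i) x)"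

definition loewner_le :: "nat \<Rightarrow> (nat \<Rightarrow> nat \<Rightarrow> real) \<Rightarrow> (nat \<Rightarrow> nat \<Rightarrow> real) \<Rightarrow> bool"
  where "loewner_le n A B \<longleftrightarrow>
    (\<forall>v. (\<Sum>i<n. \<Sum>j<n. A i j * v i * v j) \<le> (\<Sum>i<n. \<Sum>j<n. B i j * v i * v j))"

definition scalar_matrix :: "real \<Rightarrow> nat \<Rightarrow> nat \<Rightarrow> real"
  where "scalar_matrix c i j = (if i = j then c else 0)"

definition \<F> :: "nat \<Rightarrow> real \<Rightarrow> real \<Rightarrow> ((nat \<Rightarrow> real) \<Rightarrow> real) set"
  where "\<F> n \<epsilon> M = {(\<lambda>x. exp (- h x)) | h.
     C11 n h \<and>
     (AE x in lebesgue_Rn n. \<exists>H. has_hessian n h H x \<and>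
        loewner_le n (scalar_matrix (-1 + \<epsilon>)) H \<and> loewner_le n H (scalar_matrix M))}"

text \<open>Bochner integrals are \<open>0\<close> when they diverge. This does not matter for \<open>f = exp (- h)\<close> in
  \<open>\<F> n \<epsilon> M\<close> with \<open>\<epsilon> > 0\<close>: \<open>h\<close> grows at most quadratically, \<open>grad h\<close> at most linearly, and
  \<open>h + (norm_Rn n)\<^sup>2 / 2\<close> is uniformly convex, so all the integrals below converge.\<close>

definition fisher :: "nat \<Rightarrow> ((nat \<Rightarrow> real) \<Rightarrow> real) \<Rightarrow> real"
  where "fisher n f = (LINT x|gauss n. (norm_Rn n (grad f x))\<^sup>2 / f x)"

definition entropy_gauss :: "nat \<Rightarrow> ((nat \<Rightarrow> real) \<Rightarrow> real) \<Rightarrow> real"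
  where "entropy_gauss n f = (LINT x|gauss n. f x * ln (f x))
    - (LINT x|gauss n. \<bar>f x\<bar>) * ln (LINT x|gauss n. \<bar>f x\<bar>)"

definition lsi_deficit :: "nat \<Rightarrow> ((nat \<Rightarrow> real) \<Rightarrow> real) \<Rightarrow> real"
  where "lsi_deficit n f = 1 / 2 * fisher n f - entropy_gauss n f"

definition couplings :: "'a measure \<Rightarrow> 'b measure \<Rightarrow> ('a \<times> 'b) measure set"
  where "couplings \<rho> \<nu> = {p. sets p = sets (\<rho> \<Otimes>\<^sub>M \<nu>) \<and> distr p \<rho> fst = \<rho> \<and> distr p \<nu> snd = \<nu>}"

definition W2_squared :: "nat \<Rightarrow> (nat \<Rightarrow> real) measure \<Rightarrow> (nat \<Rightarrow> real) measure \<Rightarrow> ennreal"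
  where "W2_squared n \<rho> \<nu> =
    (INF p\<in>couplings \<rho> \<nu>. \<integral>\<^sup>+ (x, y). ennreal ((dist_Rn n x y)\<^sup>2) \<partial>p)"

text \<open>The square root is taken in \<open>ennreal\<close>, so that an infinite distance stays infinite.\<close>

definition W2 :: "nat \<Rightarrow> (nat \<Rightarrow> real) measure \<Rightarrow> (nat \<Rightarrow> real) measure \<Rightarrow> ennreal"
  where "W2 n \<rho> \<nu> =
    (if W2_squared n \<rho> \<nu> = \<infinity> then \<infinity> else ennreal (sqrt (enn2real (W2_squared n \<rho> \<nu>))))"

end

(*
  Write mu = f d gamma = exp(-V) dx / Z with V = h + |x|^2/2, so that eps <= D^2 V <= L := 1 + M, and
  g_i = d_i h. One shows delta(f) >= c * sum_i Var_mu(g_i) and W_2^2 <= 4 I(f), both by induction on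
  n, disintegrating mu along its last coordinate t. Both x and the gradient of V have mean 0 under
  mu, hence so do the g_i; thus sum_i Var_mu(g_i) = I(f) and W_2^2 <= (4/c) delta(f).

  The deficit of mu is the mean deficit of its fibres plus the deficit of the marginal W of t plus
  half the mean of Var_t(g_n). The variances of the conditional expectations of the other g_i are
  those of the conditional means m_i(t) of x_i. Here m_i' = -Cov_t(x_i, d_n V), and Cov_t(x) <= 1/eps
  (Prekopa-Leindler), so that sum_i (m_i')^2 <= Var_t(g_n)/eps and the one-dimensional Poincare
  inequality absorbs them into the mean of Var_t(g_n), whatever the dimension.

  In dimension one the deficit is E[theta' - ln(1 + theta')] + E[(theta - g)^2]/2, where x + theta(x)
  is the monotone transport to the Gaussian, whose slope is at most sqrt L. For W_2 these maps are
  composed to the Knothe map, so no optimal transport map is needed.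
*)
theory Submission
  imports Defs
begin

section \<open>One-dimensional monotone transport\<close>

text \<open>The induction controls variances of the g_i and not I(f) itself: the fibres of a centred
  measure need not be centred, and a translated Gaussian has deficit zero but positive Fisher
  information. Variances do not see translations; the barycentre enters only at the very end.

  The upper bound on the Hessian is what makes the deficit quadratic. For large slopes theta' - ln(1
  + theta') grows only linearly, but the transport has slope at most sqrt L, so this term dominates
  theta'^2 / (2 sqrt L). The Poincare inequality then controls the variance of theta, and the term
  (theta - g)^2 passes from theta to g.

  Second derivatives exist only almost everywhere, and a whole slice may lie in the exceptional null
  set. The Hessian bounds are therefore converted once into a two-point estimate: the first-order
  Taylor remainder lies between \<epsilon>/2 and L/2 times the squared distance. In this form they
  pass to slices by restriction and to marginals by midpoint inequalities, always with the same
  constants.\<close>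

definition pos_density :: "(real \<Rightarrow> real) \<Rightarrow> bool"
  where "pos_density f \<longleftrightarrow> (\<forall>x. f x > 0) \<and> continuous_on UNIV f \<and> integrable lborel f
    \<and> (LINT x|lborel. f x) = 1"

definition density_cdf :: "(real \<Rightarrow> real) \<Rightarrow> real \<Rightarrow> real"
  where "density_cdf f = cdf (density lborel (\<lambda>x. ennreal (f x)))"

lemma pos_densityD:
  assumes "pos_density f"
  shows "f x > 0" "continuous_on UNIV f" "integrable lborel f" "(LINT x|lborel. f x) = 1"
    "f \<in> borel_measurable borel"
  using assms by (auto simp: pos_density_def intro: borel_measurable_continuous_onI)

lemma real_distribution_density:
  assumes "pos_density f"
  shows "real_distribution (density lborel (\<lambda>x. ennreal (f x)))"
proof -
  have "(\<integral>\<^sup>+ x. ennreal (f x) \<partial>lborel) = 1"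
    using pos_densityD[OF assms] by (subst nn_integral_eq_integral) (auto intro: less_imp_le)
  with pos_densityD(5)[OF assms] show ?thesis
    by (intro real_distribution.intro prob_spaceI real_distribution_axioms.intro)
       (auto simp: emeasure_density)
qed

lemma density_cdf_diff:
  assumes f: "pos_density f" and "a \<le> b"
  shows "density_cdf f b - density_cdf f a = integral {a..b} f"
proof -
  let ?M = "density lborel (\<lambda>x. ennreal (f x))"
  interpret real_distribution ?M by (rule real_distribution_density[OF f])
  note [measurable] = pos_densityD(5)[OF f]
  have i: "set_integrable lborel {a<..b} f"
    unfolding set_integrable_def by (rule integrable_mult_indicator[OF _ pos_densityD(3)[OF f]]) simp
  have nn: "0 \<le> f x" for x using pos_densityD(1)[OF f, of x] by simp
  have "density_cdf f b - density_cdf f a = measure ?M {a<..b}"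
    unfolding density_cdf_def using \<open>a \<le> b\<close>
    by (cases "a = b") (auto intro!: cdf_diff_eq)
  also have "\<dots> = enn2real (\<integral>\<^sup>+x. ennreal (indicator {a<..b} x * f x) \<partial>lborel)"
    by (auto simp: measure_def emeasure_density intro!: arg_cong[where f=enn2real] nn_integral_cong
        split: split_indicator)
  also have "\<dots> = (LINT x:{a<..b}|lborel. f x)"
    using i nn unfolding set_integrable_def set_lebesgue_integral_def
    by (subst nn_integral_eq_integral) (auto simp: integral_nonneg_AE intro!: enn2real_ennreal)
  also have "\<dots> = integral {a<..b} f"
    using i by (rule set_borel_integral_eq_integral)
  also have "\<dots> = integral {a..b} f"
    by (rule integral_spike_set; rule negligible_subset[of "{a}"]) auto
  finally show ?thesis .
qed

lemma density_cdf_deriv: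
  assumes f: "pos_density f"
  shows "(density_cdf f has_real_derivative f x) (at x)"
proof -
  have "((\<lambda>y. integral {x-1..y} f) has_real_derivative f x) (at x within {x-1..x+1})"
    using pos_densityD(2)[OF f] by (intro integral_has_real_derivative) (auto intro: continuous_on_subset)
  then have "((\<lambda>y. density_cdf f (x-1) + integral {x-1..y} f) has_real_derivative f x) (at x within {x-1..x+1})"
    by (auto intro!: derivative_eq_intros)
  moreover have "at x within {x-1..x+1} = at x"
    by (intro at_within_interior) auto
  ultimately have *: "((\<lambda>y. density_cdf f (x-1) + integral {x-1..y} f) has_real_derivative f x) (at x)"
    by simp
  show ?thesis
  proof (rule has_field_derivative_transform_within_open[OF *, where S="{x-1<..<x+1}"])
    fix y assume "y \<in> {x-1<..<x+1}"
    then show "density_cdf f (x-1) + integral {x-1..y} f = density_cdf f y"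
      by (subst density_cdf_diff[OF f, symmetric]) auto
  qed auto
qed

lemma density_cdf_strict_mono:
  assumes f: "pos_density f" and "x < y"
  shows "density_cdf f x < density_cdf f y"
  using assms(2)
proof (rule DERIV_pos_imp_increasing)
  fix t
  show "\<exists>y. (density_cdf f has_real_derivative y) (at t) \<and> 0 < y"
    using density_cdf_deriv[OF f, of t] pos_densityD(1)[OF f, of t] by blast
qed

lemma density_cdf_isCont: "pos_density f \<Longrightarrow> isCont (density_cdf f) x"
  using density_cdf_deriv by (rule DERIV_isCont)

lemma density_cdf_limits:
  assumes f: "pos_density f"
  shows "(density_cdf f \<longlongrightarrow> 1) at_top" "(density_cdf f \<longlongrightarrow> 0) at_bot"
proof -
  interpret real_distribution "density lborel (\<lambda>x. ennreal (f x))" by (rule real_distribution_density[OF f])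
  show "(density_cdf f \<longlongrightarrow> 1) at_top" "(density_cdf f \<longlongrightarrow> 0) at_bot"
    unfolding density_cdf_def by (rule cdf_lim_at_top_prob, rule cdf_lim_at_bot)
qed

lemma density_cdf_bounds:
  assumes f: "pos_density f"
  shows "0 < density_cdf f x" "density_cdf f x < 1"
proof -
  interpret real_distribution "density lborel (\<lambda>x. ennreal (f x))" by (rule real_distribution_density[OF f])
  have b: "0 \<le> density_cdf f y" "density_cdf f y \<le> 1" for y
    unfolding density_cdf_def by (rule cdf_nonneg, rule cdf_bounded_prob)
  have "density_cdf f (x-1) < density_cdf f x" "density_cdf f x < density_cdf f (x+1)"
    by (rule density_cdf_strict_mono[OF f], simp)+
  then show "0 < density_cdf f x" "density_cdf f x < 1"
    using b(1)[of "x-1"] b(2)[of "x+1"] by linarith+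
qed

lemma density_cdf_eq_ex1:
  assumes f: "pos_density f" and "0 < p" "p < 1"
  shows "\<exists>!y. density_cdf f y = p"
proof -
  obtain b where b: "p < density_cdf f b"
    using order_tendstoD(1)[OF density_cdf_limits(1)[OF f] \<open>p<1\<close>]
    by (metis eventually_happens trivial_limit_at_top_linorder)
  obtain a where a: "density_cdf f a < p"
    using order_tendstoD(2)[OF density_cdf_limits(2)[OF f] \<open>0<p\<close>]
    by (metis eventually_happens trivial_limit_at_bot_linorder)
  have "a \<le> b" using a b density_cdf_strict_mono[OF f, of b a] by fastforce
  then obtain y where "density_cdf f y = p"
    using IVT[of "density_cdf f" a p b] a b density_cdf_isCont[OF f] by auto
  moreover have "z = y" if "density_cdf f z = density_cdf f y" for z y
    using that density_cdf_strict_mono[OF f, of z y] density_cdf_strict_mono[OF f, of y z] by linarith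
  ultimately show ?thesis by blast
qed

text \<open>Outside \<open>{0<..<1}\<close> no \<open>y\<close> qualifies and \<open>THE\<close>
  returns one fixed unspecified real; that is still enough for measurability on the whole
  line.\<close>

definition density_quantile :: "(real \<Rightarrow> real) \<Rightarrow> real \<Rightarrow> real"
  where "density_quantile g p = (THE y. density_cdf g y = p)"

definition transport :: "(real \<Rightarrow> real) \<Rightarrow> (real \<Rightarrow> real) \<Rightarrow> real \<Rightarrow> real"
  where "transport f g x = density_quantile g (density_cdf f x)"

lemma density_cdf_quantile:
  assumes "pos_density g" "0 < p" "p < 1"
  shows "density_cdf g (density_quantile g p) = p"
  unfolding density_quantile_def using density_cdf_eq_ex1[OF assms] by (rule theI')

lemma density_quantile_cdf:
  assumes "pos_density g"
  shows "density_quantile g (density_cdf g y) = y"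
  unfolding density_quantile_def
  using density_cdf_eq_ex1[OF assms density_cdf_bounds[OF assms, of y]] by (intro the1_equality) auto

lemma density_cdf_transport:
  assumes "pos_density f" "pos_density g"
  shows "density_cdf g (transport f g x) = density_cdf f x"
  unfolding transport_def using assms by (intro density_cdf_quantile density_cdf_bounds)

lemma density_quantile_isCont:
  assumes "pos_density g" "0 < p" "p < 1"
  shows "isCont (density_quantile g) p"
proof -
  define x where "x = density_quantile g p"
  have "isCont (density_quantile g) (density_cdf g x)"
    by (rule isCont_inverse_function2[of "x - 1" x "x + 1"])
      (auto simp: density_quantile_cdf density_cdf_isCont assms(1))
  then show ?thesis by (simp add: x_def density_cdf_quantile[OF assms])
qed

lemma density_quantile_deriv:
  assumes g: "pos_density g" and p: "0 < p" "p < 1"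
  shows "(density_quantile g has_real_derivative inverse (g (density_quantile g p))) (at p)"
proof (rule DERIV_inverse_function[where f = "density_cdf g" and a=0 and b=1])
  show "(density_cdf g has_real_derivative g (density_quantile g p)) (at (density_quantile g p))"
    by (rule density_cdf_deriv[OF g])
  show "g (density_quantile g p) \<noteq> 0" using pos_densityD(1)[OF g, of "density_quantile g p"] by simp
qed (use p g density_cdf_quantile density_quantile_isCont in auto)

lemma transport_deriv:
  assumes f: "pos_density f" and g: "pos_density g"
  shows "(transport f g has_real_derivative f x / g (transport f g x)) (at x)"
proof -
  have "((\<lambda>x. density_quantile g (density_cdf f x)) has_real_derivative
     inverse (g (density_quantile g (density_cdf f x))) * f x) (at x)"
    by (rule DERIV_chain2[OF density_quantile_deriv[OF g density_cdf_bounds[OF f]] density_cdf_deriv[OF f]])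
  then show ?thesis
    by (simp add: transport_def[abs_def] field_simps)
qed

lemma transport_isCont: "pos_density f \<Longrightarrow> pos_density g \<Longrightarrow> isCont (transport f g) x"
  using transport_deriv by (rule DERIV_isCont)

lemma transport_strict_mono:
  assumes "pos_density f" "pos_density g" "x < y"
  shows "transport f g x < transport f g y"
proof (rule ccontr)
  assume "\<not> ?thesis"
  then have "density_cdf g (transport f g y) \<le> density_cdf g (transport f g x)"
    using density_cdf_strict_mono[OF assms(2), of "transport f g y" "transport f g x"]
    by (cases "transport f g y = transport f g x") auto
  then show False
    using density_cdf_strict_mono[OF assms(1,3)] by (simp add: density_cdf_transport[OF assms(1,2)])
qed

text \<open>The transport in the opposite direction inverts \<open>?T\<close>, so
  \<open>?T z \<le> y\<close> becomes \<open>z \<le> x\<close> with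
  \<open>x = transport g f y\<close>, and both distribution functions take the same value.\<close>

lemma distr_transport:
  assumes f: "pos_density f" and g: "pos_density g"
  shows "distr (density lborel (\<lambda>x. ennreal (f x))) borel (transport f g) = density lborel (\<lambda>x. ennreal (g x))"
    (is "distr ?F borel ?T = ?G")
proof (rule cdf_unique)
  interpret F: real_distribution ?F by (rule real_distribution_density[OF f])
  have [measurable]: "?T \<in> borel_measurable borel"
    using transport_isCont[OF f g] by (intro borel_measurable_continuous_onI) (auto simp: continuous_on_eq_continuous_at)
  then have T: "?T \<in> measurable ?F borel" by simp
  show "real_distribution ?G" by (rule real_distribution_density[OF g])
  show "real_distribution (distr ?F borel ?T)"
    using F.prob_space_distr[OF T]
    by (intro real_distribution.intro real_distribution_axioms.intro) auto
  show "cdf (distr ?F borel ?T) = cdf ?G"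
  proof
    fix y
    define x where "x = transport g f y"
    have Tx: "?T x = y"
      unfolding transport_def x_def using density_cdf_transport[OF g f, of y]
      by (simp add: transport_def density_quantile_cdf[OF g])
    have "?T z \<le> y \<longleftrightarrow> z \<le> x" for z
      using Tx transport_strict_mono[OF f g, of z x] transport_strict_mono[OF f g, of x z]
      by (cases z x rule: linorder_cases) auto
    then have "?T -` {..y} = {..x}" by auto
    then have "cdf (distr ?F borel ?T) y = density_cdf f x"
      using T by (simp add: cdf_def measure_distr density_cdf_def)
    also have "\<dots> = density_cdf g y"
      using density_cdf_transport[OF g f, of y] by (simp add: x_def)
    finally show "cdf (distr ?F borel ?T) y = cdf ?G y" by (simp add: density_cdf_def)
  qed
qed

section \<open>Prekopa-Leindler inequality on the line\<close>

lemma prekopa_leindler_1d_normalized: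
  fixes f g h :: "real \<Rightarrow> real"
  assumes f: "pos_density f" and g: "pos_density g" and h: "pos_density h"
    and le: "\<And>x y. c * sqrt (f x * g y) \<le> h ((x + y) / 2)" and "0 \<le> c"
  shows "c \<le> 1"
proof -
  define T where "T = transport f g"
  \<comment> \<open>The points \<open>(x + T x) / 2\<close> interpolate halfway between the two
    measures. \<open>D\<close> compares the mass of \<open>h\<close> to the left of such a point
    with \<open>c\<close> times the mass of \<open>f\<close> to the left of \<open>x\<close>; once
    it is nondecreasing, comparing \<open>- k\<close> with \<open>k\<close> bounds \<open>c\<close>
    by the mass of \<open>h\<close>.\<close>
  define D where "D x = density_cdf h ((x + T x) / 2) - c * density_cdf f x" for x
  have D': "(D has_real_derivative h ((x + T x)/2) * ((1 + f x / g (T x)) / 2) - c * f x) (at x)" for x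
  proof -
    have "((\<lambda>x. (x + T x) / 2) has_real_derivative (1 + f x / g (T x)) / 2) (at x)"
      unfolding T_def by (intro DERIV_cdivide DERIV_add DERIV_ident transport_deriv f g)
    then show ?thesis
      unfolding D_def
      by (intro DERIV_diff DERIV_cmult density_cdf_deriv f DERIV_chain2[OF density_cdf_deriv[OF h]])
  qed
  have pos: "0 \<le> h ((x + T x)/2) * ((1 + f x / g (T x)) / 2) - c * f x" for x
  proof -
    define a where "a = f x / g (T x)"
    have gp: "g (T x) > 0" "f x > 0" using pos_densityD(1) f g by auto
    have a: "a > 0" using gp by (simp add: a_def)
    \<comment> \<open>Arithmetic-geometric mean for the slopes 1 of the identity and
      \<open>a\<close> of \<open>T\<close>: the slope of the midpoint map is at least
      \<open>sqrt a\<close>.\<close>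
    have "0 \<le> (1 - sqrt a)^2" by simp
    then have s: "sqrt a \<le> (1 + a) / 2" using a by (simp add: power2_diff)
    have "sqrt (f x * g (T x)) * sqrt a = sqrt (f x * f x)"
      using gp by (simp add: a_def real_sqrt_mult[symmetric])
    then have "c * f x = c * sqrt (f x * g (T x)) * sqrt a" using gp by simp
    also have "\<dots> \<le> h ((x + T x)/2) * ((1 + a) / 2)"
      using le[of x "T x"] s a \<open>0 \<le> c\<close> gp by (intro mult_mono) (auto intro: order_trans[rotated])
    finally show ?thesis by (simp add: a_def)
  qed
  have mono: "D x \<le> D y" if "x \<le> y" for x y
    by (rule deriv_nonneg_imp_mono[OF D' pos that])
  have "c * (density_cdf f (real k) - density_cdf f (- real k)) \<le> 1" for k
    using mono[of "- real k" "real k"] density_cdf_bounds[OF h, of "(real k + T (real k)) / 2"]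
      density_cdf_bounds[OF h, of "(- real k + T (- real k)) / 2"]
    by (simp add: D_def algebra_simps)
  moreover have "(\<lambda>k. c * (density_cdf f (real k) - density_cdf f (- real k))) \<longlonglongrightarrow> c * (1 - 0)"
    using filterlim_compose[OF density_cdf_limits(1)[OF f] filterlim_real_sequentially]
      filterlim_compose[OF density_cdf_limits(2)[OF f] filterlim_compose[OF filterlim_uminus_at_bot_at_top filterlim_real_sequentially]]
    by (intro tendsto_intros) auto
  ultimately have "c * (1 - 0) \<le> 1"
    by (intro LIMSEQ_le_const2) auto
  then show ?thesis by simp
qed

lemma pos_density_normalize:
  assumes "\<And>x. f x > 0" "continuous_on UNIV f" "integrable lborel f"
  shows "(LINT x|lborel. f x) > 0" "pos_density (\<lambda>x. f x / (LINT x|lborel. f x))"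
proof -
  have "(LINT x|lborel. f x) \<noteq> 0"
  proof
    assume "(LINT x|lborel. f x) = 0"
    then have "AE x in lborel. f x = 0"
      using assms by (subst (asm) integral_nonneg_eq_0_iff_AE) (auto intro: less_imp_le)
    then have "AE x::real in lborel. False" by (rule AE_mp) (use assms(1) in \<open>auto simp: less_le\<close>)
    then show False by (auto simp: AE_iff_null null_sets_def)
  qed
  then show *: "(LINT x|lborel. f x) > 0"
    using Bochner_Integration.integral_nonneg[of lborel f] assms(1) by (simp add: less_le)
  show "pos_density (\<lambda>x. f x / (LINT x|lborel. f x))"
    unfolding pos_density_def using assms * by (auto intro!: continuous_intros)
qed

lemma prekopa_leindler_1d:
  fixes f g h :: "real \<Rightarrow> real"
  assumes f: "\<And>x. f x > 0" "continuous_on UNIV f" "integrable lborel f"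
    and g: "\<And>x. g x > 0" "continuous_on UNIV g" "integrable lborel g"
    and h: "\<And>x. h x > 0" "continuous_on UNIV h" "integrable lborel h"
    and le: "\<And>x y. sqrt (f x * g y) \<le> h ((x + y) / 2)"
  shows "sqrt ((LINT x|lborel. f x) * (LINT x|lborel. g x)) \<le> (LINT x|lborel. h x)"
proof -
  note F = pos_density_normalize[OF f] and G = pos_density_normalize[OF g]
    and H = pos_density_normalize[OF h]
  define a b c where "a = (LINT x|lborel. f x)" and "b = (LINT x|lborel. g x)" and "c = (LINT x|lborel. h x)"
  have "sqrt (a * b) / c \<le> 1"
  proof (rule prekopa_leindler_1d_normalized[OF F(2) G(2) H(2), folded a_def b_def c_def])
    fix x y
    show "sqrt (a*b) / c * sqrt (f x / a * (g y / b)) \<le> h ((x + y) / 2) / c"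
      using le[of x y] F(1) G(1) H(1)
      by (simp add: a_def[symmetric] b_def[symmetric] c_def[symmetric] real_sqrt_mult real_sqrt_divide divide_simps)
  qed (use F(1) G(1) H(1) a_def b_def c_def in auto)
  then show ?thesis using H(1) by (simp add: a_def b_def c_def)
qed

section \<open>Uniformly convex potentials on the line\<close>

text \<open>Lets a fraction of the Gaussian decay rate pay for a quadratic polynomial factor; below,
  \<open>u\<close> is \<open>t\<^sup>2\<close> or \<open>sqn n x\<close>.\<close>

lemma one_plus_le_exp:
  fixes a u :: real
  assumes "0 < a" "0 \<le> u"
  shows "1 + u \<le> (1 + 1 / a) * exp (a * u)"
proof -
  have "a * u \<le> exp (a * u)" using exp_ge_add_one_self[of "a * u"] by linarith
  then have "u \<le> 1 / a * exp (a * u)" using assms by (simp add: field_simps)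
  moreover have "1 \<le> exp (a * u)" using assms by simp
  ultimately have "1 + u \<le> exp (a * u) + 1 / a * exp (a * u)" by linarith
  then show ?thesis by (simp add: algebra_simps)
qed

lemma integrable_gaussian_exp:
  assumes "0 < (c::real)"
  shows "integrable lborel (\<lambda>t::real. exp (- c * t\<^sup>2))"
proof -
  define s where "s = sqrt (1 / (2 * c))"
  have s: "0 < s" "s\<^sup>2 = 1 / (2 * c)" using assms by (auto simp: s_def)
  have "integrable lborel (\<lambda>t. sqrt (2 * pi * s\<^sup>2) * normal_density 0 s t)"
    using s(1) by (intro integrable_mult_right integrable_normal_density)
  also have "(\<lambda>t. sqrt (2 * pi * s\<^sup>2) * normal_density 0 s t) = (\<lambda>t. exp (- c * t\<^sup>2))"
    using assms s by (auto simp: normal_density_def fun_eq_iff)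
  finally show ?thesis .
qed

text \<open>Convexity is read off from a monotone first derivative by the mean value theorem,
  because the potentials below need not be twice differentiable.\<close>

lemma tangent_le_if_deriv_mono:
  fixes f f' :: "real \<Rightarrow> real"
  assumes d: "\<And>t. (f has_real_derivative f' t) (at t)" and m: "\<And>s t. s \<le> t \<Longrightarrow> f' s \<le> f' t"
  shows "f s + f' s * (t - s) \<le> f t"
proof (cases s t rule: linorder_cases)
  case less
  obtain z where "s < z" "z < t" "f t - f s = (t - s) * f' z"
    using MVT2[OF less, of f f'] d by auto
  moreover have "(t - s) * f' s \<le> (t - s) * f' z"
    using less m[of s z] \<open>s < z\<close> by (intro mult_left_mono) auto
  ultimately show ?thesis by (simp add: algebra_simps)
next
  case greater
  obtain z where "t < z" "z < s" "f s - f t = (s - t) * f' z"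
    using MVT2[OF greater, of f f'] d by auto
  moreover have "(s - t) * f' z \<le> (s - t) * f' s"
    using greater m[of z s] \<open>z < s\<close> by (intro mult_left_mono) auto
  ultimately show ?thesis by (simp add: algebra_simps)
qed simp

text \<open>The bounds \<epsilon> and L for the second derivative, imposed on increments of the
  first one: marginals are only known to be \<open>C^1\<close> with Lipschitz derivative.\<close>

definition pot1 :: "real \<Rightarrow> real \<Rightarrow> (real \<Rightarrow> real) \<Rightarrow> (real \<Rightarrow> real) \<Rightarrow> bool"
  where "pot1 \<epsilon> L W W' \<longleftrightarrow> 0 < \<epsilon> \<and> (\<forall>t. (W has_real_derivative W' t) (at t)) \<and>
    (\<forall>s t. s \<le> t \<longrightarrow> \<epsilon> * (t - s) \<le> W' t - W' s \<and> W' t - W' s \<le> L * (t - s))"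

definition part1 :: "(real \<Rightarrow> real) \<Rightarrow> real"
  where "part1 W = (LINT t|lborel. exp (- W t))"

definition gibbs1 :: "(real \<Rightarrow> real) \<Rightarrow> real \<Rightarrow> real"
  where "gibbs1 W t = exp (- W t) / part1 W"

definition nu :: "(real \<Rightarrow> real) \<Rightarrow> real measure"
  where "nu W = density lborel (\<lambda>t. ennreal (gibbs1 W t))"

text \<open>A class of observables that are integrable against every \<open>exp (- W t)\<close>; its
  closure rules replace separate convergence proofs.\<close>

definition quad_growth1 :: "(real \<Rightarrow> real) \<Rightarrow> bool"
  where "quad_growth1 f \<longleftrightarrow> f \<in> borel_measurable borel \<and> (\<exists>K. \<forall>t. \<bar>f t\<bar> \<le> K * (1 + t\<^sup>2))"

lemma quad_growth1I:
  "f \<in> borel_measurable borel \<Longrightarrow> (\<And>t. \<bar>f t\<bar> \<le> K * (1 + t\<^sup>2)) \<Longrightarrow> quad_growth1 f"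
  by (auto simp: quad_growth1_def)

context
  fixes \<epsilon> L :: real and W W' :: "real \<Rightarrow> real"
  assumes pot: "pot1 \<epsilon> L W W'"
begin

lemma pot1_deriv: "(W has_real_derivative W' t) (at t)"
  using pot unfolding pot1_def by blast

lemma pot1_slope: "s \<le> t \<Longrightarrow> \<epsilon> * (t - s) \<le> W' t - W' s" "s \<le> t \<Longrightarrow> W' t - W' s \<le> L * (t - s)"
  using pot unfolding pot1_def by blast+

lemma pot1_pos: "0 < \<epsilon>" "0 < L"
proof -
  show "0 < \<epsilon>" using pot unfolding pot1_def by blast
  then show "0 < L" using pot1_slope[of 0 1] by simp
qed

lemma pot1_lipschitz: "\<bar>W' s - W' t\<bar> \<le> L * \<bar>s - t\<bar>"
proof (cases "s \<le> t")
  case True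
  moreover from True have "0 \<le> \<epsilon> * (t - s)" using pot1_pos by simp
  ultimately show ?thesis using pot1_slope[of s t] by (simp add: abs_if)
next
  case False
  moreover from False have "0 \<le> \<epsilon> * (s - t)" using pot1_pos by simp
  ultimately show ?thesis using pot1_slope[of t s] by (simp add: abs_if)
qed

text \<open>Both halves are tangent line inequalities, one for \<open>W\<close> minus a parabola of
  curvature \<epsilon>, one for a parabola of curvature L minus \<open>W\<close>.\<close>

lemma pot1_quad:
  "\<epsilon> / 2 * (t - s)\<^sup>2 \<le> W t - W s - W' s * (t - s)"
  "W t - W s - W' s * (t - s) \<le> L / 2 * (t - s)\<^sup>2"
proof -
  have "(W s - \<epsilon> / 2 * s\<^sup>2) + (W' s - \<epsilon> * s) * (t - s) \<le> W t - \<epsilon> / 2 * t\<^sup>2"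
    by (rule tangent_le_if_deriv_mono[of "\<lambda>t. W t - \<epsilon> / 2 * t\<^sup>2" "\<lambda>t. W' t - \<epsilon> * t"])
       (use pot1_slope in \<open>auto intro!: derivative_eq_intros pot1_deriv simp: algebra_simps\<close>)
  then show "\<epsilon> / 2 * (t - s)\<^sup>2 \<le> W t - W s - W' s * (t - s)"
    by (simp add: algebra_simps power2_eq_square)
  have "(L / 2 * s\<^sup>2 - W s) + (L * s - W' s) * (t - s) \<le> L / 2 * t\<^sup>2 - W t"
    by (rule tangent_le_if_deriv_mono[of "\<lambda>t. L / 2 * t\<^sup>2 - W t" "\<lambda>t. L * t - W' t"])
       (use pot1_slope in \<open>auto intro!: derivative_eq_intros pot1_deriv simp: algebra_simps\<close>)
  then show "W t - W s - W' s * (t - s) \<le> L / 2 * (t - s)\<^sup>2"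
    by (simp add: algebra_simps power2_eq_square)
qed

lemma pot1_isCont: "isCont W t" "isCont W' t"
proof -
  show "isCont W t" using pot1_deriv by (rule DERIV_isCont)
  have "((\<lambda>s. L * \<bar>s - t\<bar>) \<longlongrightarrow> 0) (at t)" by (auto intro!: tendsto_eq_intros)
  then have "((\<lambda>s. W' s - W' t) \<longlongrightarrow> 0) (at t)"
    by (rule Lim_null_comparison[rotated]) (use pot1_lipschitz in auto)
  then show "isCont W' t" by (simp add: isCont_def LIM_zero_iff)
qed

lemma pot1_continuous: "continuous_on A W" "continuous_on A W'"
  using pot1_isCont by (auto intro!: continuous_at_imp_continuous_on)

lemma pot1_measurable: "W \<in> borel_measurable borel" "W' \<in> borel_measurable borel"
  using pot1_continuous by (auto intro!: borel_measurable_continuous_onI)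

lemma pot1_slope_linear: "\<bar>W' t\<bar> \<le> \<bar>W' 0\<bar> + L * \<bar>t\<bar>"
  using pot1_lipschitz[of t 0] by simp

text \<open>The rate \<epsilon>/2 of the quadratic lower bound is spent in three portions:
  \<epsilon>/4 absorbs the linear term by completing the square, \<epsilon>/8 absorbs the factor
  \<open>1 + t\<^sup>2\<close>, and \<epsilon>/8 remains.\<close>

lemma pot1_exp_decay: "\<exists>K\<ge>0. \<forall>t. (1 + t\<^sup>2) * exp (- W t) \<le> K * exp (- (\<epsilon> / 8) * t\<^sup>2)"
proof -
  define c where "c = (W' 0)\<^sup>2 / \<epsilon> - W 0"
  have lower: "- W t \<le> c - \<epsilon> / 4 * t\<^sup>2" for t
  proof -
    have "0 \<le> (\<epsilon> / 2 * t + W' 0)\<^sup>2 / \<epsilon>" using pot1_pos by simp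
    also have "\<dots> = \<epsilon> / 4 * t\<^sup>2 + W' 0 * t + (W' 0)\<^sup>2 / \<epsilon>"
      using pot1_pos by (simp add: field_simps power2_eq_square)
    finally show ?thesis using pot1_quad(1)[of t 0] by (simp add: c_def)
  qed
  have "(1 + t\<^sup>2) * exp (- W t) \<le> (1 + 1 / (\<epsilon> / 8)) * exp c * exp (- (\<epsilon> / 8) * t\<^sup>2)" for t
  proof -
    have "(1 + t\<^sup>2) * exp (- W t) \<le> ((1 + 1 / (\<epsilon> / 8)) * exp (\<epsilon> / 8 * t\<^sup>2)) * exp (c - \<epsilon> / 4 * t\<^sup>2)"
      using pot1_pos lower by (intro mult_mono one_plus_le_exp) auto
    also have "\<dots> = (1 + 1 / (\<epsilon> / 8)) * (exp (\<epsilon> / 8 * t\<^sup>2) * exp (c - \<epsilon> / 4 * t\<^sup>2))" by simp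
    also have "exp (\<epsilon> / 8 * t\<^sup>2) * exp (c - \<epsilon> / 4 * t\<^sup>2) = exp c * exp (- (\<epsilon> / 8) * t\<^sup>2)"
      by (simp add: exp_add[symmetric] field_simps)
    finally show ?thesis by simp
  qed
  then show ?thesis using pot1_pos by (intro exI[of _ "(1 + 1 / (\<epsilon> / 8)) * exp c"]) auto
qed

lemma integrable_quad_growth1_exp:
  assumes "quad_growth1 f"
  shows "integrable lborel (\<lambda>t. f t * exp (- W t))"
proof -
  obtain C where C: "\<And>t. \<bar>f t\<bar> \<le> C * (1 + t\<^sup>2)" and [measurable]: "f \<in> borel_measurable borel"
    using assms by (auto simp: quad_growth1_def)
  note [measurable] = pot1_measurable
  obtain K where K: "\<And>t. (1 + t\<^sup>2) * exp (- W t) \<le> K * exp (- (\<epsilon> / 8) * t\<^sup>2)"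
    using pot1_exp_decay by blast
  have "0 \<le> C" using C[of 0] by simp
  have "integrable lborel (\<lambda>t::real. C * (K * exp (- (\<epsilon> / 8) * t\<^sup>2)))"
    using pot1_pos by (intro integrable_mult_right integrable_gaussian_exp) auto
  then show ?thesis
  proof (rule Bochner_Integration.integrable_bound)
    show "AE t in lborel. norm (f t * exp (- W t)) \<le> norm (C * (K * exp (- (\<epsilon> / 8) * t\<^sup>2)))"
    proof (rule AE_I2)
      fix t
      have "norm (f t * exp (- W t)) \<le> C * (1 + t\<^sup>2) * exp (- W t)"
        using C[of t] by (simp add: abs_mult)
      also have "\<dots> \<le> C * (K * exp (- (\<epsilon> / 8) * t\<^sup>2))"
        using mult_left_mono[OF K[of t] \<open>0 \<le> C\<close>] by (simp add: mult.assoc)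
      finally show "norm (f t * exp (- W t)) \<le> norm (C * (K * exp (- (\<epsilon> / 8) * t\<^sup>2)))"
        by (rule order_trans) simp
    qed
  qed simp
qed

lemma integrable_exp_pot1: "integrable lborel (\<lambda>t. exp (- W t))"
  using integrable_quad_growth1_exp[OF quad_growth1I[of "\<lambda>_. 1" 1]] by simp

lemma part1_pos: "0 < part1 W"
  unfolding part1_def
  using integrable_exp_pot1 by (intro pos_density_normalize(1)) (auto intro!: continuous_intros pot1_continuous)

lemma pos_density_gibbs1: "pos_density (gibbs1 W)"
  unfolding gibbs1_def[abs_def] part1_def
  using integrable_exp_pot1 by (intro pos_density_normalize(2)) (auto intro!: continuous_intros pot1_continuous)

lemma gibbs1_measurable: "gibbs1 W \<in> borel_measurable borel"
  using pos_densityD(5)[OF pos_density_gibbs1] .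

lemma gibbs1_pos: "0 < gibbs1 W t"
  using pos_densityD(1)[OF pos_density_gibbs1] .

lemma prob_space_nu: "prob_space (nu W)"
proof -
  interpret real_distribution "nu W"
    unfolding nu_def by (rule real_distribution_density[OF pos_density_gibbs1])
  show ?thesis by unfold_locales
qed

lemma sets_nu: "sets (nu W) = sets borel"
  by (simp add: nu_def)

lemma integrable_nu_iff:
  "f \<in> borel_measurable borel \<Longrightarrow> integrable (nu W) f \<longleftrightarrow> integrable lborel (\<lambda>t. f t * exp (- W t))"
proof -
  assume [measurable]: "f \<in> borel_measurable borel"
  note [measurable] = gibbs1_measurable
  have "integrable (nu W) f \<longleftrightarrow> integrable lborel (\<lambda>t. gibbs1 W t * f t)"
    unfolding nu_def using gibbs1_pos by (subst integrable_density) (auto intro: less_imp_le)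
  also have "(\<lambda>t. gibbs1 W t * f t) = (\<lambda>t. (1 / part1 W) * (f t * exp (- W t)))"
    by (auto simp: gibbs1_def)
  also have "integrable lborel \<dots> \<longleftrightarrow> integrable lborel (\<lambda>t. f t * exp (- W t))"
    using part1_pos integrable_mult_left_iff[of lborel "1 / part1 W" "\<lambda>t. f t * exp (- W t)"] by simp
  finally show ?thesis .
qed

lemma integral_nu:
  assumes [measurable]: "f \<in> borel_measurable borel"
  shows "(LINT t|nu W. f t) = (LINT t|lborel. f t * exp (- W t)) / part1 W"
proof -
  note [measurable] = gibbs1_measurable
  have "(LINT t|nu W. f t) = (LINT t|lborel. gibbs1 W t * f t)"
    unfolding nu_def using gibbs1_pos by (subst integral_density) (auto intro: less_imp_le)
  also have "\<dots> = (LINT t|lborel. (1 / part1 W) * (f t * exp (- W t)))"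
    by (intro Bochner_Integration.integral_cong) (auto simp: gibbs1_def)
  finally show ?thesis by simp
qed

lemma integrable_nu_quad_growth1: "quad_growth1 f \<Longrightarrow> integrable (nu W) f"
  by (subst integrable_nu_iff) (simp_all add: integrable_quad_growth1_exp quad_growth1_def)

end

section \<open>Exhaustion by intervals and integration by parts\<close>

lemma tendsto_integral_Icc:
  fixes f :: "real \<Rightarrow> real"
  assumes "integrable lborel f"
  shows "(\<lambda>n. LINT t|lborel. f t * indicator {c - real n..c + real n} t) \<longlonglongrightarrow> (LINT t|lborel. f t)"
proof (rule integral_dominated_convergence[where w = "\<lambda>t. \<bar>f t\<bar>"])
  show "AE t in lborel. (\<lambda>n. f t * indicator {c - real n..c + real n} t) \<longlonglongrightarrow> f t"
  proof (rule AE_I2)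
    fix t
    have "\<forall>\<^sub>F n in sequentially. f t * indicator {c - real n..c + real n} t = f t"
      using eventually_ge_at_top[of "nat \<lceil>\<bar>t - c\<bar>\<rceil>"]
    proof eventually_elim
      case (elim n)
      then have "\<bar>t - c\<bar> \<le> real n" by linarith
      then show ?case by (auto simp: indicator_def abs_le_iff)
    qed
    then show "(\<lambda>n. f t * indicator {c - real n..c + real n} t) \<longlonglongrightarrow> f t" by (rule tendsto_eventually)
  qed
qed (use assms in \<open>auto split: split_indicator\<close>)

lemma integral_deriv_eq_0:
  fixes k k' :: "real \<Rightarrow> real"
  assumes d: "\<And>t. (k has_real_derivative k' t) (at t)" and c: "\<And>t. isCont k' t"
    and i: "integrable lborel k'"
    and lim: "(\<lambda>n. k (real n)) \<longlonglongrightarrow> 0" "(\<lambda>n. k (- real n)) \<longlonglongrightarrow> 0"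
  shows "(LINT t|lborel. k' t) = 0"
proof -
  have "(\<lambda>n. LINT t|lborel. k' t * indicator {- real n..real n} t) \<longlonglongrightarrow> (LINT t|lborel. k' t)"
    using tendsto_integral_Icc[OF i, of 0] by simp
  moreover have "(LINT t|lborel. k' t * indicator {- real n..real n} t) = k (real n) - k (- real n)" for n
    by (rule integral_FTC_Icc_real) (use d c in auto)
  moreover have "(\<lambda>n. k (real n) - k (- real n)) \<longlonglongrightarrow> 0 - 0"
    by (intro tendsto_diff lim)
  ultimately show ?thesis using LIMSEQ_unique by fastforce
qed

text \<open>The derivative of \<open>u t * exp (- W t)\<close> is the difference of the two
  integrands times the weight, and Gaussian decay removes the boundary terms. It is applied to the
  displacement of the transport, to trade the mean of its slope for a mean without derivatives of
  the transport.\<close>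

lemma integral_by_parts_nu:
  assumes pot: "pot1 \<epsilon> L W W'"
    and d: "\<And>t. (u has_real_derivative u' t) (at t)" and c: "\<And>t. isCont u' t"
    and q: "quad_growth1 u" "quad_growth1 u'" "quad_growth1 (\<lambda>t. W' t * u t)"
  shows "(LINT t|nu W. u' t) = (LINT t|nu W. W' t * u t)"
proof -
  note [measurable] = pot1_measurable[OF pot]
  have m [measurable]: "u \<in> borel_measurable borel" "u' \<in> borel_measurable borel"
    using q by (auto simp: quad_growth1_def)
  define k where "k t = u t * exp (- W t)" for t
  define k' where "k' t = u' t * exp (- W t) - W' t * u t * exp (- W t)" for t
  have i: "integrable lborel (\<lambda>t. u' t * exp (- W t))" "integrable lborel (\<lambda>t. W' t * u t * exp (- W t))"
    using q by (auto intro!: integrable_quad_growth1_exp[OF pot])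
  have "(LINT t|lborel. k' t) = 0"
  proof (rule integral_deriv_eq_0[of k])
    show "(k has_real_derivative k' t) (at t)" for t
      unfolding k_def k'_def
      by (auto intro!: derivative_eq_intros d pot1_deriv[OF pot] simp: algebra_simps)
    show "isCont k' t" for t
      unfolding k'_def using d[THEN DERIV_isCont]
      by (intro continuous_intros c pot1_isCont[OF pot]) auto
    show "integrable lborel k'" unfolding k'_def using i by simp
    obtain C where C: "\<And>t. \<bar>u t\<bar> \<le> C * (1 + t\<^sup>2)" using q(1) by (auto simp: quad_growth1_def)
    obtain K where K: "\<And>t. (1 + t\<^sup>2) * exp (- W t) \<le> K * exp (- (\<epsilon> / 8) * t\<^sup>2)"
      using pot1_exp_decay[OF pot] by blast
    have "0 \<le> C" using C[of 0] by simp
    have b: "\<bar>k t\<bar> \<le> C * K * exp (- (\<epsilon> / 8) * t\<^sup>2)" for t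
    proof -
      have "\<bar>k t\<bar> \<le> C * (1 + t\<^sup>2) * exp (- W t)" using C[of t] by (simp add: k_def abs_mult)
      also have "\<dots> \<le> C * (K * exp (- (\<epsilon> / 8) * t\<^sup>2))"
        using mult_left_mono[OF K[of t] \<open>0 \<le> C\<close>] by (simp add: mult.assoc)
      finally show ?thesis by (simp add: mult.assoc)
    qed
    have "filterlim (\<lambda>n. \<epsilon> / 8 * (real n)\<^sup>2) at_top sequentially"
      using pot1_pos(1)[OF pot] by real_asymp
    then have "(\<lambda>n. exp (- (\<epsilon> / 8 * (real n)\<^sup>2))) \<longlonglongrightarrow> 0"
      by (intro filterlim_compose[OF exp_at_bot] filterlim_compose[OF filterlim_uminus_at_bot_at_top])
    then have "(\<lambda>n. C * K * exp (- (\<epsilon> / 8) * (real n)\<^sup>2)) \<longlonglongrightarrow> 0"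
      by (intro tendsto_mult_right_zero) simp
    note lim = Lim_null_comparison[OF always_eventually[OF allI] this]
    show "(\<lambda>n. k (real n)) \<longlonglongrightarrow> 0"
      by (rule lim) (use b[of "real n" for n] in simp)
    show "(\<lambda>n. k (- real n)) \<longlonglongrightarrow> 0"
      by (rule lim) (use b[of "- real n" for n] in simp)
  qed
  then show ?thesis
    using i m by (simp add: integral_nu[OF pot] k'_def)
qed

text \<open>Compare with a Gaussian of variance \<open>1 / L\<close> whose distribution function agrees at \<open>z\<close>. The
  quotient of the densities is log-convex, so if it exceeds \<open>1\<close> at \<open>z\<close>, it does so on a half-line
  ending at \<open>z\<close>, although both densities have the same mass there.\<close>

lemma transport_deriv_le_sqrt:
  assumes pot: "pot1 \<epsilon> L W W'"
  shows "gibbs1 W z \<le> sqrt L * std_normal_density (transport (gibbs1 W) std_normal_density z)"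
proof (rule ccontr)
  assume contra: "\<not> ?thesis"
  note fpos = pos_density_gibbs1[OF pot]
  have npos: "pos_density std_normal_density"
    by (auto simp: pos_density_def integrable_normal_density integral_normal_density normal_density_pos
        intro!: continuous_intros) (auto simp: normal_density_def[abs_def] intro!: continuous_intros)
  note L = pot1_pos(2)[OF pot] and Z = part1_pos[OF pot]
  define T where "T = transport (gibbs1 W) std_normal_density z"
  define a where "a = z - T / sqrt L"
  define A where "A x = sqrt L * (x - a)" for x
  have Az: "A z = T" using L by (simp add: A_def a_def)
  define D where "D x = density_cdf (gibbs1 W) x - density_cdf std_normal_density (A x)" for x
  \<comment> \<open>Logarithm of the quotient of \<open>gibbs1 W\<close> by the comparison density
    \<open>sqrt L * std_normal_density (A x)\<close>. The centre \<open>a\<close> is chosen so that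
    \<open>A z = T\<close>, which makes the two distribution functions agree at
    \<open>z\<close>.\<close>
  define \<kappa> where "\<kappa> x = - W x - ln (part1 W) + (A x)\<^sup>2 / 2 + ln (sqrt (2 * pi)) - ln (sqrt L)" for x
  define s where "s = - W' z + L * (z - a)"
  have "D z = 0" using density_cdf_transport[OF fpos npos] by (simp add: D_def Az T_def)
  have D': "(D has_real_derivative gibbs1 W x - sqrt L * std_normal_density (A x)) (at x)" for x
  proof -
    have "(A has_real_derivative sqrt L) (at x)" unfolding A_def by (auto intro!: derivative_eq_intros)
    from DERIV_chain2[OF density_cdf_deriv[OF npos] this] density_cdf_deriv[OF fpos, of x]
    show ?thesis unfolding D_def by (subst mult.commute) (intro DERIV_diff)
  qed
  have \<kappa>: "gibbs1 W x = sqrt L * std_normal_density (A x) * exp (\<kappa> x)" for x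
  proof -
    have "exp (\<kappa> x) = exp (- W x) / part1 W * exp ((A x)\<^sup>2 / 2) * sqrt (2 * pi) / sqrt L"
      using L Z by (simp only: \<kappa>_def exp_add exp_diff exp_ln real_sqrt_gt_0_iff pi_gt_zero zero_less_mult_iff zero_less_numeral simp_thms)
    moreover have "exp (- (A x)\<^sup>2 / 2) * exp ((A x)\<^sup>2 / 2) = 1" by (simp add: exp_add[symmetric])
    moreover have "gibbs1 W x = sqrt L * (1 / sqrt (2 * pi) * u) * (exp (- W x) / part1 W * v * sqrt (2 * pi) / sqrt L)"
      if "u * v = 1" for u v :: real
    proof -
      have "sqrt L * (1 / sqrt (2 * pi) * u) * (exp (- W x) / part1 W * v * sqrt (2 * pi) / sqrt L)
          = (u * v) * exp (- W x) / part1 W" using L by (simp add: field_simps)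
      then show ?thesis using that by (simp add: gibbs1_def)
    qed
    ultimately show ?thesis by (simp only: std_normal_density_def)
  qed
  have "\<kappa> z > 0"
  proof -
    have p: "0 < sqrt L * std_normal_density (A z)" using L by (simp add: normal_density_pos)
    have "sqrt L * std_normal_density (A z) < sqrt L * std_normal_density (A z) * exp (\<kappa> z)"
      using contra \<kappa>[of z] by (simp add: Az T_def)
    then have "1 < exp (\<kappa> z)" using mult_less_cancel_left_pos[OF p, of 1 "exp (\<kappa> z)"] by (simp only: mult_1_right)
    then show ?thesis by simp
  qed
  \<comment> \<open>The curvature L of \<open>(A x)\<^sup>2 / 2\<close> is at least that of
    \<open>W\<close>, so \<kappa> is convex; \<open>s\<close> is its slope at
    \<open>z\<close>.\<close>
  have tangent: "\<kappa> z + s * (x - z) \<le> \<kappa> x" for x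
  proof -
    have sq: "(A y)\<^sup>2 = L * (y - a)\<^sup>2" for y using L by (simp add: A_def power_mult_distrib)
    have "L / 2 * (x - a)\<^sup>2 - L / 2 * (z - a)\<^sup>2 = L / 2 * (x - z)\<^sup>2 + L * (z - a) * (x - z)"
      by (simp add: algebra_simps power2_eq_square)
    then show ?thesis using pot1_quad(2)[OF pot, of x z]
      by (simp add: \<kappa>_def s_def sq algebra_simps)
  qed
  have Dpos: "0 < gibbs1 W x - sqrt L * std_normal_density (A x)" if "0 \<le> s * (x - z)" for x
  proof -
    have "0 < \<kappa> x" using tangent[of x] that \<open>\<kappa> z > 0\<close> by simp
    moreover have "0 < sqrt L * std_normal_density (A x)" using L by (simp add: normal_density_pos)
    ultimately show ?thesis unfolding \<kappa>[of x]
      using mult_strict_left_mono[of 1 "exp (\<kappa> x)" "sqrt L * std_normal_density (A x)"] by simp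
  qed
  have limA: "filterlim A at_top at_top" "filterlim A at_bot at_bot"
    unfolding A_def using L by real_asymp+
  show False
  \<comment> \<open>The sign of \<open>s\<close> decides on which side of \<open>z\<close> the
    quotient stays above 1. On that side \<open>D\<close> moves away from its value 0 at
    \<open>z\<close> and cannot return to its limit 0 at infinity.\<close>
  proof (cases "0 \<le> s")
    case True
    have "D z < D (z + 1)"
      by (rule DERIV_pos_imp_increasing[of z "z + 1" D]) (use D' Dpos True in \<open>auto intro!: exI\<close>)
    moreover have "D (z + 1) \<le> D x" if "z + 1 \<le> x" for x
      using that by (rule deriv_nonneg_imp_mono[OF D', rotated]) (use Dpos True in \<open>auto intro!: less_imp_le\<close>)
    then have "\<forall>\<^sub>F x in at_top. D (z + 1) \<le> D x"
      using eventually_ge_at_top[of "z+1"] by (rule eventually_mono[rotated])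
    moreover have "(D \<longlongrightarrow> 1 - 1) at_top"
      unfolding D_def by (intro tendsto_diff density_cdf_limits fpos
          filterlim_compose[OF density_cdf_limits(1)[OF npos] limA(1)])
    ultimately have "D (z + 1) \<le> 1 - 1"
      by (intro tendsto_lowerbound) auto
    then show False using \<open>D z < D (z+1)\<close> \<open>D z = 0\<close> by simp
  next
    case False
    have DposF: "0 < gibbs1 W x - sqrt L * std_normal_density (A x)" if "x \<le> z" for x
      by (rule Dpos) (use False that in \<open>auto intro: mult_nonpos_nonpos\<close>)
    have "D (z - 1) < D z"
      by (rule DERIV_pos_imp_increasing[of "z - 1" z D]) (use D' DposF in \<open>auto intro!: exI\<close>)
    moreover have "D x \<le> D (z - 1)" if "x \<le> z - 1" for x
      using that by (rule deriv_nonneg_imp_mono[OF D', rotated]) (use DposF in \<open>auto intro!: less_imp_le\<close>)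
    then have "\<forall>\<^sub>F x in at_bot. D x \<le> D (z - 1)"
      using eventually_le_at_bot[of "z-1"] by (rule eventually_mono[rotated])
    moreover have "(D \<longlongrightarrow> 0 - 0) at_bot"
      unfolding D_def by (intro tendsto_diff density_cdf_limits fpos
          filterlim_compose[OF density_cdf_limits(2)[OF npos] limA(2)])
    ultimately have "0 - 0 \<le> D (z - 1)"
      by (intro tendsto_upperbound) auto
    then show False using \<open>D (z - 1) < D z\<close> \<open>D z = 0\<close> by simp
  qed
qed

section \<open>Poincare inequality and deficit on the line\<close>

text \<open>The integrand dominates the derivative of \<open>(u t - u x0)\<^sup>2 / (t - x0) * exp (- W t)\<close>, which has the
  sign of \<open>t - x0\<close> and is continuous at \<open>x0\<close>, since division by zero gives \<open>0\<close>.\<close>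

lemma poincare_1d_aux:
  fixes u u' :: "real \<Rightarrow> real"
  assumes pot: "pot1 \<epsilon> L W W'" and x0: "W' x0 = 0" and b: "0 \<le> b"
    and d: "\<And>t. (u has_real_derivative u' t) (at t)"
    and i: "set_integrable lborel {x0 - b..x0 + b} (\<lambda>t. ((u' t)\<^sup>2 - \<epsilon> * (u t - u x0)\<^sup>2) * exp (- W t))"
  shows "0 \<le> (LINT t:{x0 - b..x0 + b}|lborel. ((u' t)\<^sup>2 - \<epsilon> * (u t - u x0)\<^sup>2) * exp (- W t))"
proof -
  define \<phi> where "\<phi> t = u t - u x0" for t
  define F where "F y = (\<phi> y)\<^sup>2 / (y - x0) * exp (- W y)" for y
  define f where "f y = (2 * \<phi> y * u' y / (y - x0) - (\<phi> y)\<^sup>2 / (y - x0)\<^sup>2 - (\<phi> y)\<^sup>2 * W' y / (y - x0)) * exp (- W y)" for y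
  define f2 where "f2 y = ((u' y)\<^sup>2 - \<epsilon> * (\<phi> y)\<^sup>2) * exp (- W y)" for y
  have \<phi>d: "(\<phi> has_real_derivative u' t) (at t)" for t
    unfolding \<phi>_def by (auto intro!: derivative_eq_intros d)
  have Fd: "(F has_real_derivative f y) (at y)" if "y \<noteq> x0" for y
  proof -
    have 1: "((\<lambda>y. (\<phi> y)\<^sup>2) has_real_derivative 2 * \<phi> y * u' y) (at y)"
      by (auto intro!: derivative_eq_intros \<phi>d)
    have 2: "((\<lambda>y. exp (- W y)) has_real_derivative exp (- W y) * (- W' y)) (at y)"
      by (auto intro!: derivative_eq_intros pot1_deriv[OF pot])
    have 3: "((\<lambda>y. y - x0) has_real_derivative 1) (at y)"
      by (auto intro!: derivative_eq_intros)
    have "(F has_real_derivative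
       ((2 * \<phi> y * u' y) * (y - x0) - (\<phi> y)\<^sup>2 * 1) / ((y - x0) * (y - x0)) * exp (- W y)
         + (\<phi> y)\<^sup>2 / (y - x0) * (exp (- W y) * (- W' y))) (at y)"
      unfolding F_def
      by (rule DERIV_cong[OF DERIV_mult[OF DERIV_divide[OF 1 3] 2]]) (use that in \<open>auto simp: mult.commute\<close>)
    moreover have "((2 * p * v) * r - p\<^sup>2 * 1) / (r * r) * e + p\<^sup>2 / r * (e * (- w)) =
        (2 * p * v / r - p\<^sup>2 / r\<^sup>2 - p\<^sup>2 * w / r) * e" if "r \<noteq> 0" for p v r w e :: real
      using that by (simp add: power2_eq_square field_simps)
    from this[of "y - x0"] that have "((2 * \<phi> y * u' y) * (y - x0) - (\<phi> y)\<^sup>2 * 1) / ((y - x0) * (y - x0)) * exp (- W y)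
         + (\<phi> y)\<^sup>2 / (y - x0) * (exp (- W y) * (- W' y)) = f y"
      unfolding f_def by simp
    ultimately show ?thesis by simp
  qed
  have Fc0: "isCont F x0"
  proof -
    have "((\<lambda>y. \<phi> y * ((u y - u x0) / (y - x0)) * exp (- W y)) \<longlongrightarrow> 0 * u' x0 * exp (- W x0)) (at x0)"
    proof (intro tendsto_intros)
      show "(\<phi> \<longlongrightarrow> 0) (at x0)" using DERIV_isCont[OF \<phi>d, of x0] by (simp add: isCont_def \<phi>_def)
      show "((\<lambda>y. (u y - u x0) / (y - x0)) \<longlongrightarrow> u' x0) (at x0)"
        using d[of x0] by (simp add: has_field_derivative_iff)
      show "(W \<longlongrightarrow> W x0) (at x0)" using pot1_isCont(1)[OF pot] by (simp add: isCont_def)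
    qed
    then show ?thesis
      by (simp add: isCont_def F_def[abs_def] \<phi>_def power2_eq_square)
  qed
  have h1: "(f has_integral F (x0 + b) - F (x0 - b)) {x0 - b..x0 + b}"
  proof (rule fundamental_theorem_of_calculus_interior_strong[of "{x0}"])
    show "(F has_vector_derivative f x) (at x)" if "x \<in> {x0 - b<..<x0 + b} - {x0}" for x
      using Fd[of x] that by (simp add: has_real_derivative_iff_has_vector_derivative)
    have "isCont F x" for x using Fd[of x] Fc0 by (cases "x = x0") (auto intro: DERIV_isCont)
    then show "continuous_on {x0 - b..x0 + b} F" by (auto intro!: continuous_at_imp_continuous_on)
  qed (use b in auto)
  have h2: "(f2 has_integral (LINT t:{x0 - b..x0 + b}|lborel. f2 t)) {x0 - b..x0 + b}"
    using set_borel_integral_eq_integral[of "{x0 - b..x0 + b}" f2] i unfolding f2_def \<phi>_def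
    by (simp add: has_integral_integral)
  \<comment> \<open>With \<open>q\<close> the difference quotient of \<open>u\<close> at
    \<open>x0\<close>, the first two terms of \<open>f\<close> are
    \<open>2 * q * u' y - q\<^sup>2\<close>, at most \<open>(u' y)\<^sup>2\<close>. The third term
    is controlled by \<open>W' y / (y - x0) \<ge> \<epsilon>\<close>, which holds because
    \<open>W'\<close> vanishes at \<open>x0\<close>.\<close>
  have h3: "f y \<le> f2 y" for y
  proof (cases "y = x0")
    case True
    then show ?thesis by (simp add: f_def f2_def \<phi>_def)
  next
    case False
    define q where "q = \<phi> y / (y - x0)"
    have "\<epsilon> \<le> W' y / (y - x0)"
    proof (cases "x0 < y")
      case True
      then show ?thesis using pot1_slope(1)[OF pot, of x0 y] x0 by (simp add: pos_le_divide_eq)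
    next
      case False
      then show ?thesis using pot1_slope(1)[OF pot, of y x0] x0 \<open>y \<noteq> x0\<close>
        by (simp add: neg_le_divide_eq algebra_simps)
    qed
    then have "\<epsilon> * (\<phi> y)\<^sup>2 \<le> (\<phi> y)\<^sup>2 * W' y / (y - x0)"
      using mult_right_mono[of \<epsilon> "W' y / (y - x0)" "(\<phi> y)\<^sup>2"] by (simp add: mult.commute)
    moreover have "2 * q * u' y - q\<^sup>2 \<le> (u' y)\<^sup>2"
      using zero_le_power2[of "u' y - q"] by (simp add: power2_diff algebra_simps)
    ultimately show ?thesis
      unfolding f_def f2_def
      by (intro mult_right_mono) (auto simp: q_def power_divide)
  qed
  have "F (x0 + b) - F (x0 - b) \<le> (LINT t:{x0 - b..x0 + b}|lborel. f2 t)"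
    by (rule has_integral_le[OF h1 h2 h3])
  moreover have "0 \<le> F (x0 + b)" "F (x0 - b) \<le> 0"
    using b by (auto simp: F_def mult_nonneg_nonneg mult_nonpos_nonneg divide_nonneg_nonpos)
  ultimately show ?thesis by (simp add: f2_def \<phi>_def)
qed

lemma pot1_critical_point:
  assumes pot: "pot1 \<epsilon> L W W'"
  shows "\<exists>x. W' x = 0"
proof -
  \<comment> \<open>Over this length an increase at rate at least \<epsilon> outweighs
    \<open>W' 0\<close>, so \<open>W'\<close> changes sign on \<open>{- b..b}\<close>.\<close>
  define b where "b = \<bar>W' 0\<bar> / \<epsilon>"
  have b: "0 \<le> b" "\<epsilon> * b = \<bar>W' 0\<bar>" using pot1_pos[OF pot] by (auto simp: b_def)
  have "0 \<le> W' b" "W' (- b) \<le> 0"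
    using pot1_slope(1)[OF pot, of 0 b] pot1_slope(1)[OF pot, of "- b" 0] b by auto
  then show ?thesis
    using IVT[of W' "- b" 0 b] pot1_isCont(2)[OF pot] b by auto
qed

text \<open>The local estimate is exhausted by intervals centred at a critical point
  \<open>x0\<close> of \<open>W\<close>. Its boundary terms have a favourable sign, so integrability
  of the two squares is the only growth condition. Centring at \<open>u x0\<close> in place of the
  mean can only increase the mean square.\<close>

lemma poincare_1d:
  fixes u u' :: "real \<Rightarrow> real"
  assumes pot: "pot1 \<epsilon> L W W'"
    and d: "\<And>t. (u has_real_derivative u' t) (at t)"
    and i: "integrable (nu W) (\<lambda>t. (u t)\<^sup>2)" "integrable (nu W) (\<lambda>t. (u' t)\<^sup>2)"
  shows "(LINT t|nu W. (u t)\<^sup>2) - (LINT t|nu W. u t)\<^sup>2 \<le> (LINT t|nu W. (u' t)\<^sup>2) / \<epsilon>"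
proof -
  interpret prob_space "nu W" by (rule prob_space_nu[OF pot])
  obtain x0 where x0: "W' x0 = 0" using pot1_critical_point[OF pot] by blast
  have [measurable]: "u \<in> borel_measurable borel"
    using d by (auto intro!: borel_measurable_continuous_onI continuous_at_imp_continuous_on DERIV_isCont)
  have u: "integrable (nu W) u"
    by (rule square_integrable_imp_integrable[OF _ i(1)])
       (simp add: measurable_cong_sets[OF sets_nu[OF pot] refl])
  have [measurable]: "(\<lambda>t. (u' t)\<^sup>2) \<in> borel_measurable borel"
    using borel_measurable_integrable[OF i(2)] by (simp add: measurable_cong_sets[OF sets_nu[OF pot] refl])
  define k where "k t = (u' t)\<^sup>2 - \<epsilon> * (u t - u x0)\<^sup>2" for t
  have sq: "(u t - u x0)\<^sup>2 = (u t)\<^sup>2 - 2 * u x0 * u t + (u x0)\<^sup>2" for t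
    by (simp add: power2_diff)
  have i3: "integrable (nu W) (\<lambda>t. (u t - u x0)\<^sup>2)"
    unfolding sq using i u by simp
  have ik: "integrable (nu W) k" unfolding k_def using i3 i by simp
  have [measurable]: "k \<in> borel_measurable borel" unfolding k_def by measurable
  have ikl: "integrable lborel (\<lambda>t. k t * exp (- W t))"
    using ik by (simp add: integrable_nu_iff[OF pot])
  have "0 \<le> (LINT t|lborel. k t * exp (- W t) * indicator {x0 - real n..x0 + real n} t)" for n
  proof -
    have "set_integrable lborel {x0 - real n..x0 + real n} (\<lambda>t. k t * exp (- W t))"
      unfolding set_integrable_def by (rule integrable_mult_indicator[OF _ ikl]) simp
    from poincare_1d_aux[OF pot x0 _ d this[unfolded k_def]] show ?thesis
      by (simp add: set_lebesgue_integral_def k_def mult.commute)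
  qed
  then have "0 \<le> (LINT t|lborel. k t * exp (- W t))"
    by (intro LIMSEQ_le_const[OF tendsto_integral_Icc[OF ikl, of x0]]) auto
  then have "0 \<le> (LINT t|nu W. k t)"
    using part1_pos[OF pot] by (subst integral_nu[OF pot]) auto
  also have "\<dots> = (LINT t|nu W. (u' t)\<^sup>2) - \<epsilon> * (LINT t|nu W. (u t - u x0)\<^sup>2)"
    unfolding k_def using i3 i by simp
  finally have "(LINT t|nu W. (u t - u x0)\<^sup>2) \<le> (LINT t|nu W. (u' t)\<^sup>2) / \<epsilon>"
    using pot1_pos[OF pot] by (simp add: field_simps)
  moreover have "(LINT t|nu W. (u t - u x0)\<^sup>2) = (LINT t|nu W. (u t)\<^sup>2) - 2 * u x0 * (LINT t|nu W. u t) + (u x0)\<^sup>2"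
    unfolding sq using i u prob_space by simp
  moreover have "0 \<le> ((LINT t|nu W. u t) - u x0)\<^sup>2" by simp
  ultimately show ?thesis by (simp add: power2_diff algebra_simps)
qed

section \<open>Growth classes on the line\<close>

definition lin_growth1 :: "(real \<Rightarrow> real) \<Rightarrow> bool"
  where "lin_growth1 f \<longleftrightarrow> f \<in> borel_measurable borel \<and> (\<exists>K. \<forall>t. \<bar>f t\<bar> \<le> K * (1 + \<bar>t\<bar>))"

lemma lin_growth1_mult:
  assumes "lin_growth1 f" "lin_growth1 g"
  shows "quad_growth1 (\<lambda>t. f t * g t)"
proof -
  obtain A B where A: "\<And>t. \<bar>f t\<bar> \<le> A * (1 + \<bar>t\<bar>)" and B: "\<And>t. \<bar>g t\<bar> \<le> B * (1 + \<bar>t\<bar>)"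
    using assms by (auto simp: lin_growth1_def)
  have AB: "0 \<le> A" "0 \<le> B" using A[of 0] B[of 0] by auto
  show ?thesis
  proof (rule quad_growth1I)
    show "(\<lambda>t. f t * g t) \<in> borel_measurable borel" using assms by (auto simp: lin_growth1_def)
    fix t
    have "\<bar>f t * g t\<bar> \<le> (A * (1 + \<bar>t\<bar>)) * (B * (1 + \<bar>t\<bar>))"
      unfolding abs_mult using A B AB by (intro mult_mono) auto
    also have "\<dots> = A * B * (1 + \<bar>t\<bar>)\<^sup>2" by (simp add: power2_eq_square)
    also have "\<dots> \<le> A * B * (2 * (1 + t\<^sup>2))"
    proof (rule mult_left_mono)
      show "(1 + \<bar>t\<bar>)\<^sup>2 \<le> 2 * (1 + t\<^sup>2)"
        using zero_le_power2[of "1 - \<bar>t\<bar>"] by (simp add: power2_sum power2_diff)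
    qed (use AB in simp)
    finally show "\<bar>f t * g t\<bar> \<le> (A * B * 2) * (1 + t\<^sup>2)" by (simp add: mult.assoc)
  qed
qed

lemma quad_growth1_add:
  assumes "quad_growth1 f" "quad_growth1 g"
  shows "quad_growth1 (\<lambda>t. f t + g t)"
proof -
  obtain A B where A: "\<And>t. \<bar>f t\<bar> \<le> A * (1 + t\<^sup>2)" and B: "\<And>t. \<bar>g t\<bar> \<le> B * (1 + t\<^sup>2)"
    using assms by (auto simp: quad_growth1_def)
  show ?thesis
  proof (rule quad_growth1I)
    show "(\<lambda>t. f t + g t) \<in> borel_measurable borel" using assms by (auto simp: quad_growth1_def)
    show "\<bar>f t + g t\<bar> \<le> (A + B) * (1 + t\<^sup>2)" for t
      using A[of t] B[of t] abs_triangle_ineq[of "f t" "g t"] by (simp only: distrib_right)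
  qed
qed

lemma lin_growth1_add:
  assumes "lin_growth1 f" "lin_growth1 g"
  shows "lin_growth1 (\<lambda>t. f t + g t)"
proof -
  obtain A B where A: "\<And>t. \<bar>f t\<bar> \<le> A * (1 + \<bar>t\<bar>)" and B: "\<And>t. \<bar>g t\<bar> \<le> B * (1 + \<bar>t\<bar>)"
    using assms by (auto simp: lin_growth1_def)
  have "\<bar>f t + g t\<bar> \<le> (A + B) * (1 + \<bar>t\<bar>)" for t
    using A[of t] B[of t] abs_triangle_ineq[of "f t" "g t"] by (simp only: distrib_right)
  then show ?thesis using assms by (auto simp: lin_growth1_def)
qed

lemma lin_growth1_cmult:
  assumes "lin_growth1 f"
  shows "lin_growth1 (\<lambda>t. c * f t)"
proof -
  obtain A where A: "\<And>t. \<bar>f t\<bar> \<le> A * (1 + \<bar>t\<bar>)" using assms by (auto simp: lin_growth1_def)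
  have "\<bar>c * f t\<bar> \<le> (\<bar>c\<bar> * A) * (1 + \<bar>t\<bar>)" for t
    using mult_left_mono[OF A[of t], of "\<bar>c\<bar>"] by (simp add: abs_mult mult.assoc)
  then show ?thesis using assms by (auto simp: lin_growth1_def)
qed

lemma lin_growth1_const: "lin_growth1 (\<lambda>t. c)"
proof -
  have "\<bar>c\<bar> \<le> \<bar>c\<bar> * (1 + \<bar>t\<bar>)" for t :: real
    using mult_left_mono[of 1 "1 + \<bar>t\<bar>" "\<bar>c\<bar>"] by simp
  then show ?thesis by (auto simp: lin_growth1_def)
qed

lemma lin_growth1_id: "lin_growth1 (\<lambda>t. t)"
  by (auto simp: lin_growth1_def intro!: exI[of _ 1])

lemma lin_growth1_diff: "lin_growth1 f \<Longrightarrow> lin_growth1 g \<Longrightarrow> lin_growth1 (\<lambda>t. f t - g t)"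
  using lin_growth1_add[of f "\<lambda>t. -1 * g t"] lin_growth1_cmult[of g "-1"] by simp

lemma lin_growth1_imp_quad: "lin_growth1 f \<Longrightarrow> quad_growth1 f"
  using lin_growth1_mult[OF _ lin_growth1_const[of 1], of f] by simp

lemma quad_growth1_cmult: "quad_growth1 f \<Longrightarrow> quad_growth1 (\<lambda>t. c * f t)"
proof -
  assume f: "quad_growth1 f"
  then obtain A where A: "\<And>t. \<bar>f t\<bar> \<le> A * (1 + t\<^sup>2)" by (auto simp: quad_growth1_def)
  have "\<bar>c * f t\<bar> \<le> (\<bar>c\<bar> * A) * (1 + t\<^sup>2)" for t
    using mult_left_mono[OF A[of t], of "\<bar>c\<bar>"] by (simp add: abs_mult mult.assoc)
  then show ?thesis using f by (intro quad_growth1I) (auto simp: quad_growth1_def)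
qed

lemma quad_growth1_diff: "quad_growth1 f \<Longrightarrow> quad_growth1 g \<Longrightarrow> quad_growth1 (\<lambda>t. f t - g t)"
  using quad_growth1_add[of f "\<lambda>t. -1 * g t"] quad_growth1_cmult[of g "-1"] by simp

lemma quad_growth1_const: "quad_growth1 (\<lambda>t. c)"
  by (rule lin_growth1_imp_quad[OF lin_growth1_const])

lemma lin_growth1_power2: "lin_growth1 f \<Longrightarrow> quad_growth1 (\<lambda>t. (f t)\<^sup>2)"
  using lin_growth1_mult[of f f] by (simp add: power2_eq_square)

lemma lin_growth1_pot1_slope:
  assumes pot: "pot1 \<epsilon> L W W'"
  shows "lin_growth1 W'"
proof -
  have "\<bar>W' t\<bar> \<le> (\<bar>W' 0\<bar> + L) * (1 + \<bar>t\<bar>)" for t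
  proof -
    have "0 \<le> \<bar>W' 0\<bar> * \<bar>t\<bar>" by simp
    moreover have "(\<bar>W' 0\<bar> + L) * (1 + \<bar>t\<bar>) = \<bar>W' 0\<bar> + \<bar>W' 0\<bar> * \<bar>t\<bar> + L + L * \<bar>t\<bar>"
      by (simp add: algebra_simps)
    ultimately show ?thesis using pot1_slope_linear[OF pot, of t] pot1_pos(2)[OF pot] by linarith
  qed
  then show ?thesis using pot1_measurable[OF pot] by (auto simp: lin_growth1_def)
qed

lemma quad_growth1_pot1:
  assumes pot: "pot1 \<epsilon> L W W'"
  shows "quad_growth1 W"
proof -
  have "quad_growth1 (\<lambda>t. \<bar>W 0\<bar> + \<bar>W' 0\<bar> * \<bar>t\<bar> + L / 2 * t\<^sup>2)"
    by (intro quad_growth1_add quad_growth1_cmult quad_growth1_const lin_growth1_power2 lin_growth1_id lin_growth1_imp_quad)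
       (auto simp: lin_growth1_def intro!: exI[of _ 1])
  then obtain K where K: "\<And>t. \<bar>\<bar>W 0\<bar> + \<bar>W' 0\<bar> * \<bar>t\<bar> + L / 2 * t\<^sup>2\<bar> \<le> K * (1 + t\<^sup>2)"
    by (auto simp: quad_growth1_def)
  have "\<bar>W t\<bar> \<le> K * (1 + t\<^sup>2)" for t
  proof -
    have "0 \<le> \<epsilon> / 2 * t\<^sup>2" using pot1_pos[OF pot] by simp
    then have "\<bar>W t - W 0 - W' 0 * t\<bar> \<le> L / 2 * t\<^sup>2"
      using pot1_quad[OF pot, of t 0] by simp
    moreover have "\<bar>W' 0 * t\<bar> = \<bar>W' 0\<bar> * \<bar>t\<bar>" by (rule abs_mult)
    ultimately show ?thesis using K[of t] by linarith
  qed
  then show ?thesis using pot1_measurable[OF pot] by (intro quad_growth1I) auto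
qed

section \<open>Deficit and transport cost on the line\<close>

lemma minus_one_minus_ln_ge:
  fixes y R :: real
  assumes "0 < y" "y \<le> R" "1 \<le> R"
  shows "(y - 1)\<^sup>2 / (2 * R) \<le> y - 1 - ln y"
proof -
  define k where "k y = y - 1 - ln y - (y - 1)\<^sup>2 / (2 * R)" for y :: real
  \<comment> \<open>For \<open>y \<le> R\<close> this product has the sign of \<open>y - 1\<close>,
    so \<open>k\<close> is least at 1, where it vanishes. The bound is later used with
    \<open>R = sqrt L\<close>, the largest slope of the transport.\<close>
  have k': "(k has_real_derivative (y - 1) * (1 / y - 1 / R)) (at y)" if "0 < y" for y
    unfolding k_def using that assms by (auto intro!: derivative_eq_intros simp: field_simps)
  have "0 \<le> k y"
  proof (cases "1 \<le> y")
    case True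
    have "k 1 \<le> k y"
    proof (rule deriv_nonneg_imp_mono[OF k' _ True])
      fix t assume "t \<in> {1..y}"
      then show "0 \<le> (t - 1) * (1 / t - 1 / R)" "0 < t"
        using assms by (auto intro!: mult_nonneg_nonneg divide_left_mono)
    qed
    then show ?thesis by (simp add: k_def)
  next
    case False
    have "- k y \<le> - k 1"
    proof (rule deriv_nonneg_imp_mono[of y 1 "\<lambda>t. - k t" "\<lambda>t. - ((t - 1) * (1 / t - 1 / R))"])
      fix t assume t: "t \<in> {y..1}"
      then have t0: "0 < t" using assms by auto
      show "((\<lambda>t. - k t) has_real_derivative - ((t - 1) * (1 / t - 1 / R))) (at t)"
        by (intro DERIV_minus k' t0)
      have "1 / R \<le> 1 / t" using t t0 assms by (intro divide_left_mono) auto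
      then show "0 \<le> - ((t - 1) * (1 / t - 1 / R))"
        using t by (simp add: mult_nonpos_nonneg)
    qed (use False in auto)
    then show ?thesis by (simp add: k_def)
  qed
  then show ?thesis by (simp add: k_def)
qed

text \<open>Relative entropy of \<open>nu W\<close> with respect to the standard Gaussian: the
  integrand is the logarithm of \<open>gibbs1 W\<close> over
  \<open>std_normal_density\<close>.\<close>

definition entropy1 :: "(real \<Rightarrow> real) \<Rightarrow> real"
  where "entropy1 W = (LINT x|nu W. - W x - ln (part1 W) + x\<^sup>2 / 2 + ln (2 * pi) / 2)"

lemma pos_density_std_normal: "pos_density std_normal_density"
proof -
  have "continuous_on UNIV std_normal_density"
    unfolding std_normal_density_def[abs_def] by (intro continuous_intros) auto
  then show ?thesis
    by (simp add: pos_density_def normal_density_pos)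
qed

lemma abs_mult_le_power2_sum: "\<bar>a * b\<bar> \<le> a\<^sup>2 + (b :: real)\<^sup>2"
proof -
  have "0 \<le> (\<bar>a\<bar> - \<bar>b\<bar>)\<^sup>2" "0 \<le> \<bar>a\<bar> * \<bar>b\<bar>" by simp_all
  then show ?thesis unfolding power2_diff abs_mult power2_abs by linarith
qed

text \<open>Parallelogram identity for variances: the two sides differ by the variance of
  \<open>f + g\<close>.\<close>

lemma variance_sum_le:
  assumes "prob_space M" "integrable M (\<lambda>x. (f x :: real)\<^sup>2)" "integrable M (\<lambda>x. (g x)\<^sup>2)"
    and [measurable]: "f \<in> borel_measurable M" "g \<in> borel_measurable M"
  shows "(LINT x|M. (f x - g x)\<^sup>2) - (LINT x|M. f x - g x)\<^sup>2 \<le>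
    2 * ((LINT x|M. (f x)\<^sup>2) - (LINT x|M. f x)\<^sup>2) + 2 * ((LINT x|M. (g x)\<^sup>2) - (LINT x|M. g x)\<^sup>2)"
proof -
  interpret prob_space M by fact
  have i: "integrable M f" "integrable M g"
    using assms by (auto intro: square_integrable_imp_integrable)
  have "integrable M (\<lambda>x. (f x)\<^sup>2 + (g x)\<^sup>2)" using assms by simp
  then have ifg: "integrable M (\<lambda>x. f x * g x)"
  proof (rule Bochner_Integration.integrable_bound)
    have "\<bar>f x * g x\<bar> \<le> (f x)\<^sup>2 + (g x)\<^sup>2" for x
      by (rule abs_mult_le_power2_sum)
    then show "AE x in M. norm (f x * g x) \<le> norm ((f x)\<^sup>2 + (g x)\<^sup>2)"
      by simp
  qed simp
  define a b where "a = (LINT x|M. f x)" and "b = (LINT x|M. g x)"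
  have "0 \<le> (LINT x|M. ((f x - a) + (g x - b))\<^sup>2)" by simp
  also have "(LINT x|M. ((f x - a) + (g x - b))\<^sup>2) = (LINT x|M. (f x)\<^sup>2 + (g x)\<^sup>2 + 2 * (f x * g x) - 2 * (a + b) * f x - 2 * (a + b) * g x + (a + b)\<^sup>2)"
    by (intro Bochner_Integration.integral_cong) (auto simp: power2_eq_square algebra_simps)
  also have "\<dots> = (LINT x|M. (f x)\<^sup>2) + (LINT x|M. (g x)\<^sup>2) + 2 * (LINT x|M. f x * g x) - 2 * (a + b) * a - 2 * (a + b) * b + (a + b)\<^sup>2"
    using assms i ifg by (simp add: a_def b_def prob_space)
  finally have "0 \<le> \<dots>" .
  moreover have "(LINT x|M. (f x - g x)\<^sup>2) = (LINT x|M. (f x)\<^sup>2) + (LINT x|M. (g x)\<^sup>2) - 2 * (LINT x|M. f x * g x)"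
    using assms i ifg by (simp add: power2_diff mult.assoc)
  moreover have "(LINT x|M. f x - g x) = a - b" using i by (simp add: a_def b_def)
  moreover have "(A + B - 2 * C) - (a - b)\<^sup>2 \<le> 2 * (A - a\<^sup>2) + 2 * (B - b\<^sup>2)"
    if "0 \<le> A + B + 2 * C - 2 * (a + b) * a - 2 * (a + b) * b + (a + b)\<^sup>2" for A B C
    using that by (simp add: power2_eq_square algebra_simps)
  ultimately show ?thesis by (simp only: a_def[symmetric] b_def[symmetric])
qed

text \<open>The last claim is the logarithm of the change of variables formula for \<open>T\<close>.
  The slope bound is what gives \<open>T\<close> linear growth and so admits it to the growth
  classes.\<close>

lemma transport_to_normal_1d:
  assumes pot: "pot1 \<epsilon> L W W'"
  defines "T \<equiv> transport (gibbs1 W) std_normal_density"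
    and "T' \<equiv> (\<lambda>x. gibbs1 W x / std_normal_density (transport (gibbs1 W) std_normal_density x))"
  shows "(T has_real_derivative T' x) (at x)" "0 < T' x" "T' x \<le> sqrt L" "isCont T' x"
    "lin_growth1 T" "ln (T' x) = - W x - ln (part1 W) + (T x)\<^sup>2 / 2 + ln (2 * pi) / 2"
proof -
  note P = pos_density_gibbs1[OF pot] and N = pos_density_std_normal
  have d: "(T has_real_derivative T' x) (at x)" for x
    unfolding T_def T'_def by (rule transport_deriv[OF P N])
  show "(T has_real_derivative T' x) (at x)" by fact
  have pos: "0 < T' x" for x
    unfolding T'_def using gibbs1_pos[OF pot] by (simp add: normal_density_pos)
  show "0 < T' x" by fact
  have le: "T' x \<le> sqrt L" for x
    using transport_deriv_le_sqrt[OF pot, of x]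
    by (simp add: T'_def pos_divide_le_eq normal_density_pos)
  show "T' x \<le> sqrt L" by fact
  have Tc: "isCont T x" for x using d by (rule DERIV_isCont)
  have "isCont (gibbs1 W) x" "isCont std_normal_density y" for x y
    using P N by (auto simp: pos_density_def continuous_on_eq_continuous_at)
  then show "isCont T' x"
    using Tc[of x] unfolding T'_def T_def
    by (intro continuous_divide isCont_o2[of x "transport (gibbs1 W) std_normal_density" std_normal_density])
       (auto simp: less_imp_neq[OF normal_density_pos, symmetric])
  have [measurable]: "T \<in> borel_measurable borel"
    using Tc by (auto intro!: borel_measurable_continuous_onI continuous_at_imp_continuous_on)
  have "\<bar>T t\<bar> \<le> (\<bar>T 0\<bar> + sqrt L) * (1 + \<bar>t\<bar>)" for t
  proof -
    have "\<bar>T t - T 0\<bar> \<le> sqrt L * \<bar>t - 0\<bar>"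
      using field_differentiable_bound[of UNIV T T' "sqrt L" t 0] d le pos
      by (auto simp: abs_of_pos)
    moreover have "0 \<le> \<bar>T 0\<bar> * \<bar>t\<bar>" by simp
    moreover have "(\<bar>T 0\<bar> + sqrt L) * (1 + \<bar>t\<bar>) = \<bar>T 0\<bar> + \<bar>T 0\<bar> * \<bar>t\<bar> + sqrt L + sqrt L * \<bar>t - 0\<bar>"
      by (simp add: algebra_simps)
    moreover have "0 < sqrt L" using pot1_pos[OF pot] by simp
    ultimately show ?thesis by linarith
  qed
  then show "lin_growth1 T" by (auto simp: lin_growth1_def)
  show "ln (T' x) = - W x - ln (part1 W) + (T x)\<^sup>2 / 2 + ln (2 * pi) / 2"
    using part1_pos[OF pot]
    by (simp add: T'_def T_def gibbs1_def std_normal_density_def ln_div ln_mult ln_sqrt)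
qed

text \<open>Change of variables expresses \<open>ln (T' x)\<close> through the entropy integrand and
  \<open>T\<close>; integration by parts turns the mean of \<open>T' x - 1\<close> into that of
  \<open>W' x * \<theta> x\<close>, where \<open>W' x = g x + x\<close>. What is left completes the
  square of \<open>\<theta> - g\<close> and yields the identity \<open>deficit\<close> in the proof.
  The first claim feeds the induction for the deficit, the second the cost of the Knothe
  map.\<close>

lemma deficit_1d:
  fixes W W' :: "real \<Rightarrow> real"
  assumes pot: "pot1 \<epsilon> L W W'" and L: "1 \<le> L"
  defines "g \<equiv> (\<lambda>x. W' x - x)"
  shows "min (1 / 4) (\<epsilon> / (4 * sqrt L)) * ((LINT x|nu W. (g x)\<^sup>2) - (LINT x|nu W. g x)\<^sup>2)
      \<le> 1 / 2 * (LINT x|nu W. (g x)\<^sup>2) - entropy1 W"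
    and "(LINT x|nu W. (transport (gibbs1 W) std_normal_density x - x)\<^sup>2) \<le> 4 * (LINT x|nu W. (g x)\<^sup>2)"
proof -
  interpret prob_space "nu W" by (rule prob_space_nu[OF pot])
  define T where "T = transport (gibbs1 W) std_normal_density"
  define T' where "T' x = gibbs1 W x / std_normal_density (T x)" for x
  note T = transport_to_normal_1d[OF pot, folded T_def, folded T'_def]
  define \<theta> where "\<theta> x = T x - x" for x
  define k where "k x = T' x - 1 - ln (T' x)" for x
  have lin: "lin_growth1 \<theta>" "lin_growth1 g" "lin_growth1 W'" "lin_growth1 (\<lambda>x. x)"
    unfolding \<theta>_def g_def using T(5) lin_growth1_pot1_slope[OF pot] lin_growth1_id
    by (auto intro!: lin_growth1_diff)
  have m: "\<theta> \<in> borel_measurable (nu W)" "g \<in> borel_measurable (nu W)" "T' \<in> borel_measurable borel"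
    using lin T(4) by (auto simp: lin_growth1_def measurable_cong_sets[OF sets_nu[OF pot] refl]
       intro!: borel_measurable_continuous_onI continuous_at_imp_continuous_on)
  have linT': "lin_growth1 T'"
  proof -
    have "\<bar>T' t\<bar> \<le> sqrt L * (1 + \<bar>t\<bar>)" for t
    proof -
      have "0 \<le> sqrt L * \<bar>t\<bar>" using L by simp
      then show ?thesis using T(2,3)[of t] by (simp add: algebra_simps)
    qed
    then show ?thesis using m by (auto simp: lin_growth1_def)
  qed
  note int = integrable_nu_quad_growth1[OF pot]
  define e where "e x = - W x - ln (part1 W) + x\<^sup>2 / 2 + ln (2 * pi) / 2" for x
  have qe: "quad_growth1 e"
    unfolding e_def
    using quad_growth1_cmult[OF lin_growth1_power2[OF lin_growth1_id], of "1/2"]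
    by (intro quad_growth1_add quad_growth1_const quad_growth1_diff)
       (use quad_growth1_cmult[OF quad_growth1_pot1[OF pot], of "-1"] in auto)
  have \<theta>d: "(\<theta> has_real_derivative T' x - 1) (at x)" for x
    unfolding \<theta>_def by (auto intro!: derivative_eq_intros T(1))
  \<comment> \<open>Here \<open>(T x)\<^sup>2 - x\<^sup>2 = 2 * x * \<theta> x + (\<theta>
    x)\<^sup>2\<close>; the term \<open>x * \<theta> x\<close> will cancel against the one coming
    from integration by parts.\<close>
  have ek: "k x = (T' x - 1) - (e x + (x * \<theta> x + (1/2) * (\<theta> x)\<^sup>2))" for x
    by (simp add: k_def T(6) e_def \<theta>_def power2_eq_square algebra_simps)
  have qk: "quad_growth1 k" unfolding ek[abs_def]
    by (intro quad_growth1_add quad_growth1_diff quad_growth1_cmult quad_growth1_const qe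
        lin_growth1_power2 lin_growth1_mult lin lin_growth1_imp_quad[OF linT'])
  have ibp: "(LINT x|nu W. T' x - 1) = (LINT x|nu W. W' x * \<theta> x)"
  proof (rule integral_by_parts_nu[OF pot \<theta>d])
    show "isCont (\<lambda>x. T' x - 1) t" for t using T(4) by (intro continuous_intros)
    show "quad_growth1 \<theta>" "quad_growth1 (\<lambda>x. T' x - 1)" "quad_growth1 (\<lambda>t. W' t * \<theta> t)"
      by (rule lin_growth1_imp_quad lin_growth1_mult lin_growth1_diff lin_growth1_const lin linT')+
  qed
  have [simp]: "integrable (nu W) (\<lambda>x. (\<theta> x)\<^sup>2)" "integrable (nu W) (\<lambda>x. (g x)\<^sup>2)" "integrable (nu W) e"
     "integrable (nu W) k" "integrable (nu W) (\<lambda>x. x * \<theta> x)" "integrable (nu W) (\<lambda>x. g x * \<theta> x)"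
     "integrable (nu W) (\<lambda>x. W' x * \<theta> x)" "integrable (nu W) T'" "integrable (nu W) (\<lambda>x. (\<theta> x - g x)\<^sup>2)"
     "integrable (nu W) (\<lambda>x. (T' x - 1)\<^sup>2)" "integrable (nu W) \<theta>" "integrable (nu W) g"
    by (rule int, (rule qe qk lin_growth1_power2 lin_growth1_mult lin linT' lin_growth1_diff lin_growth1_const lin_growth1_imp_quad)+)+
  have "(LINT x|nu W. k x) = (LINT x|nu W. T' x - 1) - ((LINT x|nu W. e x) + ((LINT x|nu W. x * \<theta> x) + (1/2) * (LINT x|nu W. (\<theta> x)\<^sup>2)))"
    unfolding ek by simp
  also have "(LINT x|nu W. T' x - 1) = (LINT x|nu W. g x * \<theta> x) + (LINT x|nu W. x * \<theta> x)"
  proof -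
    have "(LINT x|nu W. W' x * \<theta> x) = (LINT x|nu W. g x * \<theta> x + x * \<theta> x)"
      by (intro Bochner_Integration.integral_cong) (auto simp: g_def algebra_simps)
    then show ?thesis unfolding ibp by simp
  qed
  finally have kint: "(LINT x|nu W. k x) = (LINT x|nu W. g x * \<theta> x) - entropy1 W - (1/2) * (LINT x|nu W. (\<theta> x)\<^sup>2)"
    by (simp add: entropy1_def e_def)
  have dint: "(LINT x|nu W. (\<theta> x - g x)\<^sup>2) = (LINT x|nu W. (\<theta> x)\<^sup>2) + (LINT x|nu W. (g x)\<^sup>2) - 2 * (LINT x|nu W. g x * \<theta> x)"
  proof -
    have "(\<theta> x - g x)\<^sup>2 = (\<theta> x)\<^sup>2 + (g x)\<^sup>2 - 2 * (g x * \<theta> x)" for x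
      by (simp add: power2_diff)
    then show ?thesis by simp
  qed
  have deficit: "1 / 2 * (LINT x|nu W. (g x)\<^sup>2) - entropy1 W
      = (LINT x|nu W. k x) + 1 / 2 * (LINT x|nu W. (\<theta> x - g x)\<^sup>2)"
    unfolding kint dint by (simp add: field_simps)
  have kge: "(T' x - 1)\<^sup>2 / (2 * sqrt L) \<le> k x" for x
    unfolding k_def using T(2,3) L by (intro minus_one_minus_ln_ge) auto
  have k0: "0 \<le> k x" for x using kge[of x] by (rule order_trans[rotated]) (use L in simp)
  define V\<theta> where "V\<theta> = (LINT x|nu W. (\<theta> x)\<^sup>2) - (LINT x|nu W. \<theta> x)\<^sup>2"
  define Vd where "Vd = (LINT x|nu W. (\<theta> x - g x)\<^sup>2) - (LINT x|nu W. \<theta> x - g x)\<^sup>2"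
  \<comment> \<open>As \<open>g\<close> is \<theta> minus \<open>\<theta> - g\<close>, its variance
    costs at most \<open>2 * V\<theta> + 2 * Vd\<close>. The mean of \<open>k\<close> pays
    \<open>\<epsilon> / (2 * sqrt L)\<close> per unit of \<open>V\<theta>\<close>, the square pays
    1/2 per unit of \<open>Vd\<close>; \<open>a\<close> is half of the smaller rate.\<close>
  define a where "a = min (1 / 4) (\<epsilon> / (4 * sqrt L))"
  have a: "0 \<le> a" "2 * a \<le> 1/2" "2 * a \<le> \<epsilon> / (2 * sqrt L)"
    using pot1_pos[OF pot] by (auto simp: a_def min_def)
  have "V\<theta> \<le> (LINT x|nu W. (T' x - 1)\<^sup>2) / \<epsilon>"
    unfolding V\<theta>_def by (rule poincare_1d[OF pot \<theta>d]) auto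
  moreover have "(LINT x|nu W. (T' x - 1)\<^sup>2 / (2 * sqrt L)) \<le> (LINT x|nu W. k x)"
    using kge by (intro integral_mono) auto
  ultimately have "\<epsilon> / (2 * sqrt L) * V\<theta> \<le> (LINT x|nu W. k x)"
  proof -
    assume h: "V\<theta> \<le> (LINT x|nu W. (T' x - 1)\<^sup>2) / \<epsilon>" "(LINT x|nu W. (T' x - 1)\<^sup>2 / (2 * sqrt L)) \<le> (LINT x|nu W. k x)"
    have "\<epsilon> / (2 * sqrt L) * V\<theta> \<le> \<epsilon> / (2 * sqrt L) * ((LINT x|nu W. (T' x - 1)\<^sup>2) / \<epsilon>)"
      using h(1) pot1_pos[OF pot] by (intro mult_left_mono) auto
    also have "\<dots> = (LINT x|nu W. (T' x - 1)\<^sup>2 / (2 * sqrt L))" using pot1_pos[OF pot] by simp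
    finally show ?thesis using h(2) by simp
  qed
  moreover have "0 \<le> V\<theta>"
    unfolding V\<theta>_def using variance_positive[of \<theta>] by (subst (asm) variance_eq) auto
  moreover have "0 \<le> Vd" "Vd \<le> (LINT x|nu W. (\<theta> x - g x)\<^sup>2)"
  proof -
    have "integrable (nu W) (\<lambda>x. \<theta> x - g x)" by simp
    then show "0 \<le> Vd"
      unfolding Vd_def using variance_positive[of "\<lambda>x. \<theta> x - g x"] by (subst (asm) variance_eq) auto
  qed (simp add: Vd_def)
  moreover have "(LINT x|nu W. (g x)\<^sup>2) - (LINT x|nu W. g x)\<^sup>2 \<le> 2 * V\<theta> + 2 * Vd"
    using variance_sum_le[of "nu W" \<theta> "\<lambda>x. \<theta> x - g x"] m prob_space_nu[OF pot]
    by (simp add: V\<theta>_def Vd_def)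
  ultimately show "min (1 / 4) (\<epsilon> / (4 * sqrt L)) * ((LINT x|nu W. (g x)\<^sup>2) - (LINT x|nu W. g x)\<^sup>2)
      \<le> 1 / 2 * (LINT x|nu W. (g x)\<^sup>2) - entropy1 W"
  proof -
    assume h: "\<epsilon> / (2 * sqrt L) * V\<theta> \<le> (LINT x|nu W. k x)" "0 \<le> V\<theta>" "0 \<le> Vd" "Vd \<le> (LINT x|nu W. (\<theta> x - g x)\<^sup>2)"
      "(LINT x|nu W. (g x)\<^sup>2) - (LINT x|nu W. g x)\<^sup>2 \<le> 2 * V\<theta> + 2 * Vd"
    have "a * ((LINT x|nu W. (g x)\<^sup>2) - (LINT x|nu W. g x)\<^sup>2) \<le> a * (2 * V\<theta> + 2 * Vd)"
      using h a by (intro mult_left_mono) auto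
    also have "\<dots> = (2 * a) * V\<theta> + (2 * a) * Vd" by (simp add: algebra_simps)
    also have "\<dots> \<le> \<epsilon> / (2 * sqrt L) * V\<theta> + 1 / 2 * Vd"
      using h a by (intro add_mono mult_right_mono) auto
    also have "\<dots> \<le> 1 / 2 * (LINT x|nu W. (g x)\<^sup>2) - entropy1 W"
      unfolding deficit using h by simp
    finally show ?thesis by (simp add: a_def)
  qed
  \<comment> \<open>Gibbs' inequality: \<open>exp (- e x)\<close> is the density of the Gaussian
    relative to \<open>nu W\<close>, so it has mean 1, and
    \<open>1 - exp (- e x) \<le> e x\<close>.\<close>
  have "0 \<le> entropy1 W"
  proof -
    have ge: "1 - exp (- y) \<le> y" for y :: real using exp_ge_add_one_self[of "- y"] by simp
    have ie: "integrable lborel (\<lambda>x. std_normal_density x)" by simp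
    have eq: "exp (- e x) * gibbs1 W x = std_normal_density x" for x
    proof -
      have "- e x = W x + ln (part1 W) + (- x\<^sup>2 / 2) + (- (ln (2 * pi) / 2))" by (simp add: e_def)
      then have "exp (- e x) = exp (W x) * part1 W * exp (- x\<^sup>2 / 2) * inverse (exp (ln (2 * pi) / 2))"
        using part1_pos[OF pot] by (simp only: exp_add exp_minus exp_ln)
      also have "exp (ln (2 * pi) / 2) = sqrt (2 * pi)"
        by (simp add: ln_sqrt[symmetric])
      finally show ?thesis using part1_pos[OF pot]
        by (simp add: gibbs1_def std_normal_density_def exp_minus field_simps)
    qed
    have [measurable]: "e \<in> borel_measurable borel" using qe by (simp add: quad_growth1_def)
    have i: "integrable (nu W) (\<lambda>x. exp (- e x))" and v: "(LINT x|nu W. exp (- e x)) = 1"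
    proof -
      note [measurable] = gibbs1_measurable[OF pot]
      have "integrable lborel (\<lambda>x. gibbs1 W x * exp (- e x))"
        using ie by (simp add: eq mult.commute[of "gibbs1 W _"])
      then show "integrable (nu W) (\<lambda>x. exp (- e x))"
        unfolding nu_def using gibbs1_pos[OF pot] by (subst integrable_density) (auto intro: less_imp_le)
      have "(LINT x|nu W. exp (- e x)) = (LINT x|lborel. gibbs1 W x * exp (- e x))"
        unfolding nu_def using gibbs1_pos[OF pot] by (subst integral_density) (auto intro: less_imp_le)
      then show "(LINT x|nu W. exp (- e x)) = 1" by (simp add: eq mult.commute[of "gibbs1 W _"])
    qed
    have "(LINT x|nu W. 1 - exp (- e x)) \<le> (LINT x|nu W. e x)"
      using ge i by (intro integral_mono) auto
    then show ?thesis using i v prob_space by (simp add: entropy1_def e_def)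
  qed
  \<comment> \<open>In the identity \<open>deficit\<close> the entropy and the mean of
    \<open>k\<close> are nonnegative and drop out. Splitting \<theta> into
    \<open>\<theta> - g\<close> and \<open>g\<close> then costs a factor 2 on each of two equal
    bounds, hence the 4.\<close>
  then have "(LINT x|nu W. (\<theta> x - g x)\<^sup>2) \<le> (LINT x|nu W. (g x)\<^sup>2)"
    using deficit Bochner_Integration.integral_nonneg[of "nu W" k, OF k0] by simp
  moreover have "(LINT x|nu W. (\<theta> x)\<^sup>2) \<le> (LINT x|nu W. 2 * (\<theta> x - g x)\<^sup>2 + 2 * (g x)\<^sup>2)"
  proof (rule integral_mono)
    fix x
    show "(\<theta> x)\<^sup>2 \<le> 2 * (\<theta> x - g x)\<^sup>2 + 2 * (g x)\<^sup>2"
      using zero_le_power2[of "\<theta> x - 2 * g x"] by (simp add: power2_eq_square algebra_simps)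
  qed auto
  moreover have "(LINT x|nu W. 2 * (\<theta> x - g x)\<^sup>2 + 2 * (g x)\<^sup>2) =
      2 * (LINT x|nu W. (\<theta> x - g x)\<^sup>2) + 2 * (LINT x|nu W. (g x)\<^sup>2)" by simp
  ultimately have "(LINT x|nu W. (\<theta> x)\<^sup>2) \<le> 4 * (LINT x|nu W. (g x)\<^sup>2)" by linarith
  then show "(LINT x|nu W. (transport (gibbs1 W) std_normal_density x - x)\<^sup>2) \<le> 4 * (LINT x|nu W. (g x)\<^sup>2)"
    by (simp add: \<theta>_def T_def)
qed

section \<open>Finite products and the Prekopa-Leindler inequality\<close>

interpretation lborel_PiM: product_sigma_finite "\<lambda>_::nat. lborel :: real measure"
  by unfold_locales

definition sqn :: "nat \<Rightarrow> (nat \<Rightarrow> real) \<Rightarrow> real"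
  where "sqn n x = (\<Sum>i<n. (x i)\<^sup>2)"

lemma sqn_nonneg: "0 \<le> sqn n x"
  by (simp add: sqn_def sum_nonneg)

lemma norm_Rn_power2: "(norm_Rn n x)\<^sup>2 = sqn n x"
  by (simp add: norm_Rn_def L2_set_def sqn_def sum_nonneg)

lemma Rn_update: "x \<in> Rn n \<Longrightarrow> x(n := t) \<in> Rn (Suc n)"
  by (auto simp: Rn_def PiE_iff extensional_def)

lemma sqn_update: "sqn (Suc n) (x(n := t)) = sqn n x + t\<^sup>2"
  by (simp add: sqn_def)

lemma sigma_finite_lebesgue_Rn: "sigma_finite_measure (lebesgue_Rn n)"
  unfolding lebesgue_Rn_def by (rule lborel_PiM.sigma_finite) simp

lemma measurable_Rn_update:
  "(\<lambda>(t, x). x(n := t)) \<in> measurable (lborel \<Otimes>\<^sub>M lebesgue_Rn n) (lebesgue_Rn (Suc n))"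
proof -
  have "(\<lambda>(x, t). x(n := t)) \<in> measurable (lebesgue_Rn n \<Otimes>\<^sub>M lborel) (lebesgue_Rn (Suc n))"
    unfolding lebesgue_Rn_def lessThan_Suc by (rule measurable_add_dim)
  from measurable_compose[OF measurable_pair_swap' this] show ?thesis
    by (simp add: case_prod_unfold)
qed

lemma measurable_Rn_slice:
  "(\<lambda>x. x(n := t)) \<in> measurable (lebesgue_Rn n) (lebesgue_Rn (Suc n))"
  using measurable_compose[OF measurable_Pair1'[of t lborel "lebesgue_Rn n"] measurable_Rn_update] by simp

lemma measurable_Rn_component: "i < n \<Longrightarrow> (\<lambda>x. x i) \<in> borel_measurable (lebesgue_Rn n)"
  unfolding lebesgue_Rn_def using measurable_component_singleton[of i "{..<n}" "\<lambda>_. lborel"] by simp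

lemma borel_measurable_sqn: "sqn n \<in> borel_measurable (lebesgue_Rn n)"
  unfolding sqn_def[abs_def] by (intro borel_measurable_sum borel_measurable_power measurable_Rn_component) auto

lemma nn_integral_lebesgue_Rn_Suc:
  assumes "f \<in> borel_measurable (lebesgue_Rn (Suc n))"
  shows "(\<integral>\<^sup>+x. f x \<partial>lebesgue_Rn (Suc n)) = (\<integral>\<^sup>+t. (\<integral>\<^sup>+x. f (x(n := t)) \<partial>lebesgue_Rn n) \<partial>lborel)"
  using assms unfolding lebesgue_Rn_def lessThan_Suc
  by (intro lborel_PiM.product_nn_integral_insert_rev) auto

text \<open>The new coordinate stands first in the pair, so that Fubini leaves it as the outer
  variable, the one along which measures are disintegrated.\<close>

lemma lebesgue_Rn_Suc:
  "lebesgue_Rn (Suc n) = distr (lborel \<Otimes>\<^sub>M lebesgue_Rn n) (lebesgue_Rn (Suc n)) (\<lambda>(t, x). x(n := t))"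
proof (rule measure_eqI)
  fix A assume A: "A \<in> sets (lebesgue_Rn (Suc n))"
  interpret sigma_finite_measure "lebesgue_Rn n" by (rule sigma_finite_lebesgue_Rn)
  note [measurable] = measurable_Rn_update[of n] A
  have "emeasure (lebesgue_Rn (Suc n)) A = (\<integral>\<^sup>+t. (\<integral>\<^sup>+x. indicator A (x(n := t)) \<partial>lebesgue_Rn n) \<partial>lborel)"
    using nn_integral_lebesgue_Rn_Suc[of "indicator A" n] A by simp
  also have "\<dots> = (\<integral>\<^sup>+p. indicator A (case p of (t, x) \<Rightarrow> x(n := t)) \<partial>(lborel \<Otimes>\<^sub>M lebesgue_Rn n))"
    using nn_integral_fst[of "\<lambda>p. indicator A (case p of (t, x) \<Rightarrow> x(n := t))" lborel]
    by simp
  also have "\<dots> = (\<integral>\<^sup>+x. indicator A x \<partial>distr (lborel \<Otimes>\<^sub>M lebesgue_Rn n) (lebesgue_Rn (Suc n)) (\<lambda>(t, x). x(n := t)))"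
    by (subst nn_integral_distr) auto
  also have "\<dots> = emeasure (distr (lborel \<Otimes>\<^sub>M lebesgue_Rn n) (lebesgue_Rn (Suc n)) (\<lambda>(t, x). x(n := t))) A"
    by simp
  finally show "emeasure (lebesgue_Rn (Suc n)) A = \<dots>" .
qed simp

lemma integral_lebesgue_Rn_Suc:
  fixes f :: "(nat \<Rightarrow> real) \<Rightarrow> real"
  assumes f: "integrable (lebesgue_Rn (Suc n)) f"
  shows "integrable lborel (\<lambda>t. LINT x|lebesgue_Rn n. f (x(n := t)))"
    and "(LINT x|lebesgue_Rn (Suc n). f x) = (LINT t|lborel. LINT x|lebesgue_Rn n. f (x(n := t)))"
proof -
  interpret L: sigma_finite_measure "lebesgue_Rn n" by (rule sigma_finite_lebesgue_Rn)
  interpret pair_sigma_finite lborel "lebesgue_Rn n" ..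
  note [measurable] = measurable_Rn_update[of n] borel_measurable_integrable[OF f]
  have i: "integrable (lborel \<Otimes>\<^sub>M lebesgue_Rn n) (\<lambda>p. f (case p of (t, x) \<Rightarrow> x(n := t)))"
    using f by (subst (asm) lebesgue_Rn_Suc) (simp add: integrable_distr_eq)
  show "integrable lborel (\<lambda>t. LINT x|lebesgue_Rn n. f (x(n := t)))"
    using integrable_fst'[OF i] by simp
  have "(LINT x|lebesgue_Rn (Suc n). f x) = (LINT p|(lborel \<Otimes>\<^sub>M lebesgue_Rn n). f (case p of (t, x) \<Rightarrow> x(n := t)))"
    by (subst lebesgue_Rn_Suc) (simp add: integral_distr)
  also have "\<dots> = (LINT t|lborel. LINT x|lebesgue_Rn n. f (x(n := t)))"
    using integral_fst'[OF i] by simp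
  finally show "(LINT x|lebesgue_Rn (Suc n). f x) = (LINT t|lborel. LINT x|lebesgue_Rn n. f (x(n := t)))" .
qed

text \<open>Base case of the inductions: \<open>Rn 0\<close> is a single point of mass one, the
  function that is \<open>undefined\<close> everywhere.\<close>

lemma integral_lebesgue_Rn_0:
  fixes f :: "(nat \<Rightarrow> real) \<Rightarrow> real"
  shows "(LINT x|lebesgue_Rn 0. f x) = f (\<lambda>_. undefined)"
  by (simp add: lebesgue_Rn_def PiM_empty lebesgue_integral_count_space_finite)

lemma not_AE_lebesgue_Rn_False: "\<not> (AE x in lebesgue_Rn n. False)"
proof
  assume "AE x in lebesgue_Rn n. False"
  then have "emeasure (lebesgue_Rn n) (space (lebesgue_Rn n)) = 0"
    by (auto simp: AE_iff_null null_sets_def)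
  then have "(\<Prod>i<n. emeasure lborel (UNIV :: real set)) = 0"
    unfolding lebesgue_Rn_def space_PiM by (subst (asm) lborel_PiM.emeasure_PiM) auto
  then show False by simp
qed

lemma integral_pos_lebesgue_Rn:
  fixes f :: "(nat \<Rightarrow> real) \<Rightarrow> real"
  assumes "integrable (lebesgue_Rn n) f" "\<And>x. 0 < f x"
  shows "0 < (LINT x|lebesgue_Rn n. f x)"
proof -
  have "(LINT x|lebesgue_Rn n. f x) \<noteq> 0"
  proof
    assume "(LINT x|lebesgue_Rn n. f x) = 0"
    then have "AE x in lebesgue_Rn n. f x = 0"
      using integral_nonneg_eq_0_iff_AE[OF assms(1)] assms(2) by (simp add: less_imp_le)
    then have "AE x in lebesgue_Rn n. False" by (rule AE_mp) (use assms(2) in \<open>auto simp: less_le\<close>)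
    then show False using not_AE_lebesgue_Rn_False by blast
  qed
  then show ?thesis
    using Bochner_Integration.integral_nonneg[of "lebesgue_Rn n" f] assms(2) by (simp add: less_le)
qed

lemma integrable_gaussian_bound:
  fixes f :: "(nat \<Rightarrow> real) \<Rightarrow> real"
  assumes [measurable]: "f \<in> borel_measurable (lebesgue_Rn n)" and c: "0 < c"
    and le: "\<And>x. x \<in> Rn n \<Longrightarrow> \<bar>f x\<bar> \<le> K * exp (- c * sqn n x)"
  shows "integrable (lebesgue_Rn n) f"
proof -
  have "integrable (lebesgue_Rn n) (\<lambda>x. \<Prod>i\<in>{..<n}. exp (- c * (x i)\<^sup>2))"
    unfolding lebesgue_Rn_def
    by (rule lborel_PiM.product_integrable_prod) (use integrable_gaussian_exp[OF c] in auto)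
  also have "(\<lambda>x. \<Prod>i\<in>{..<n}. exp (- c * (x i)\<^sup>2)) = (\<lambda>x. exp (- c * sqn n x))"
    by (simp add: exp_sum[symmetric] sqn_def sum_distrib_left del: mult_minus_left)
  finally have "integrable (lebesgue_Rn n) (\<lambda>x. K * exp (- c * sqn n x))" by simp
  then show ?thesis
  proof (rule Bochner_Integration.integrable_bound)
    show "AE x in lebesgue_Rn n. norm (f x) \<le> norm (K * exp (- c * sqn n x))"
      using le by (intro AE_I2) (force simp: space_lebesgue_Rn)
  qed simp
qed

section \<open>Growth classes in dimension n\<close>

definition quad_growth :: "nat \<Rightarrow> ((nat \<Rightarrow> real) \<Rightarrow> real) \<Rightarrow> bool"
  where "quad_growth n f \<longleftrightarrow> f \<in> borel_measurable (lebesgue_Rn n) \<and>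
    (\<exists>K. \<forall>x\<in>Rn n. \<bar>f x\<bar> \<le> K * (1 + sqn n x))"

text \<open>Stated for the square of \<open>f\<close> in terms of \<open>sqn\<close>, so that
  squares and products of such functions fall into \<open>quad_growth\<close> at once.\<close>

definition lin_growth :: "nat \<Rightarrow> ((nat \<Rightarrow> real) \<Rightarrow> real) \<Rightarrow> bool"
  where "lin_growth n f \<longleftrightarrow> f \<in> borel_measurable (lebesgue_Rn n) \<and>
    (\<exists>K. \<forall>x\<in>Rn n. (f x)\<^sup>2 \<le> K * (1 + sqn n x))"

lemma quad_growthI:
  "f \<in> borel_measurable (lebesgue_Rn n) \<Longrightarrow> (\<And>x. x \<in> Rn n \<Longrightarrow> \<bar>f x\<bar> \<le> K * (1 + sqn n x)) \<Longrightarrow> quad_growth n f"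
  by (auto simp: quad_growth_def)

lemma lin_growthI:
  "f \<in> borel_measurable (lebesgue_Rn n) \<Longrightarrow> (\<And>x. x \<in> Rn n \<Longrightarrow> (f x)\<^sup>2 \<le> K * (1 + sqn n x)) \<Longrightarrow> lin_growth n f"
  by (auto simp: lin_growth_def)

lemma quad_growth_measurable: "quad_growth n f \<Longrightarrow> f \<in> borel_measurable (lebesgue_Rn n)"
  by (simp add: quad_growth_def)

lemma lin_growth_measurable: "lin_growth n f \<Longrightarrow> f \<in> borel_measurable (lebesgue_Rn n)"
  by (simp add: lin_growth_def)

lemma quad_growth_add:
  assumes "quad_growth n f" "quad_growth n g"
  shows "quad_growth n (\<lambda>x. f x + g x)"
proof -
  obtain A B where A: "\<And>x. x \<in> Rn n \<Longrightarrow> \<bar>f x\<bar> \<le> A * (1 + sqn n x)" and B: "\<And>x. x \<in> Rn n \<Longrightarrow> \<bar>g x\<bar> \<le> B * (1 + sqn n x)"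
    using assms by (auto simp: quad_growth_def)
  show ?thesis
  proof (rule quad_growthI)
    show "(\<lambda>x. f x + g x) \<in> borel_measurable (lebesgue_Rn n)" using assms by (auto simp: quad_growth_def)
    show "\<bar>f x + g x\<bar> \<le> (A + B) * (1 + sqn n x)" if "x \<in> Rn n" for x
      using A[OF that] B[OF that] abs_triangle_ineq[of "f x" "g x"] by (simp only: distrib_right)
  qed
qed

lemma quad_growth_cmult:
  assumes "quad_growth n f"
  shows "quad_growth n (\<lambda>x. c * f x)"
proof -
  obtain A where A: "\<And>x. x \<in> Rn n \<Longrightarrow> \<bar>f x\<bar> \<le> A * (1 + sqn n x)"
    using assms by (auto simp: quad_growth_def)
  show ?thesis
  proof (rule quad_growthI)
    show "(\<lambda>x. c * f x) \<in> borel_measurable (lebesgue_Rn n)" using assms by (auto simp: quad_growth_def)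
    show "\<bar>c * f x\<bar> \<le> (\<bar>c\<bar> * A) * (1 + sqn n x)" if "x \<in> Rn n" for x
      using mult_left_mono[OF A[OF that], of "\<bar>c\<bar>"] by (simp add: abs_mult mult.assoc)
  qed
qed

lemma quad_growth_diff: "quad_growth n f \<Longrightarrow> quad_growth n g \<Longrightarrow> quad_growth n (\<lambda>x. f x - g x)"
  using quad_growth_add[of n f "\<lambda>x. -1 * g x"] quad_growth_cmult[of n g "-1"] by simp

lemma quad_growth_uminus: "quad_growth n f \<Longrightarrow> quad_growth n (\<lambda>x. - f x)"
  using quad_growth_cmult[of n f "-1"] by simp

lemma quad_growth_const: "quad_growth n (\<lambda>x. c)"
proof (rule quad_growthI)
  show "\<bar>c\<bar> \<le> \<bar>c\<bar> * (1 + sqn n x)" for x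
    using mult_left_mono[of 1 "1 + sqn n x" "\<bar>c\<bar>"] sqn_nonneg[of n x] by simp
qed simp

lemma quad_growth_sqn: "quad_growth n (sqn n)"
  by (rule quad_growthI[of _ _ 1]) (use sqn_nonneg in \<open>auto simp: borel_measurable_sqn\<close>)

lemma quad_growth_sum: "(\<And>i. i \<in> I \<Longrightarrow> quad_growth n (f i)) \<Longrightarrow> quad_growth n (\<lambda>x. \<Sum>i\<in>I. f i x)"
  by (induction I rule: infinite_finite_induct) (auto intro: quad_growth_const quad_growth_add)

lemma lin_growth_mult:
  assumes "lin_growth n f" "lin_growth n g"
  shows "quad_growth n (\<lambda>x. f x * g x)"
proof -
  obtain A B where A: "\<And>x. x \<in> Rn n \<Longrightarrow> (f x)\<^sup>2 \<le> A * (1 + sqn n x)" and B: "\<And>x. x \<in> Rn n \<Longrightarrow> (g x)\<^sup>2 \<le> B * (1 + sqn n x)"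
    using assms by (auto simp: lin_growth_def)
  show ?thesis
  proof (rule quad_growthI)
    show "(\<lambda>x. f x * g x) \<in> borel_measurable (lebesgue_Rn n)" using assms by (auto simp: lin_growth_def)
    show "\<bar>f x * g x\<bar> \<le> (A + B) * (1 + sqn n x)" if "x \<in> Rn n" for x
      using A[OF that] B[OF that] abs_mult_le_power2_sum[of "f x" "g x"] by (simp only: distrib_right)
  qed
qed

lemma lin_growth_add:
  assumes "lin_growth n f" "lin_growth n g"
  shows "lin_growth n (\<lambda>x. f x + g x)"
proof -
  obtain A B where A: "\<And>x. x \<in> Rn n \<Longrightarrow> (f x)\<^sup>2 \<le> A * (1 + sqn n x)" and B: "\<And>x. x \<in> Rn n \<Longrightarrow> (g x)\<^sup>2 \<le> B * (1 + sqn n x)"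
    using assms by (auto simp: lin_growth_def)
  show ?thesis
  proof (rule lin_growthI)
    show "(\<lambda>x. f x + g x) \<in> borel_measurable (lebesgue_Rn n)" using assms by (auto simp: lin_growth_def)
    show "(f x + g x)\<^sup>2 \<le> (2 * A + 2 * B) * (1 + sqn n x)" if "x \<in> Rn n" for x
    proof -
      have "(f x + g x)\<^sup>2 \<le> 2 * (f x)\<^sup>2 + 2 * (g x)\<^sup>2"
        using zero_le_power2[of "f x - g x"] unfolding power2_sum power2_diff by linarith
      then show ?thesis using A[OF that] B[OF that] by (simp only: distrib_right mult.assoc)
    qed
  qed
qed

lemma lin_growth_cmult:
  assumes "lin_growth n f"
  shows "lin_growth n (\<lambda>x. c * f x)"
proof -
  obtain A where A: "\<And>x. x \<in> Rn n \<Longrightarrow> (f x)\<^sup>2 \<le> A * (1 + sqn n x)"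
    using assms by (auto simp: lin_growth_def)
  show ?thesis
  proof (rule lin_growthI)
    show "(\<lambda>x. c * f x) \<in> borel_measurable (lebesgue_Rn n)" using assms by (auto simp: lin_growth_def)
    show "(c * f x)\<^sup>2 \<le> (c\<^sup>2 * A) * (1 + sqn n x)" if "x \<in> Rn n" for x
      using mult_left_mono[OF A[OF that], of "c\<^sup>2"] by (simp add: power_mult_distrib mult.assoc)
  qed
qed

lemma lin_growth_diff: "lin_growth n f \<Longrightarrow> lin_growth n g \<Longrightarrow> lin_growth n (\<lambda>x. f x - g x)"
  using lin_growth_add[of n f "\<lambda>x. -1 * g x"] lin_growth_cmult[of n g "-1"] by simp

lemma lin_growth_const: "lin_growth n (\<lambda>x. c)"
proof (rule lin_growthI)
  show "c\<^sup>2 \<le> c\<^sup>2 * (1 + sqn n x)" for x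
    using mult_left_mono[of 1 "1 + sqn n x" "c\<^sup>2"] sqn_nonneg[of n x] by simp
qed simp

lemma lin_growth_component: "i < n \<Longrightarrow> lin_growth n (\<lambda>x. x i)"
proof (rule lin_growthI[of _ _ 1])
  fix x assume "i < n"
  then have "(x i)\<^sup>2 \<le> sqn n x" unfolding sqn_def by (intro member_le_sum) auto
  then show "(x i)\<^sup>2 \<le> 1 * (1 + sqn n x)" by simp
qed (rule measurable_Rn_component)

lemma lin_growth_sum: "(\<And>i. i \<in> I \<Longrightarrow> lin_growth n (f i)) \<Longrightarrow> lin_growth n (\<lambda>x. \<Sum>i\<in>I. f i x)"
  by (induction I rule: infinite_finite_induct) (auto intro: lin_growth_const lin_growth_add)

lemma lin_growth_imp_quad: "lin_growth n f \<Longrightarrow> quad_growth n f"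
  using lin_growth_mult[OF _ lin_growth_const[of n 1], of f] by simp

lemma lin_growth_power2: "lin_growth n f \<Longrightarrow> quad_growth n (\<lambda>x. (f x)\<^sup>2)"
  using lin_growth_mult[of n f f] by (simp add: power2_eq_square)

lemma growth_slice_bound:
  assumes "0 \<le> K"
  shows "K * (1 + sqn (Suc n) (x(n := t))) \<le> (K * (1 + t\<^sup>2)) * (1 + sqn n x)"
proof -
  have "1 + sqn (Suc n) (x(n := t)) \<le> (1 + t\<^sup>2) * (1 + sqn n x)"
    using sqn_nonneg[of n x] by (simp add: sqn_update algebra_simps)
  then show ?thesis using assms by (simp add: mult_left_mono mult.assoc)
qed

lemma quad_growth_nonneg_const:
  assumes "quad_growth n f"
  obtains K where "0 \<le> K" "\<And>x. x \<in> Rn n \<Longrightarrow> \<bar>f x\<bar> \<le> K * (1 + sqn n x)"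
proof -
  obtain K where K: "\<And>x. x \<in> Rn n \<Longrightarrow> \<bar>f x\<bar> \<le> K * (1 + sqn n x)"
    using assms by (auto simp: quad_growth_def)
  have "\<bar>f x\<bar> \<le> \<bar>K\<bar> * (1 + sqn n x)" if "x \<in> Rn n" for x
    using K[OF that] mult_right_mono[of K "\<bar>K\<bar>" "1 + sqn n x"] sqn_nonneg[of n x] by linarith
  then show ?thesis using that[of "\<bar>K\<bar>"] by simp
qed

lemma quad_growth_slice:
  assumes f: "quad_growth (Suc n) f"
  shows "quad_growth n (\<lambda>x. f (x(n := t)))"
proof -
  obtain K where K: "0 \<le> K" "\<And>x. x \<in> Rn (Suc n) \<Longrightarrow> \<bar>f x\<bar> \<le> K * (1 + sqn (Suc n) x)"
    by (rule quad_growth_nonneg_const[OF f]) blast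
  show ?thesis
  proof (rule quad_growthI)
    show "(\<lambda>x. f (x(n := t))) \<in> borel_measurable (lebesgue_Rn n)"
      by (rule measurable_compose[OF measurable_Rn_slice quad_growth_measurable[OF f]])
    show "\<bar>f (x(n := t))\<bar> \<le> (K * (1 + t\<^sup>2)) * (1 + sqn n x)" if "x \<in> Rn n" for x
      using K(2)[OF Rn_update[OF that]] growth_slice_bound[OF K(1)] by (rule order_trans)
  qed
qed

lemma lin_growth_slice:
  assumes f: "lin_growth (Suc n) f"
  shows "lin_growth n (\<lambda>x. f (x(n := t)))"
proof -
  have "quad_growth n (\<lambda>x. (f (x(n := t)))\<^sup>2)"
    using quad_growth_slice[OF lin_growth_power2[OF f]] .
  then show ?thesis
    using measurable_compose[OF measurable_Rn_slice lin_growth_measurable[OF f]]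
    by (auto simp: lin_growth_def quad_growth_def)
qed

text \<open>\<open>V\<close> has gradient \<open>G\<close> and a Hessian between \<open>\<epsilon>\<close> and \<open>L\<close>; measurability and growth are included
  so that the class is visibly closed under fixing the last coordinate.\<close>

definition pot :: "nat \<Rightarrow> real \<Rightarrow> real \<Rightarrow> ((nat \<Rightarrow> real) \<Rightarrow> real) \<Rightarrow> ((nat \<Rightarrow> real) \<Rightarrow> nat \<Rightarrow> real) \<Rightarrow> bool"
  where "pot n \<epsilon> L V G \<longleftrightarrow> 0 < \<epsilon> \<and> 0 < L \<and> V \<in> borel_measurable (lebesgue_Rn n) \<and>
    (\<forall>i<n. lin_growth n (\<lambda>x. G x i)) \<and>
    (\<forall>x\<in>Rn n. \<forall>y\<in>Rn n. \<epsilon> / 2 * sqn n (\<lambda>i. y i - x i) \<le> V y - V x - (\<Sum>i<n. G x i * (y i - x i)) \<and>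
       V y - V x - (\<Sum>i<n. G x i * (y i - x i)) \<le> L / 2 * sqn n (\<lambda>i. y i - x i))"

definition part :: "nat \<Rightarrow> ((nat \<Rightarrow> real) \<Rightarrow> real) \<Rightarrow> real"
  where "part n V = (LINT x|lebesgue_Rn n. exp (- V x))"

definition mu :: "nat \<Rightarrow> ((nat \<Rightarrow> real) \<Rightarrow> real) \<Rightarrow> (nat \<Rightarrow> real) measure"
  where "mu n V = density (lebesgue_Rn n) (\<lambda>x. ennreal (exp (- V x) / part n V))"

context
  fixes n :: nat and \<epsilon> L :: real and V :: "(nat \<Rightarrow> real) \<Rightarrow> real" and G :: "(nat \<Rightarrow> real) \<Rightarrow> nat \<Rightarrow> real"
  assumes pot: "pot n \<epsilon> L V G"
begin

lemma pot_pos: "0 < \<epsilon>" "0 < L"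
  using pot by (auto simp: pot_def)

lemma pot_measurable: "V \<in> borel_measurable (lebesgue_Rn n)"
  using pot by (auto simp: pot_def)

lemma pot_lin_growth: "i < n \<Longrightarrow> lin_growth n (\<lambda>x. G x i)"
  using pot by (auto simp: pot_def)

lemma pot_lower: "x \<in> Rn n \<Longrightarrow> y \<in> Rn n \<Longrightarrow> \<epsilon> / 2 * sqn n (\<lambda>i. y i - x i) \<le> V y - V x - (\<Sum>i<n. G x i * (y i - x i))"
  using pot by (auto simp: pot_def)

lemma pot_upper: "x \<in> Rn n \<Longrightarrow> y \<in> Rn n \<Longrightarrow> V y - V x - (\<Sum>i<n. G x i * (y i - x i)) \<le> L / 2 * sqn n (\<lambda>i. y i - x i)"
  using pot by (auto simp: pot_def)

lemma pot_quad_growth: "quad_growth n V"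
proof -
  define o' where "o' = (\<lambda>i\<in>{..<n}. 0 :: real)"
  have o: "o' \<in> Rn n" by (simp add: o'_def Rn_def)
  have eq: "sqn n (\<lambda>i. x i - o' i) = sqn n x" "(\<Sum>i<n. G o' i * (x i - o' i)) = (\<Sum>i<n. G o' i * x i)" for x
    by (auto simp: sqn_def o'_def intro!: sum.cong)
  have "quad_growth n (\<lambda>x. \<bar>V o'\<bar> + \<bar>\<Sum>i<n. G o' i * x i\<bar> + L / 2 * sqn n x)"
  proof (intro quad_growth_add quad_growth_const quad_growth_cmult quad_growth_sqn)
    have "quad_growth n (\<lambda>x. \<Sum>i<n. G o' i * x i)"
      by (intro quad_growth_sum quad_growth_cmult lin_growth_imp_quad lin_growth_component) auto
    then show "quad_growth n (\<lambda>x. \<bar>\<Sum>i<n. G o' i * x i\<bar>)" by (auto simp: quad_growth_def)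
  qed
  then obtain K where K: "\<And>x. x \<in> Rn n \<Longrightarrow> \<bar>\<bar>V o'\<bar> + \<bar>\<Sum>i<n. G o' i * x i\<bar> + L / 2 * sqn n x\<bar> \<le> K * (1 + sqn n x)"
    by (auto simp: quad_growth_def)
  show ?thesis
  proof (rule quad_growthI[OF pot_measurable])
    fix x assume x: "x \<in> Rn n"
    have "0 \<le> \<epsilon> / 2 * sqn n x" using pot_pos sqn_nonneg by simp
    then show "\<bar>V x\<bar> \<le> K * (1 + sqn n x)"
      using pot_lower[OF o x] pot_upper[OF o x] K[OF x] unfolding eq by linarith
  qed
qed

text \<open>The one-dimensional argument coordinate by coordinate, expanded at the origin
  \<open>o'\<close>, with the same split of \<epsilon>/2 into \<epsilon>/4, \<epsilon>/8 and
  \<epsilon>/8.\<close>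

lemma pot_exp_decay: "\<exists>K\<ge>0. \<forall>x\<in>Rn n. (1 + sqn n x) * exp (- V x) \<le> K * exp (- (\<epsilon> / 8) * sqn n x)"
proof -
  define o' where "o' = (\<lambda>i\<in>{..<n}. 0 :: real)"
  have o: "o' \<in> Rn n" by (simp add: o'_def Rn_def)
  have eq: "sqn n (\<lambda>i. x i - o' i) = sqn n x" "(\<Sum>i<n. G o' i * (x i - o' i)) = (\<Sum>i<n. G o' i * x i)" for x
    by (auto simp: sqn_def o'_def intro!: sum.cong)
  define c where "c = (\<Sum>i<n. (G o' i)\<^sup>2 / \<epsilon>) - V o'"
  have lower: "- V x \<le> c - \<epsilon> / 4 * sqn n x" if x: "x \<in> Rn n" for x
  proof -
    have "0 \<le> (\<Sum>i<n. (\<epsilon> / 2 * x i + G o' i)\<^sup>2 / \<epsilon>)" using pot_pos by (intro sum_nonneg) auto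
    also have "\<dots> = (\<Sum>i<n. \<epsilon> / 4 * (x i)\<^sup>2 + G o' i * x i + (G o' i)\<^sup>2 / \<epsilon>)"
      using pot_pos by (intro sum.cong) (auto simp: field_simps power2_eq_square)
    also have "\<dots> = \<epsilon> / 4 * sqn n x + (\<Sum>i<n. G o' i * x i) + (\<Sum>i<n. (G o' i)\<^sup>2 / \<epsilon>)"
      by (simp add: sum.distrib sqn_def sum_distrib_left)
    finally show ?thesis using pot_lower[OF o x] unfolding eq c_def by simp
  qed
  have "(1 + sqn n x) * exp (- V x) \<le> (1 + 1 / (\<epsilon> / 8)) * exp c * exp (- (\<epsilon> / 8) * sqn n x)" if x: "x \<in> Rn n" for x
  proof -
    have "(1 + sqn n x) * exp (- V x) \<le> ((1 + 1 / (\<epsilon> / 8)) * exp (\<epsilon> / 8 * sqn n x)) * exp (c - \<epsilon> / 4 * sqn n x)"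
      using pot_pos lower[OF x] sqn_nonneg by (intro mult_mono one_plus_le_exp) auto
    also have "\<dots> = (1 + 1 / (\<epsilon> / 8)) * (exp (\<epsilon> / 8 * sqn n x) * exp (c - \<epsilon> / 4 * sqn n x))" by simp
    also have "exp (\<epsilon> / 8 * sqn n x) * exp (c - \<epsilon> / 4 * sqn n x) = exp c * exp (- (\<epsilon> / 8) * sqn n x)"
      by (simp add: exp_add[symmetric] field_simps)
    finally show ?thesis by simp
  qed
  then show ?thesis using pot_pos by (intro exI[of _ "(1 + 1 / (\<epsilon> / 8)) * exp c"]) auto
qed

lemma integrable_quad_growth_exp:
  assumes f: "quad_growth n f"
  shows "integrable (lebesgue_Rn n) (\<lambda>x. f x * exp (- V x))"
proof -
  obtain C where C: "0 \<le> C" "\<And>x. x \<in> Rn n \<Longrightarrow> \<bar>f x\<bar> \<le> C * (1 + sqn n x)"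
    by (rule quad_growth_nonneg_const[OF f]) blast
  obtain K where K: "\<And>x. x \<in> Rn n \<Longrightarrow> (1 + sqn n x) * exp (- V x) \<le> K * exp (- (\<epsilon> / 8) * sqn n x)"
    using pot_exp_decay by blast
  note [measurable] = pot_measurable quad_growth_measurable[OF f]
  show ?thesis
  proof (rule integrable_gaussian_bound)
    fix x assume x: "x \<in> Rn n"
    have "\<bar>f x * exp (- V x)\<bar> \<le> C * (1 + sqn n x) * exp (- V x)"
      using C(2)[OF x] by (simp add: abs_mult)
    also have "\<dots> \<le> C * (K * exp (- (\<epsilon> / 8) * sqn n x))"
      using mult_left_mono[OF K[OF x] C(1)] by (simp add: mult.assoc)
    finally show "\<bar>f x * exp (- V x)\<bar> \<le> (C * K) * exp (- (\<epsilon> / 8) * sqn n x)" by (simp add: mult.assoc)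
  qed (use pot_pos in auto)
qed

lemma integrable_exp_pot: "integrable (lebesgue_Rn n) (\<lambda>x. exp (- V x))"
  using integrable_quad_growth_exp[OF quad_growth_const[of n 1]] by simp

lemma part_pos: "0 < part n V"
  unfolding part_def by (rule integral_pos_lebesgue_Rn[OF integrable_exp_pot]) simp

lemma sets_mu: "sets (mu n V) = sets (lebesgue_Rn n)"
  by (simp add: mu_def)

lemma space_mu: "space (mu n V) = Rn n"
  by (simp add: mu_def space_lebesgue_Rn)

lemma measurable_mu: "borel_measurable (mu n V) = borel_measurable (lebesgue_Rn n)"
  by (rule measurable_cong_sets[OF sets_mu refl])

lemma integrable_mu: "quad_growth n f \<Longrightarrow> integrable (mu n V) f"
proof -
  assume f: "quad_growth n f"
  note [measurable] = pot_measurable quad_growth_measurable[OF f]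
  have "integrable (lebesgue_Rn n) (\<lambda>x. (1 / part n V) * (f x * exp (- V x)))"
    by (intro integrable_mult_right integrable_quad_growth_exp f)
  then have "integrable (lebesgue_Rn n) (\<lambda>x. exp (- V x) / part n V * f x)"
    by (simp add: mult.commute)
  then show ?thesis
    unfolding mu_def using part_pos by (subst integrable_density) auto
qed

lemma integral_mu:
  assumes [measurable]: "f \<in> borel_measurable (lebesgue_Rn n)"
  shows "(LINT x|mu n V. f x) = (LINT x|lebesgue_Rn n. f x * exp (- V x)) / part n V"
proof -
  note [measurable] = pot_measurable
  have "(LINT x|mu n V. f x) = (LINT x|lebesgue_Rn n. exp (- V x) / part n V * f x)"
    unfolding mu_def using part_pos by (subst integral_density) auto
  also have "\<dots> = (LINT x|lebesgue_Rn n. (1 / part n V) * (f x * exp (- V x)))"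
    by (intro Bochner_Integration.integral_cong) auto
  finally show ?thesis by simp
qed

lemma prob_space_mu: "prob_space (mu n V)"
proof (rule prob_spaceI)
  note [measurable] = pot_measurable
  have "emeasure (mu n V) (space (mu n V)) = (\<integral>\<^sup>+x. ennreal (exp (- V x) / part n V) \<partial>lebesgue_Rn n)"
    unfolding mu_def by (subst emeasure_density) (auto intro!: nn_integral_cong)
  also have "\<dots> = ennreal (LINT x|lebesgue_Rn n. exp (- V x) / part n V)"
    using part_pos integrable_exp_pot by (intro nn_integral_eq_integral) auto
  also have "\<dots> = 1" using part_pos by (simp add: part_def)
  finally show "emeasure (mu n V) (space (mu n V)) = 1" .
qed

end

lemma pot_slice:
  assumes pot: "pot (Suc n) \<epsilon> L V G"
  shows "pot n \<epsilon> L (\<lambda>x. V (x(n := t))) (\<lambda>x. G (x(n := t)))"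
  unfolding pot_def
proof (intro conjI ballI allI impI)
  show "0 < \<epsilon>" "0 < L" using pot_pos[OF pot] by auto
  show "(\<lambda>x. V (x(n := t))) \<in> borel_measurable (lebesgue_Rn n)"
    by (rule measurable_compose[OF measurable_Rn_slice pot_measurable[OF pot]])
  show "lin_growth n (\<lambda>x. G (x(n := t)) i)" if "i < n" for i
    using lin_growth_slice[OF pot_lin_growth[OF pot, of i]] that by simp
  fix x y assume xy: "x \<in> Rn n" "y \<in> Rn n"
  have eq: "sqn (Suc n) (\<lambda>i. (y(n := t)) i - (x(n := t)) i) = sqn n (\<lambda>i. y i - x i)"
    "(\<Sum>i<Suc n. G (x(n := t)) i * ((y(n := t)) i - (x(n := t)) i)) = (\<Sum>i<n. G (x(n := t)) i * (y i - x i))"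
    by (simp_all add: sqn_def)
  show "\<epsilon> / 2 * sqn n (\<lambda>i. y i - x i) \<le> V (y(n := t)) - V (x(n := t)) - (\<Sum>i<n. G (x(n := t)) i * (y i - x i))"
    using pot_lower[OF pot Rn_update[OF xy(1), of t] Rn_update[OF xy(2), of t]] unfolding eq .
  show "V (y(n := t)) - V (x(n := t)) - (\<Sum>i<n. G (x(n := t)) i * (y i - x i)) \<le> L / 2 * sqn n (\<lambda>i. y i - x i)"
    using pot_upper[OF pot Rn_update[OF xy(1), of t] Rn_update[OF xy(2), of t]] unfolding eq .
qed

section \<open>Derivatives in the last coordinate\<close>

lemma DERIV_quadratic_remainder:
  fixes f :: "real \<Rightarrow> real"
  assumes "\<And>h. \<bar>f (t + h) - f t - D * h\<bar> \<le> C * h\<^sup>2"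
  shows "(f has_real_derivative D) (at t)"
proof -
  have "((\<lambda>h. \<bar>C\<bar> * \<bar>h\<bar>) \<longlongrightarrow> 0) (at (0::real))" by (auto intro!: tendsto_eq_intros)
  then have "((\<lambda>h. (f (t + h) - f t) / h - D) \<longlongrightarrow> 0) (at 0)"
  proof (rule Lim_null_comparison[rotated])
    have "norm ((f (t + h) - f t) / h - D) \<le> \<bar>C\<bar> * \<bar>h\<bar>" if "h \<noteq> 0" for h
    proof -
      have "norm ((f (t + h) - f t) / h - D) = \<bar>f (t + h) - f t - D * h\<bar> / \<bar>h\<bar>"
        using that by (simp add: abs_divide[symmetric] diff_divide_distrib del: abs_divide)
      also have "\<dots> \<le> \<bar>C\<bar> * h\<^sup>2 / \<bar>h\<bar>"
        using assms[of h] mult_right_mono[OF abs_ge_self[of C] zero_le_power2[of h]] by (intro divide_right_mono) auto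
      also have "\<dots> = \<bar>C\<bar> * \<bar>h\<bar>"
      proof -
        have "c * k\<^sup>2 / k = c * k" if "k \<noteq> 0" for c k :: real
          using that by (simp add: power2_eq_square)
        from this[of "\<bar>h\<bar>" "\<bar>C\<bar>"] that show ?thesis unfolding power2_abs by simp
      qed
      finally show ?thesis .
    qed
    then show "\<forall>\<^sub>F h in at 0. norm ((f (t + h) - f t) / h - D) \<le> \<bar>C\<bar> * \<bar>h\<bar>"
      by (auto simp: eventually_at_filter)
  qed
  then show ?thesis by (simp add: DERIV_def LIM_zero_iff)
qed

text \<open>\<open>pot\<close> does not mention derivatives. For two points that differ by
  \<open>h\<close> in the last coordinate, its two bounds squeeze the remainder to order
  \<open>h\<^sup>2\<close>, which makes \<open>G\<close> a true partial derivative.\<close>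

lemma pot_DERIV_last:
  assumes pot: "pot (Suc n) \<epsilon> L V G" and x: "x \<in> Rn n"
  shows "((\<lambda>t. V (x(n := t))) has_real_derivative G (x(n := t)) n) (at t)"
proof (rule DERIV_quadratic_remainder)
  fix h
  have eq: "sqn (Suc n) (\<lambda>i. (x(n := t + h)) i - (x(n := t)) i) = h\<^sup>2"
    "(\<Sum>i<Suc n. G (x(n := t)) i * ((x(n := t + h)) i - (x(n := t)) i)) = G (x(n := t)) n * h"
    by (simp_all add: sqn_def)
  have "0 \<le> \<epsilon> / 2 * h\<^sup>2" using pot_pos[OF pot] by simp
  then show "\<bar>V (x(n := t + h)) - V (x(n := t)) - G (x(n := t)) n * h\<bar> \<le> L / 2 * h\<^sup>2"
    using pot_lower[OF pot Rn_update[OF x, of t] Rn_update[OF x, of "t + h"]]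
      pot_upper[OF pot Rn_update[OF x, of t] Rn_update[OF x, of "t + h"]] unfolding eq by simp
qed

text \<open>By the mean value theorem a bound on \<open>f'\<close> that is uniform in
  \<open>t\<close> also dominates the difference quotients, so dominated convergence applies along
  every null sequence.\<close>

lemma DERIV_lebesgue_integral:
  fixes f f' :: "real \<Rightarrow> 'a \<Rightarrow> real"
  assumes i: "\<And>t. integrable M (f t)" and B: "integrable M B"
    and d: "\<And>t x. x \<in> space M \<Longrightarrow> ((\<lambda>t. f t x) has_real_derivative f' t x) (at t)"
    and m: "f' t \<in> borel_measurable M"
    and le: "\<And>t x. x \<in> space M \<Longrightarrow> \<bar>f' t x\<bar> \<le> B x"
  shows "((\<lambda>t. LINT x|M. f t x) has_real_derivative (LINT x|M. f' t x)) (at t)"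
  unfolding DERIV_def tendsto_at_iff_sequentially comp_def
proof (intro allI impI)
  fix X :: "nat \<Rightarrow> real" assume X: "\<forall>i. X i \<in> UNIV - {0}" "X \<longlonglongrightarrow> 0"
  have "(\<lambda>k. LINT x|M. (f (t + X k) x - f t x) / X k) \<longlonglongrightarrow> (LINT x|M. f' t x)"
  proof (rule integral_dominated_convergence[OF m _ B])
    show "(\<lambda>x. (f (t + X k) x - f t x) / X k) \<in> borel_measurable M" for k
      using i by (auto intro!: borel_measurable_divide borel_measurable_diff borel_measurable_integrable)
    show "AE x in M. (\<lambda>k. (f (t + X k) x - f t x) / X k) \<longlonglongrightarrow> f' t x"
    proof (rule AE_I2)
      fix x assume "x \<in> space M"
      from d[OF this, of t] show "(\<lambda>k. (f (t + X k) x - f t x) / X k) \<longlonglongrightarrow> f' t x"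
        unfolding DERIV_def tendsto_at_iff_sequentially comp_def using X by blast
    qed
    show "AE x in M. norm ((f (t + X k) x - f t x) / X k) \<le> B x" for k
    proof (rule AE_I2)
      fix x assume x: "x \<in> space M"
      have "norm (f (t + X k) x - f t x) \<le> B x * norm (t + X k - t)"
        by (rule field_differentiable_bound[of UNIV "\<lambda>t. f t x" "\<lambda>t. f' t x"])
           (use d[OF x] le[OF x] in auto)
      then show "norm ((f (t + X k) x - f t x) / X k) \<le> B x"
        using X(1)[rule_format, of k] by (simp add: divide_le_eq)
    qed
  qed
  moreover have "(LINT x|M. (f (t + X k) x - f t x) / X k) = ((LINT x|M. f (t + X k) x) - (LINT x|M. f t x)) / X k" for k
    using i by simp
  ultimately show "(\<lambda>k. ((LINT x|M. f (t + X k) x) - (LINT x|M. f t x)) / X k) \<longlonglongrightarrow> (LINT x|M. f' t x)"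
    by (simp only:)
qed

text \<open>The dominating function must not depend on \<open>t\<close>. The decay estimate in
  dimension \<open>Suc n\<close> first absorbs the quadratic growth, including its part in
  \<open>t\<close>; only then is \<open>t\<close> dropped from the Gaussian exponent.\<close>

lemma DERIV_integral_slice:
  assumes pot: "pot (Suc n) \<epsilon> L V G" and f: "lin_growth n f"
  shows "((\<lambda>t. LINT x|lebesgue_Rn n. f x * exp (- V (x(n := t)))) has_real_derivative
     - (LINT x|lebesgue_Rn n. f x * G (x(n := t)) n * exp (- V (x(n := t))))) (at t)"
proof -
  note slice = pot_slice[OF pot]
  obtain A B where A: "\<And>x. x \<in> Rn n \<Longrightarrow> (f x)\<^sup>2 \<le> A * (1 + sqn n x)"
    and B: "\<And>x. x \<in> Rn (Suc n) \<Longrightarrow> (G x n)\<^sup>2 \<le> B * (1 + sqn (Suc n) x)"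
    using f pot_lin_growth[OF pot, of n] by (auto simp: lin_growth_def)
  obtain K where K: "\<And>x. x \<in> Rn (Suc n) \<Longrightarrow> (1 + sqn (Suc n) x) * exp (- V x) \<le> K * exp (- (\<epsilon> / 8) * sqn (Suc n) x)"
    and K0: "0 \<le> K" using pot_exp_decay[OF pot] by blast
  define b where "b x = (\<bar>A\<bar> + \<bar>B\<bar>) * K * exp (- (\<epsilon> / 8) * sqn n x)" for x
  note e = pot_pos(1)[OF pot]
  note [measurable] = borel_measurable_sqn lin_growth_measurable[OF f]
  have "((\<lambda>t. LINT x|lebesgue_Rn n. f x * exp (- V (x(n := t)))) has_real_derivative
     (LINT x|lebesgue_Rn n. - (f x * G (x(n := t)) n * exp (- V (x(n := t)))))) (at t)"
  proof (rule DERIV_lebesgue_integral[where B = b])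
    show "integrable (lebesgue_Rn n) (\<lambda>x. f x * exp (- V (x(n := t))))" for t
      by (rule integrable_quad_growth_exp[OF slice lin_growth_imp_quad[OF f]])
    show "integrable (lebesgue_Rn n) b"
      by (rule integrable_gaussian_bound[of _ _ "\<epsilon> / 8" "(\<bar>A\<bar> + \<bar>B\<bar>) * K"]) (use K0 e in \<open>auto simp: b_def[abs_def] abs_mult\<close>)
    show "((\<lambda>t. f x * exp (- V (x(n := t)))) has_real_derivative - (f x * G (x(n := t)) n * exp (- V (x(n := t))))) (at t)"
      if "x \<in> space (lebesgue_Rn n)" for t x
      using that by (auto intro!: derivative_eq_intros pot_DERIV_last[OF pot] simp: space_lebesgue_Rn)
    have [measurable]: "(\<lambda>x. G (x(n := t)) n) \<in> borel_measurable (lebesgue_Rn n)"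
      by (rule measurable_compose[OF measurable_Rn_slice lin_growth_measurable[OF pot_lin_growth[OF pot]]]) simp
    note [measurable] = pot_measurable[OF slice]
    show "(\<lambda>x. - (f x * G (x(n := t)) n * exp (- V (x(n := t))))) \<in> borel_measurable (lebesgue_Rn n)"
      by measurable
    fix t x assume "x \<in> space (lebesgue_Rn n)"
    then have x: "x \<in> Rn n" by (simp add: space_lebesgue_Rn)
    let ?y = "x(n := t)"
    have le: "sqn n x \<le> sqn (Suc n) ?y" by (simp add: sqn_update)
    have "\<bar>- (f x * G ?y n * exp (- V ?y))\<bar> = \<bar>f x * G ?y n\<bar> * exp (- V ?y)" by (simp add: abs_mult)
    also have "\<dots> \<le> ((f x)\<^sup>2 + (G ?y n)\<^sup>2) * exp (- V ?y)"
      by (intro mult_right_mono abs_mult_le_power2_sum) simp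
    also have "\<dots> \<le> ((\<bar>A\<bar> + \<bar>B\<bar>) * (1 + sqn (Suc n) ?y)) * exp (- V ?y)"
    proof (intro mult_right_mono)
      have "(f x)\<^sup>2 \<le> \<bar>A\<bar> * (1 + sqn (Suc n) ?y)"
        using A[OF x] sqn_nonneg[of n x] le by (elim order_trans) (intro mult_mono, auto)
      moreover have "(G ?y n)\<^sup>2 \<le> \<bar>B\<bar> * (1 + sqn (Suc n) ?y)"
        using B[OF Rn_update[OF x, of t]] sqn_nonneg[of "Suc n" ?y] by (elim order_trans) (intro mult_right_mono, auto)
      ultimately show "(f x)\<^sup>2 + (G ?y n)\<^sup>2 \<le> (\<bar>A\<bar> + \<bar>B\<bar>) * (1 + sqn (Suc n) ?y)"
        by (simp only: distrib_right)
    qed simp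
    also have "\<dots> = (\<bar>A\<bar> + \<bar>B\<bar>) * ((1 + sqn (Suc n) ?y) * exp (- V ?y))" by simp
    also have "\<dots> \<le> (\<bar>A\<bar> + \<bar>B\<bar>) * (K * exp (- (\<epsilon> / 8) * sqn (Suc n) ?y))"
      by (intro mult_left_mono K Rn_update x) auto
    also have "\<dots> \<le> (\<bar>A\<bar> + \<bar>B\<bar>) * (K * exp (- (\<epsilon> / 8) * sqn n x))"
      using le e K0 by (intro mult_left_mono) auto
    finally show "\<bar>- (f x * G ?y n * exp (- V ?y))\<bar> \<le> b x" by (simp add: b_def mult.assoc)
  qed
  then show ?thesis by simp
qed

section \<open>Prekopa-Leindler inequality in dimension n\<close>

definition mid :: "nat \<Rightarrow> (nat \<Rightarrow> real) \<Rightarrow> (nat \<Rightarrow> real) \<Rightarrow> nat \<Rightarrow> real"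
  where "mid n x y = (\<lambda>i\<in>{..<n}. (x i + y i) / 2)"

lemma mid_in_Rn: "mid n x y \<in> Rn n"
  by (simp add: mid_def Rn_def)

lemma mid_update:
  "(mid n x y)(n := (s + t) / 2) = mid (Suc n) (x(n := s)) (y(n := t))"
  by (auto simp: mid_def fun_eq_iff)

lemma part_Suc:
  assumes pot: "pot (Suc n) \<epsilon> L V G"
  shows "integrable lborel (\<lambda>t. part n (\<lambda>x. V (x(n := t))))"
    and "part (Suc n) V = (LINT t|lborel. part n (\<lambda>x. V (x(n := t))))"
  using integral_lebesgue_Rn_Suc[OF integrable_exp_pot[OF pot]] by (simp_all add: part_def)

lemma DERIV_part_slice:
  assumes pot: "pot (Suc n) \<epsilon> L V G"
  shows "((\<lambda>t. part n (\<lambda>x. V (x(n := t)))) has_real_derivative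
     - (LINT x|lebesgue_Rn n. G (x(n := t)) n * exp (- V (x(n := t))))) (at t)"
  using DERIV_integral_slice[OF pot lin_growth_const[of n 1]] by (simp add: part_def)

text \<open>Tensorization: for fixed last coordinates \<open>s\<close> and \<open>t\<close> the
  induction hypothesis for the slices is exactly the pointwise hypothesis of the one-dimensional
  inequality for the slice partition functions. The constant \<kappa> is there to record gains from
  uniform convexity.\<close>

lemma prekopa_leindler:
  assumes "pot n \<epsilon> L V1 G1" "pot n \<epsilon> L V2 G2" "pot n \<epsilon> L V3 G3"
    and "\<And>x y. x \<in> Rn n \<Longrightarrow> y \<in> Rn n \<Longrightarrow> V3 (mid n x y) \<le> (V1 x + V2 y) / 2 + \<kappa>"
  shows "sqrt (part n V1 * part n V2) \<le> exp \<kappa> * part n V3"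
  using assms
proof (induction n arbitrary: V1 V2 V3 G1 G2 G3)
  case 0
  have p: "part 0 V = exp (- V (\<lambda>_. undefined))" for V by (simp add: part_def integral_lebesgue_Rn_0)
  have r: "(\<lambda>_. undefined) \<in> Rn 0" by (simp add: Rn_def)
  have "mid 0 (\<lambda>_. undefined) (\<lambda>_. undefined) = (\<lambda>_. undefined)" by (auto simp: mid_def)
  then have v: "V3 (\<lambda>_. undefined) \<le> (V1 (\<lambda>_. undefined) + V2 (\<lambda>_. undefined)) / 2 + \<kappa>"
    using 0(4)[OF r r] by simp
  have s: "sqrt (exp a * exp b) = exp ((a + b) / 2)" for a b :: real
    by (rule real_sqrt_unique) (auto simp: power2_eq_square exp_add[symmetric])
  show ?case unfolding p s using v by (simp add: exp_add[symmetric] field_simps)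
next
  case (Suc n)
  have c: "continuous_on UNIV (\<lambda>t. part n (\<lambda>x. V (x(n := t))))" if "pot (Suc n) \<epsilon> L V G" for V G
    using DERIV_part_slice[OF that] by (auto intro!: continuous_at_imp_continuous_on DERIV_isCont)
  have "sqrt ((LINT t|lborel. part n (\<lambda>x. V1 (x(n := t)))) * (LINT t|lborel. part n (\<lambda>x. V2 (x(n := t)))))
      \<le> (LINT t|lborel. exp \<kappa> * part n (\<lambda>x. V3 (x(n := t))))"
  proof (rule prekopa_leindler_1d)
    fix s t
    show "sqrt (part n (\<lambda>x. V1 (x(n := s))) * part n (\<lambda>x. V2 (x(n := t))))
       \<le> exp \<kappa> * part n (\<lambda>x. V3 (x(n := (s + t) / 2)))"
    proof (rule Suc.IH)
      fix x y assume xy: "x \<in> Rn n" "y \<in> Rn n"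
      show "V3 ((mid n x y)(n := (s + t) / 2)) \<le> (V1 (x(n := s)) + V2 (y(n := t))) / 2 + \<kappa>"
        unfolding mid_update by (intro Suc.prems(4) Rn_update xy)
    qed (rule pot_slice[OF Suc.prems(1)] pot_slice[OF Suc.prems(2)] pot_slice[OF Suc.prems(3)])+
  qed (use Suc.prems(1-3) in \<open>auto intro!: c part_Suc part_pos pot_slice continuous_on_mult_left mult_pos_pos\<close>)
  then show ?case
    by (simp only: part_Suc(2)[OF Suc.prems(1)] part_Suc(2)[OF Suc.prems(2)] part_Suc(2)[OF Suc.prems(3)]
        integral_mult_right_zero)
qed

section \<open>Marginals and covariances\<close>

text \<open>Midpoint convexity, iterated on the points \<open>s + c / 2 ^ k\<close>, bounds
  difference quotients at \<open>s\<close> by the chord; in the limit it gives the tangent line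
  inequality. Adding the tangent inequalities at \<open>s\<close> and at \<open>t\<close> gives
  monotonicity.\<close>

lemma deriv_mono_if_midpoint_convex:
  fixes f f' :: "real \<Rightarrow> real"
  assumes d: "\<And>t. (f has_real_derivative f' t) (at t)"
    and m: "\<And>s t. f ((s + t) / 2) \<le> (f s + f t) / 2"
    and "s \<le> t"
  shows "f' s \<le> f' t"
proof -
  have tangent: "f' s * c \<le> f (s + c) - f s" if "c \<noteq> 0" for s c
  proof -
    have "2 ^ k * (f (s + c / 2 ^ k) - f s) \<le> f (s + c) - f s" for k :: nat
    proof (induction k)
      case (Suc k)
      have "f (s + c / 2 ^ Suc k) = f ((s + (s + c / 2 ^ k)) / 2)"
        by (simp add: field_simps)
      also have "\<dots> \<le> (f s + f (s + c / 2 ^ k)) / 2" by (rule m)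
      finally have "2 * (f (s + c / 2 ^ Suc k) - f s) \<le> f (s + c / 2 ^ k) - f s" by simp
      then have "2 ^ k * (2 * (f (s + c / 2 ^ Suc k) - f s)) \<le> 2 ^ k * (f (s + c / 2 ^ k) - f s)"
        by (intro mult_left_mono) auto
      then have "2 ^ Suc k * (f (s + c / 2 ^ Suc k) - f s) \<le> 2 ^ k * (f (s + c / 2 ^ k) - f s)"
        by (simp only: power_Suc2 mult.assoc)
      with Suc show ?case by linarith
    qed simp
    moreover have "(\<lambda>k. c * ((f (s + c / 2 ^ k) - f s) / (c / 2 ^ k))) \<longlonglongrightarrow> c * f' s"
    proof (intro tendsto_mult_left)
      have "(\<lambda>k. c / 2 ^ k) \<longlonglongrightarrow> 0"
        by (rule LIMSEQ_divide_realpow_zero) simp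
      then have "filterlim (\<lambda>k. c / 2 ^ k) (at 0) sequentially"
        using that by (simp add: filterlim_at)
      from filterlim_compose[OF d[of s, unfolded DERIV_def] this]
      show "(\<lambda>k. (f (s + c / 2 ^ k) - f s) / (c / 2 ^ k)) \<longlonglongrightarrow> f' s" .
    qed
    moreover have "c * ((f (s + c / 2 ^ k) - f s) / (c / 2 ^ k)) = 2 ^ k * (f (s + c / 2 ^ k) - f s)" for k
      using that by (simp add: field_simps)
    ultimately have "c * f' s \<le> f (s + c) - f s"
      by (intro LIMSEQ_le_const2) auto
    then show ?thesis by (simp add: mult.commute)
  qed
  show ?thesis
  proof (cases "s = t")
    case False
    then have "f' s * (t - s) \<le> f t - f s" "f' t * (s - t) \<le> f s - f t"
      using tangent[of "t - s" s] tangent[of "s - t" t] by auto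
    then have "(f' s - f' t) * (t - s) \<le> 0" by (simp add: algebra_simps)
    then show ?thesis using \<open>s \<le> t\<close> False by (simp add: mult_le_0_iff)
  qed simp
qed

lemma exp_midpoint_le: "exp ((a + b) / 2) \<le> (exp a + exp b) / (2 :: real)"
proof -
  have "(exp (c / 2))\<^sup>2 = exp c" for c :: real by (simp add: power2_eq_square exp_add[symmetric])
  moreover have "exp ((a + b) / 2) = exp (a / 2) * exp (b / 2)"
    by (simp add: exp_add[symmetric] add_divide_distrib)
  ultimately show ?thesis
    using zero_le_power2[of "exp (a / 2) - exp (b / 2)"] by (simp add: power2_diff)
qed

lemma mid_same: "x \<in> Rn n \<Longrightarrow> mid n x x = x"
  by (auto simp: mid_def Rn_def fun_eq_iff PiE_iff extensional_def)

text \<open>Expanding both endpoints at the midpoint cancels the gradient terms. Half the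
  displacement has a quarter of the squared norm, which turns \<epsilon>/2 and L/2 into \<epsilon>/8
  and L/8.\<close>

lemma pot_mid:
  assumes pot: "pot n \<epsilon> L V G" and xy: "x \<in> Rn n" "y \<in> Rn n"
  shows "V (mid n x y) \<le> (V x + V y) / 2 - \<epsilon> / 8 * sqn n (\<lambda>i. y i - x i)"
    and "(V x + V y) / 2 - L / 8 * sqn n (\<lambda>i. y i - x i) \<le> V (mid n x y)"
proof -
  let ?m = "mid n x y"
  have m: "?m \<in> Rn n" by (rule mid_in_Rn)
  have s: "sqn n (\<lambda>i. x i - ?m i) = sqn n (\<lambda>i. y i - x i) / 4" "sqn n (\<lambda>i. y i - ?m i) = sqn n (\<lambda>i. y i - x i) / 4"
    unfolding sqn_def sum_divide_distrib
    by (auto intro!: sum.cong simp: mid_def power2_eq_square field_simps)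
  have "(\<Sum>i<n. G ?m i * (x i - ?m i)) + (\<Sum>i<n. G ?m i * (y i - ?m i)) = 0"
    unfolding sum.distrib[symmetric] by (intro sum.neutral) (auto simp: mid_def field_simps)
  then show "V ?m \<le> (V x + V y) / 2 - \<epsilon> / 8 * sqn n (\<lambda>i. y i - x i)"
    "(V x + V y) / 2 - L / 8 * sqn n (\<lambda>i. y i - x i) \<le> V ?m"
    using pot_lower[OF pot m xy(1)] pot_lower[OF pot m xy(2)]
      pot_upper[OF pot m xy(1)] pot_upper[OF pot m xy(2)]
    unfolding s by (simp_all add: field_simps)
qed

section \<open>The potential of the last coordinate\<close>

abbreviation sl :: "nat \<Rightarrow> ((nat \<Rightarrow> real) \<Rightarrow> 'a) \<Rightarrow> real \<Rightarrow> (nat \<Rightarrow> real) \<Rightarrow> 'a"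
  where "sl n f t \<equiv> (\<lambda>x. f (x(n := t)))"

text \<open>Up to normalization \<open>exp (- marg n V t)\<close> is the density of the last
  coordinate under \<open>mu (Suc n) V\<close>. Its derivative \<open>marg'\<close> is the
  conditional mean of the last partial derivative.\<close>

definition marg :: "nat \<Rightarrow> ((nat \<Rightarrow> real) \<Rightarrow> real) \<Rightarrow> real \<Rightarrow> real"
  where "marg n V t = - ln (part n (sl n V t))"

definition marg' :: "nat \<Rightarrow> ((nat \<Rightarrow> real) \<Rightarrow> real) \<Rightarrow> ((nat \<Rightarrow> real) \<Rightarrow> nat \<Rightarrow> real) \<Rightarrow> real \<Rightarrow> real"
  where "marg' n V G t = (LINT x|mu n (sl n V t). G (x(n := t)) n)"

lemma exp_marg:
  assumes "pot (Suc n) \<epsilon> L V G"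
  shows "exp (- marg n V t) = part n (sl n V t)"
  using part_pos[OF pot_slice[OF assms]] by (simp add: marg_def)

lemma measurable_slice_gradient:
  assumes "pot (Suc n) \<epsilon> L V G" "i < Suc n"
  shows "(\<lambda>x. G (x(n := t)) i) \<in> borel_measurable (lebesgue_Rn n)"
  by (rule measurable_compose[OF measurable_Rn_slice lin_growth_measurable[OF pot_lin_growth[OF assms]]])

lemma DERIV_marg:
  assumes pot: "pot (Suc n) \<epsilon> L V G"
  shows "(marg n V has_real_derivative marg' n V G t) (at t)"
proof -
  note p = part_pos[OF pot_slice[OF pot], of t]
  have "((\<lambda>t. - ln (part n (sl n V t))) has_real_derivative
     - (- (LINT x|lebesgue_Rn n. G (x(n := t)) n * exp (- V (x(n := t)))) / part n (sl n V t))) (at t)"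
    by (rule DERIV_cong[OF DERIV_minus[OF DERIV_chain2[OF DERIV_ln_divide[OF p] DERIV_part_slice[OF pot]]]]) simp
  moreover have "- (- (LINT x|lebesgue_Rn n. G (x(n := t)) n * exp (- V (x(n := t)))) / part n (sl n V t)) = marg' n V G t"
    unfolding marg'_def by (subst integral_mu[OF pot_slice[OF pot]]) (auto intro: measurable_slice_gradient[OF pot])
  ultimately show ?thesis unfolding marg_def[abs_def] by simp
qed

text \<open>Prekopa-Leindler for the slices at \<open>s\<close>, \<open>t\<close> and their
  midpoint. Of the convexity gain only the part in the last coordinate is kept; it is independent of
  \<open>x\<close> and \<open>y\<close> and serves as \<kappa>.\<close>

lemma marg_midpoint_lower:
  assumes pot: "pot (Suc n) \<epsilon> L V G"
  shows "marg n V ((s + t) / 2) \<le> (marg n V s + marg n V t) / 2 - \<epsilon> / 8 * (t - s)\<^sup>2"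
proof -
  note slice = pot_slice[OF pot]
  let ?w = "\<lambda>t. part n (sl n V t)"
  have "sqrt (?w s * ?w t) \<le> exp (- \<epsilon> / 8 * (t - s)\<^sup>2) * ?w ((s + t) / 2)"
  proof (rule prekopa_leindler[OF slice slice slice])
    fix x y assume xy: "x \<in> Rn n" "y \<in> Rn n"
    have "sqn (Suc n) (\<lambda>i. (y(n := t)) i - (x(n := s)) i) = sqn n (\<lambda>i. y i - x i) + (t - s)\<^sup>2"
      by (simp add: sqn_def)
    then have "\<epsilon> / 8 * (t - s)\<^sup>2 \<le> \<epsilon> / 8 * sqn (Suc n) (\<lambda>i. (y(n := t)) i - (x(n := s)) i)"
      using pot_pos[OF pot] sqn_nonneg[of n "\<lambda>i. y i - x i"] by simp
    then show "V ((mid n x y)(n := (s + t) / 2)) \<le> (V (x(n := s)) + V (y(n := t))) / 2 + - \<epsilon> / 8 * (t - s)\<^sup>2"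
      using pot_mid(1)[OF pot Rn_update[OF xy(1), of s] Rn_update[OF xy(2), of t]]
      unfolding mid_update by simp
  qed
  then have le: "ln (sqrt (?w s * ?w t)) \<le> ln (exp (- \<epsilon> / 8 * (t - s)\<^sup>2) * ?w ((s + t) / 2))"
    using part_pos[OF slice] by (subst ln_le_cancel_iff) auto
  have lns: "ln (sqrt (p * q)) = (ln p + ln q) / 2" "ln (exp c * p) = c + ln p"
    if "0 < p" "0 < q" for p q c :: real
    using that by (simp_all add: ln_sqrt ln_mult_pos)
  note p = part_pos[OF slice]
  show ?thesis
    using le unfolding lns(1)[OF p p] lns(2)[OF p p] by (simp add: marg_def field_simps)
qed

text \<open>Here the same \<open>x\<close> is used in both slices. The factors
  \<open>exp \<alpha>\<close> and \<open>exp \<beta>\<close> scale the two slice weights to mass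
  one; the geometric mean of the scaled weights is at most their arithmetic mean, again of mass one,
  and \<open>exp c\<close> is what the scaling and the curvature leave over.\<close>

lemma marg_midpoint_upper:
  assumes pot: "pot (Suc n) \<epsilon> L V G"
  shows "(marg n V s + marg n V t) / 2 - L / 8 * (t - s)\<^sup>2 \<le> marg n V ((s + t) / 2)"
proof -
  note slice = pot_slice[OF pot]
  let ?w = "\<lambda>t. part n (sl n V t)"
  define \<alpha> \<beta> where "\<alpha> = marg n V s" and "\<beta> = marg n V t"
  define c where "c = L / 8 * (t - s)\<^sup>2 - (\<alpha> + \<beta>) / 2"
  have "?w ((s + t) / 2) \<le> (LINT x|lebesgue_Rn n. exp c * ((exp \<alpha> * exp (- V (x(n := s))) + exp \<beta> * exp (- V (x(n := t)))) / 2))"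
    unfolding part_def
  proof (rule integral_mono)
    fix x assume "x \<in> space (lebesgue_Rn n)"
    then have x: "x \<in> Rn n" by (simp add: space_lebesgue_Rn)
    have "sqn (Suc n) (\<lambda>i. (x(n := t)) i - (x(n := s)) i) = (t - s)\<^sup>2"
      by (simp add: sqn_def)
    then have "- V (x(n := (s + t) / 2)) \<le> c + ((\<alpha> - V (x(n := s))) + (\<beta> - V (x(n := t)))) / 2"
      using pot_mid(2)[OF pot Rn_update[OF x, of s] Rn_update[OF x, of t]]
      unfolding mid_update[symmetric] mid_same[OF x] c_def by (simp add: field_simps)
    then have "exp (- V (x(n := (s + t) / 2))) \<le> exp (c + ((\<alpha> - V (x(n := s))) + (\<beta> - V (x(n := t)))) / 2)"
      by simp
    also have "\<dots> = exp c * exp (((\<alpha> - V (x(n := s))) + (\<beta> - V (x(n := t)))) / 2)" by (rule exp_add)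
    also have "\<dots> \<le> exp c * ((exp (\<alpha> - V (x(n := s))) + exp (\<beta> - V (x(n := t)))) / 2)"
    proof (rule mult_left_mono)
      show "exp (((\<alpha> - V (x(n := s))) + (\<beta> - V (x(n := t)))) / 2) \<le> (exp (\<alpha> - V (x(n := s))) + exp (\<beta> - V (x(n := t)))) / 2"
        by (rule exp_midpoint_le)
    qed simp
    finally show "exp (- V (x(n := (s + t) / 2))) \<le> exp c * ((exp \<alpha> * exp (- V (x(n := s))) + exp \<beta> * exp (- V (x(n := t)))) / 2)"
      by (simp add: exp_add[symmetric])
  qed (use integrable_exp_pot[OF slice] in auto)
  also have "\<dots> = exp c * ((exp \<alpha> * ?w s + exp \<beta> * ?w t) / 2)"
    using integrable_exp_pot[OF slice] by (simp add: part_def)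
  also have "\<dots> = exp c"
    unfolding exp_marg[OF pot, symmetric] by (simp add: \<alpha>_def \<beta>_def exp_add[symmetric])
  finally have "ln (?w ((s + t) / 2)) \<le> ln (exp c)"
    using part_pos[OF slice] by (subst ln_le_cancel_iff) auto
  then show ?thesis by (simp add: marg_def[of n V "(s + t) / 2"] c_def \<alpha>_def \<beta>_def)
qed

text \<open>Marginalization keeps both constants, which is what allows the one-dimensional results
  to be applied at every stage of the inductions. The midpoint inequalities are applied after
  subtracting the parabolas with curvature \<epsilon> and L.\<close>

lemma pot1_marg:
  assumes pot: "pot (Suc n) \<epsilon> L V G"
  shows "pot1 \<epsilon> L (marg n V) (marg' n V G)"
  unfolding pot1_def
proof (intro conjI allI impI)
  show "0 < \<epsilon>" using pot_pos[OF pot] by simp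
  show "(marg n V has_real_derivative marg' n V G t) (at t)" for t by (rule DERIV_marg[OF pot])
  fix s t :: real assume "s \<le> t"
  have p: "((u + v) / 2)\<^sup>2 = (u\<^sup>2 + v\<^sup>2) / 2 - (v - u)\<^sup>2 / 4" for u v :: real
    by (simp add: power2_eq_square field_simps)
  have "marg' n V G s - \<epsilon> * s \<le> marg' n V G t - \<epsilon> * t"
  proof (rule deriv_mono_if_midpoint_convex[OF _ _ \<open>s \<le> t\<close>, of "\<lambda>t. marg n V t - \<epsilon> / 2 * t\<^sup>2"])
    show "((\<lambda>t. marg n V t - \<epsilon> / 2 * t\<^sup>2) has_real_derivative marg' n V G t - \<epsilon> * t) (at t)" for t
      by (auto intro!: derivative_eq_intros DERIV_marg[OF pot])
    show "marg n V ((u + v) / 2) - \<epsilon> / 2 * ((u + v) / 2)\<^sup>2 \<le> (marg n V u - \<epsilon> / 2 * u\<^sup>2 + (marg n V v - \<epsilon> / 2 * v\<^sup>2)) / 2" for u v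
      using marg_midpoint_lower[OF pot, of u v] unfolding p by (simp add: field_simps)
  qed
  then show "\<epsilon> * (t - s) \<le> marg' n V G t - marg' n V G s" by (simp add: algebra_simps)
  have "L * s - marg' n V G s \<le> L * t - marg' n V G t"
  proof (rule deriv_mono_if_midpoint_convex[OF _ _ \<open>s \<le> t\<close>, of "\<lambda>t. L / 2 * t\<^sup>2 - marg n V t"])
    show "((\<lambda>t. L / 2 * t\<^sup>2 - marg n V t) has_real_derivative L * t - marg' n V G t) (at t)" for t
      by (auto intro!: derivative_eq_intros DERIV_marg[OF pot])
    show "L / 2 * ((u + v) / 2)\<^sup>2 - marg n V ((u + v) / 2) \<le> (L / 2 * u\<^sup>2 - marg n V u + (L / 2 * v\<^sup>2 - marg n V v)) / 2" for u v
      using marg_midpoint_upper[OF pot, of u v] unfolding p by (simp add: field_simps)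
  qed
  then show "marg' n V G t - marg' n V G s \<le> L * (t - s)" by (simp add: algebra_simps)
qed

lemma part1_marg:
  assumes pot: "pot (Suc n) \<epsilon> L V G"
  shows "part1 (marg n V) = part (Suc n) V"
  unfolding part1_def exp_marg[OF pot] part_Suc(2)[OF pot] ..

lemma integral_mu_Suc:
  assumes pot: "pot (Suc n) \<epsilon> L V G" and f: "quad_growth (Suc n) f"
  shows "integrable (nu (marg n V)) (\<lambda>t. LINT x|mu n (sl n V t). f (x(n := t)))"
    and "(LINT x|mu (Suc n) V. f x) = (LINT t|nu (marg n V). LINT x|mu n (sl n V t). f (x(n := t)))"
proof -
  note slice = pot_slice[OF pot] and pot1 = pot1_marg[OF pot]
  define \<phi> where "\<phi> t = (LINT x|mu n (sl n V t). f (x(n := t)))" for t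
  note I = integral_lebesgue_Rn_Suc[OF integrable_quad_growth_exp[OF pot f]]
  have eq: "\<phi> t * exp (- marg n V t) = (LINT x|lebesgue_Rn n. f (x(n := t)) * exp (- V (x(n := t))))" for t
    unfolding \<phi>_def exp_marg[OF pot]
    using part_pos[OF slice, of t]
    by (subst integral_mu[OF slice quad_growth_measurable[OF quad_growth_slice[OF f]]]) simp
  have i: "integrable lborel (\<lambda>t. \<phi> t * exp (- marg n V t))" unfolding eq by (rule I(1))
  note [measurable] = pot1_measurable[OF pot1] borel_measurable_integrable[OF i]
  \<comment> \<open>Fubini gives measurability of \<phi> only together with the weight; the weight
    is positive and measurable, so it can be divided out.\<close>
  have "(\<lambda>t. (\<phi> t * exp (- marg n V t)) * exp (marg n V t)) \<in> borel_measurable borel" by measurable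
  moreover have "(\<phi> t * exp (- marg n V t)) * exp (marg n V t) = \<phi> t" for t
    by (simp add: exp_add[symmetric] mult.assoc)
  ultimately have [measurable]: "\<phi> \<in> borel_measurable borel" by simp
  show "integrable (nu (marg n V)) (\<lambda>t. LINT x|mu n (sl n V t). f (x(n := t)))"
    unfolding \<phi>_def[symmetric] using i by (subst integrable_nu_iff[OF pot1]) auto
  show "(LINT x|mu (Suc n) V. f x) = (LINT t|nu (marg n V). LINT x|mu n (sl n V t). f (x(n := t)))"
    unfolding \<phi>_def[symmetric]
    by (subst integral_mu[OF pot quad_growth_measurable[OF f]], subst integral_nu[OF pot1])
       (simp_all add: eq I(2) part1_marg[OF pot])
qed

section \<open>Translation invariance and the mean of the gradient\<close>

definition translate :: "nat \<Rightarrow> (nat \<Rightarrow> real) \<Rightarrow> (nat \<Rightarrow> real) \<Rightarrow> nat \<Rightarrow> real"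
  where "translate n a x = (\<lambda>i\<in>{..<n}. x i + a i)"

lemma measurable_translate: "translate n a \<in> measurable (lebesgue_Rn n) (lebesgue_Rn n)"
  unfolding translate_def[abs_def] lebesgue_Rn_def by measurable

lemma distr_translate: "distr (lebesgue_Rn n) (lebesgue_Rn n) (translate n a) = lebesgue_Rn n"
  unfolding lebesgue_Rn_def
proof (rule lborel_PiM.PiM_eqI)
  fix A :: "nat \<Rightarrow> real set" assume A: "\<And>i. i \<in> {..<n} \<Longrightarrow> A i \<in> sets lborel"
  let ?M = "Pi\<^sub>M {..<n} (\<lambda>_. lborel :: real measure)"
  have A': "(\<lambda>y. y + a i) -` A i \<in> sets lborel" if "i < n" for i
    using measurable_sets[of "\<lambda>y. y + a i" borel borel "A i"] A[of i] that by simp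
  have "translate n a -` Pi\<^sub>E {..<n} A \<inter> space ?M = Pi\<^sub>E {..<n} (\<lambda>i. (\<lambda>y. y + a i) -` A i)"
    by (auto simp: translate_def space_PiM PiE_iff)
  then have "emeasure (distr ?M ?M (translate n a)) (Pi\<^sub>E {..<n} A) = emeasure ?M (Pi\<^sub>E {..<n} (\<lambda>i. (\<lambda>y. y + a i) -` A i))"
    using A measurable_translate[of n a] by (subst emeasure_distr) (auto simp: lebesgue_Rn_def)
  also have "\<dots> = (\<Prod>i<n. emeasure lborel ((\<lambda>y. y + a i) -` A i))"
    using A' by (subst lborel_PiM.emeasure_PiM) auto
  also have "\<dots> = (\<Prod>i<n. emeasure lborel (A i))"
  proof (rule prod.cong)
    fix i assume "i \<in> {..<n}"
    then have "emeasure (distr lborel borel (\<lambda>y. a i + y)) (A i) = emeasure lborel ((\<lambda>y. y + a i) -` A i)"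
    proof -
      have "(\<lambda>y. y + a i) = (\<lambda>y. a i + y)" by (simp add: fun_eq_iff)
      then show ?thesis using A \<open>i \<in> {..<n}\<close> by (subst emeasure_distr) simp_all
    qed
    then show "emeasure lborel ((\<lambda>y. y + a i) -` A i) = emeasure lborel (A i)"
      by (simp add: lborel_distr_plus)
  qed simp
  finally show "emeasure (distr ?M ?M (translate n a)) (Pi\<^sub>E {..<n} A) = (\<Prod>i\<in>{..<n}. emeasure lborel (A i))" .
qed auto

lemma integral_translate:
  fixes f :: "(nat \<Rightarrow> real) \<Rightarrow> real"
  assumes "f \<in> borel_measurable (lebesgue_Rn n)"
  shows "(LINT x|lebesgue_Rn n. f (translate n a x)) = (LINT x|lebesgue_Rn n. f x)"
    and "integrable (lebesgue_Rn n) (\<lambda>x. f (translate n a x)) \<longleftrightarrow> integrable (lebesgue_Rn n) f"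
  using integral_distr[OF measurable_translate assms, of a] integrable_distr_eq[OF measurable_translate assms, of a]
  unfolding distr_translate by simp_all

text \<open>Integration by parts in the form of translation invariance: shifting
  \<open>exp (- V x)\<close> by \<open>s\<close> along one axis leaves its integral \<open>Z\<close>
  unchanged, while to first order in \<open>s\<close> the integral changes by
  \<open>- s * \<gamma>\<close>. The upper quadratic bound on \<open>V\<close> controls the error by
  a multiple of \<open>s\<^sup>2\<close>, and both signs of \<open>s\<close> force \<gamma> to
  vanish.\<close>

lemma integral_gradient_eq_0:
  assumes pot: "pot n \<epsilon> L V G" and i: "i < n"
  shows "(LINT x|mu n V. G x i) = 0"
proof -
  note lin = pot_lin_growth[OF pot i]
  note [measurable] = pot_measurable[OF pot] lin_growth_measurable[OF lin]
  define \<gamma> where "\<gamma> = (LINT x|lebesgue_Rn n. G x i * exp (- V x))"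
  define Z where "Z = part n V"
  have Z: "0 < Z" unfolding Z_def by (rule part_pos[OF pot])
  have iG: "integrable (lebesgue_Rn n) (\<lambda>x. G x i * exp (- V x))"
    by (rule integrable_quad_growth_exp[OF pot lin_growth_imp_quad[OF lin]])
  note iV = integrable_exp_pot[OF pot]
  have main: "exp (- L / 2 * s\<^sup>2) * (Z - s * \<gamma>) \<le> Z" for s
  proof -
    define a where "a = (\<lambda>j. if j = i then s else 0)"
    have "(LINT x|lebesgue_Rn n. exp (- L / 2 * s\<^sup>2) * (exp (- V x) - s * (G x i * exp (- V x))))
       \<le> (LINT x|lebesgue_Rn n. exp (- V (translate n a x)))"
    proof (rule integral_mono)
      show "integrable (lebesgue_Rn n) (\<lambda>x. exp (- V (translate n a x)))"
        using integral_translate(2)[of "\<lambda>x. exp (- V x)" n a] iV by simp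
      fix x assume "x \<in> space (lebesgue_Rn n)"
      then have x: "x \<in> Rn n" by (simp add: space_lebesgue_Rn)
      have y: "translate n a x \<in> Rn n" by (simp add: translate_def Rn_def)
      have "sqn n (\<lambda>j. translate n a x j - x j) = (\<Sum>j<n. if j = i then s\<^sup>2 else 0)"
        unfolding sqn_def by (intro sum.cong) (auto simp: translate_def a_def)
      then have e1: "sqn n (\<lambda>j. translate n a x j - x j) = s\<^sup>2" using i by simp
      have "(\<Sum>j<n. G x j * (translate n a x j - x j)) = (\<Sum>j<n. if j = i then G x i * s else 0)"
        by (intro sum.cong) (auto simp: translate_def a_def)
      then have e2: "(\<Sum>j<n. G x j * (translate n a x j - x j)) = G x i * s" using i by simp
      have "- V x + (- L / 2 * s\<^sup>2) + (- s * G x i) \<le> - V (translate n a x)"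
        using pot_upper[OF pot x y] unfolding e1 e2 by (simp add: mult.commute)
      then have "exp (- V x + (- L / 2 * s\<^sup>2) + (- s * G x i)) \<le> exp (- V (translate n a x))" by simp
      moreover have "exp (- L / 2 * s\<^sup>2) * (exp (- V x) - s * (G x i * exp (- V x)))
          = exp (- L / 2 * s\<^sup>2) * exp (- V x) * (1 + (- s * G x i))" by (simp add: algebra_simps)
      moreover have "\<dots> \<le> exp (- L / 2 * s\<^sup>2) * exp (- V x) * exp (- s * G x i)"
        by (intro mult_left_mono exp_ge_add_one_self) auto
      moreover have "exp (- V x + (- L / 2 * s\<^sup>2) + (- s * G x i)) = exp (- L / 2 * s\<^sup>2) * exp (- V x) * exp (- s * G x i)"
        by (simp only: exp_add mult.commute mult.left_commute)
      ultimately show "exp (- L / 2 * s\<^sup>2) * (exp (- V x) - s * (G x i * exp (- V x))) \<le> exp (- V (translate n a x))"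
        by linarith
    qed (use iV iG in auto)
    also have "\<dots> = Z" using integral_translate(1)[of "\<lambda>x. exp (- V x)" n a] by (simp add: Z_def part_def)
    also have "(LINT x|lebesgue_Rn n. exp (- L / 2 * s\<^sup>2) * (exp (- V x) - s * (G x i * exp (- V x))))
        = exp (- L / 2 * s\<^sup>2) * (Z - s * \<gamma>)"
      using iV iG by (simp add: Z_def part_def \<gamma>_def)
    finally show ?thesis .
  qed
  \<comment> \<open>The factor \<open>exp (- L / 2 * s\<^sup>2)\<close> moves to the other side,
    where for exponents at most 1 it is bounded by \<open>1 + L * s\<^sup>2\<close>.\<close>
  have main2: "- s * \<gamma> \<le> Z * L * s\<^sup>2" if "L / 2 * s\<^sup>2 \<le> 1" for s
  proof -
    define y where "y = L / 2 * s\<^sup>2"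
    have y: "0 \<le> y" "y \<le> 1" using that pot_pos[OF pot] by (auto simp: y_def)
    have "Z - s * \<gamma> = exp y * (exp (- y) * (Z - s * \<gamma>))" by (simp add: mult.assoc[symmetric] exp_add[symmetric])
    also have "\<dots> \<le> exp y * Z" using main[of s] by (intro mult_left_mono) (auto simp: y_def)
    also have "\<dots> \<le> (1 + y + y\<^sup>2) * Z" using exp_bound[OF y] Z by (intro mult_right_mono) auto
    also have "\<dots> \<le> (1 + 2 * y) * Z"
      using y Z mult_left_mono[of y 1 y] by (intro mult_right_mono) (auto simp: power2_eq_square)
    finally show ?thesis by (simp add: y_def algebra_simps)
  qed
  have "\<gamma> = 0"
  proof (rule ccontr)
    assume "\<gamma> \<noteq> 0"
    \<comment> \<open>The second entry makes the quadratic error at most half of the linear term;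
      the first one, together with \<open>h \<le> 1\<close>, keeps the exponent below 1 so that
      \<open>main2\<close> applies.\<close>
    define q where "q = min (1 / L) (\<bar>\<gamma>\<bar> / (2 * Z * L))"
    define h where "h = min 1 q"
    have L: "0 < L" using pot_pos[OF pot] by simp
    have h: "0 < h" "h \<le> 1" "h \<le> 1 / L" "h \<le> \<bar>\<gamma>\<bar> / (2 * Z * L)"
      using L Z \<open>\<gamma> \<noteq> 0\<close> by (auto simp: h_def q_def)
    have "h\<^sup>2 \<le> h" using h by (simp add: power2_eq_square mult_left_le)
    then have "L / 2 * h\<^sup>2 \<le> L / 2 * (1 / L)" using h L by (intro mult_left_mono) auto
    then have "L / 2 * h\<^sup>2 \<le> 1" using L by simp
    from main2[of h] main2[of "- h"] this have "h * \<bar>\<gamma>\<bar> \<le> Z * L * h\<^sup>2" by (simp add: abs_if)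
    then have "h * \<bar>\<gamma>\<bar> \<le> h * (Z * L * h)" by (simp only: power2_eq_square mult_ac)
    then have "\<bar>\<gamma>\<bar> \<le> Z * L * h" using h(1) by (simp only: mult_le_cancel_left_pos)
    also have "\<dots> \<le> Z * L * (\<bar>\<gamma>\<bar> / (2 * Z * L))" using h Z L by (intro mult_left_mono) auto
    also have "\<dots> = \<bar>\<gamma>\<bar> / 2" using Z L by simp
    finally show False using \<open>\<gamma> \<noteq> 0\<close> by simp
  qed
  then show ?thesis by (subst integral_mu[OF pot]) (auto simp: \<gamma>_def)
qed

section \<open>Variance of linear forms\<close>

lemma two_plus_power2_le_cosh: "2 + u\<^sup>2 \<le> exp u + exp (- u :: real)"
proof -
  have ge2: "2 \<le> exp w + exp (- w)" for w :: real
    using exp_midpoint_le[of w "- w"] by simp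
  have pos: "2 * w \<le> exp w - exp (- w)" if "0 \<le> w" for w :: real
  proof -
    have "exp 0 - exp (- 0) - 2 * 0 \<le> exp w - exp (- w) - 2 * w"
    proof (rule deriv_nonneg_imp_mono[OF _ _ that, of "\<lambda>w. exp w - exp (- w) - 2 * w" "\<lambda>w. exp w + exp (- w) - 2"])
      show "((\<lambda>w. exp w - exp (- w) - 2 * w) has_real_derivative exp w + exp (- w) - 2) (at w)" for w :: real
        by (auto intro!: derivative_eq_intros)
    qed (use ge2 in \<open>simp add: algebra_simps\<close>)
    then show ?thesis by simp
  qed
  \<comment> \<open>The square on the right is \<open>exp u + exp (- u) - 2\<close>, so halving the
    argument reduces the claim to \<open>2 * w \<le> exp w - exp (- w)\<close>.\<close>
  have "\<bar>u\<bar>\<^sup>2 \<le> (exp (\<bar>u\<bar> / 2) - exp (- (\<bar>u\<bar> / 2)))\<^sup>2"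
    using pos[of "\<bar>u\<bar> / 2"] by (intro power_mono) auto
  also have "\<dots> = exp \<bar>u\<bar> + exp (- \<bar>u\<bar>) - 2"
    by (simp add: power2_eq_square algebra_simps exp_add[symmetric])
  also have "exp \<bar>u\<bar> + exp (- \<bar>u\<bar>) = exp u + exp (- u)" by (simp add: abs_if)
  finally show ?thesis by simp
qed

text \<open>A linear term does not enter the Taylor remainder, so exponential tilts stay in the
  class with the same constants.\<close>

lemma pot_tilt:
  assumes pot: "pot n \<epsilon> L V G"
  shows "pot n \<epsilon> L (\<lambda>x. V x + s * (\<Sum>i<n. v i * x i)) (\<lambda>x i. G x i + s * v i)"
  unfolding pot_def
proof (intro conjI ballI allI impI)
  show "0 < \<epsilon>" "0 < L" using pot_pos[OF pot] by auto
  show "(\<lambda>x. V x + s * (\<Sum>i<n. v i * x i)) \<in> borel_measurable (lebesgue_Rn n)"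
    by (intro borel_measurable_add pot_measurable[OF pot] borel_measurable_times borel_measurable_sum
        measurable_Rn_component) auto
  show "lin_growth n (\<lambda>x. G x i + s * v i)" if "i < n" for i
    by (intro lin_growth_add lin_growth_const pot_lin_growth[OF pot that])
  fix x y assume xy: "x \<in> Rn n" "y \<in> Rn n"
  have eq: "V y + s * (\<Sum>i<n. v i * y i) - (V x + s * (\<Sum>i<n. v i * x i)) - (\<Sum>i<n. (G x i + s * v i) * (y i - x i))
     = V y - V x - (\<Sum>i<n. G x i * (y i - x i))"
    by (simp add: algebra_simps sum_subtractf sum.distrib sum_distrib_left)
  show "\<epsilon> / 2 * sqn n (\<lambda>i. y i - x i)
       \<le> V y + s * (\<Sum>i<n. v i * y i) - (V x + s * (\<Sum>i<n. v i * x i)) - (\<Sum>i<n. (G x i + s * v i) * (y i - x i))"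
    unfolding eq by (rule pot_lower[OF pot xy])
  show "V y + s * (\<Sum>i<n. v i * y i) - (V x + s * (\<Sum>i<n. v i * x i)) - (\<Sum>i<n. (G x i + s * v i) * (y i - x i))
       \<le> L / 2 * sqn n (\<lambda>i. y i - x i)"
    unfolding eq by (rule pot_upper[OF pot xy])
qed

definition varm :: "'a measure \<Rightarrow> ('a \<Rightarrow> real) \<Rightarrow> real"
  where "varm M f = (LINT x|M. (f x)\<^sup>2) - (LINT x|M. f x)\<^sup>2"

text \<open>With \<open>A x = (\<Sum>i<n. v i * x i)\<close>, the Prekopa-Leindler inequality for the tilts of \<open>V\<close> by
  \<open>s * A\<close> and \<open>- s * A\<close> gives \<open>E (exp (s * A)) * E (exp (- s * A)) \<le> exp (s\<^sup>2 * b)\<close> with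
  \<open>b = (\<Sum>i<n. (v i)\<^sup>2) / \<epsilon>\<close>; the bound is its second order term at \<open>s = 0\<close>.\<close>

lemma varm_linear_le:
  assumes pot: "pot n \<epsilon> L V G"
  shows "varm (mu n V) (\<lambda>x. \<Sum>i<n. v i * x i) \<le> (\<Sum>i<n. (v i)\<^sup>2) / \<epsilon>"
proof -
  interpret prob_space "mu n V" by (rule prob_space_mu[OF pot])
  define A where "A x = (\<Sum>i<n. v i * x i)" for x :: "nat \<Rightarrow> real"
  define b where "b = (\<Sum>i<n. (v i)\<^sup>2) / \<epsilon>"
  have \<epsilon>: "0 < \<epsilon>" using pot_pos[OF pot] by simp
  have b0: "0 \<le> b" using \<epsilon> by (simp add: b_def sum_nonneg)
  have linA: "lin_growth n A" unfolding A_def[abs_def]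
    by (intro lin_growth_sum lin_growth_cmult lin_growth_component) auto
  have iA: "integrable (mu n V) A" "integrable (mu n V) (\<lambda>x. (A x)\<^sup>2)"
    by (intro integrable_mu[OF pot] lin_growth_imp_quad lin_growth_power2 linA)+
  note [measurable] = pot_measurable[OF pot] lin_growth_measurable[OF linA]
  define P where "P s = (LINT x|mu n V. exp (s * A x))" for s
  have tilt: "pot n \<epsilon> L (\<lambda>x. V x + - s * A x) (\<lambda>x i. G x i + - s * v i)" for s
    using pot_tilt[OF pot, of "- s" v] unfolding A_def .
  have Pint: "integrable (mu n V) (\<lambda>x. exp (s * A x))" for s
  proof -
    have "integrable (lebesgue_Rn n) (\<lambda>x. (1 / part n V) * exp (- (V x + - s * A x)))"
      by (intro integrable_mult_right integrable_exp_pot[OF tilt])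
    then have "integrable (lebesgue_Rn n) (\<lambda>x. exp (- V x) / part n V * exp (s * A x))"
      by (simp add: exp_add exp_diff exp_minus field_simps)
    then show ?thesis
      unfolding mu_def using part_pos[OF pot] by (subst integrable_density) auto
  qed
  have P: "P s = part n (\<lambda>x. V x + - s * A x) / part n V" for s
    unfolding P_def part_def[of n "\<lambda>x. V x + - s * A x"]
    by (subst integral_mu[OF pot]) (auto simp: exp_add[symmetric])
  have upper: "P s * P (- s) \<le> exp (s\<^sup>2 * b)" for s
  proof -
    have "sqrt (part n (\<lambda>x. V x + - s * A x) * part n (\<lambda>x. V x + - (- s) * A x)) \<le> exp (s\<^sup>2 * b / 2) * part n V"
    proof (rule prekopa_leindler[OF tilt tilt pot])
      fix x y assume xy: "x \<in> Rn n" "y \<in> Rn n"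
      \<comment> \<open>Completing the square in \<open>y i - x i\<close>: the convexity gain at the
        midpoint pays for the difference of the two tilts, up to the error
        \<open>s\<^sup>2 * b / 2\<close>.\<close>
      have "0 \<le> (\<Sum>i<n. (\<epsilon> / 2 * (y i - x i) + s * v i)\<^sup>2 / (2 * \<epsilon>))"
        using \<epsilon> by (intro sum_nonneg) auto
      also have "\<dots> = (\<Sum>i<n. \<epsilon> / 8 * (y i - x i)\<^sup>2 + s / 2 * (v i * y i - v i * x i) + s\<^sup>2 / (2 * \<epsilon>) * (v i)\<^sup>2)"
        using \<epsilon> by (intro sum.cong) (auto simp: field_simps power2_eq_square)
      also have "\<dots> = \<epsilon> / 8 * sqn n (\<lambda>i. y i - x i) + s / 2 * (A y - A x) + s\<^sup>2 * b / 2"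
      proof -
        have "s\<^sup>2 * b / 2 = s\<^sup>2 / (2 * \<epsilon>) * (\<Sum>i<n. (v i)\<^sup>2)" by (simp add: b_def)
        then show ?thesis
          by (simp only: sum.distrib sqn_def A_def sum_distrib_left[symmetric] sum_subtractf)
      qed
      finally show "V (mid n x y) \<le> (V x + - s * A x + (V y + - (- s) * A y)) / 2 + s\<^sup>2 * b / 2"
        using pot_mid(1)[OF pot xy] by (simp add: field_simps)
    qed
    then have "part n (\<lambda>x. V x + - s * A x) * part n (\<lambda>x. V x + - (- s) * A x) \<le> (exp (s\<^sup>2 * b / 2) * part n V)\<^sup>2"
      by (rule sqrt_le_D)
    also have "\<dots> = exp (s\<^sup>2 * b) * (part n V)\<^sup>2"
      by (simp add: power_mult_distrib exp_double[symmetric])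
    finally show ?thesis unfolding P using part_pos[OF pot]
      by (simp add: pos_divide_le_eq power2_eq_square)
  qed
  have lower: "1 + s\<^sup>2 * varm (mu n V) A \<le> P s * P (- s)" for s
  proof -
    define m1 m2 where "m1 = (LINT x|mu n V. A x)" and "m2 = (LINT x|mu n V. (A x)\<^sup>2)"
    \<comment> \<open>Two independent copies: after integration over \<open>x\<close>, the number
      \<open>a\<close> is replaced by \<open>A y\<close> and integrated as well. The square of
      \<open>A x - A y\<close> has mean twice the variance, and the exponentials factor into
      \<open>P s * P (- s)\<close>, twice.\<close>
    have inner: "2 + s\<^sup>2 * (m2 - 2 * a * m1 + a\<^sup>2) \<le> exp (- s * a) * P s + exp (s * a) * P (- s)" for a
    proof -
      have "2 + s\<^sup>2 * (m2 - 2 * a * m1 + a\<^sup>2) = (LINT x|mu n V. 2 + s\<^sup>2 * ((A x)\<^sup>2 - 2 * a * A x + a\<^sup>2))"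
        using iA by (simp add: m1_def m2_def prob_space)
      also have "\<dots> \<le> (LINT x|mu n V. exp (- s * a) * exp (s * A x) + exp (s * a) * exp (- s * A x))"
      proof (rule integral_mono)
        fix x
        have "2 + s\<^sup>2 * ((A x)\<^sup>2 - 2 * a * A x + a\<^sup>2) = 2 + (s * (A x - a))\<^sup>2"
          by (simp add: power2_eq_square algebra_simps)
        also have "\<dots> \<le> exp (s * (A x - a)) + exp (- (s * (A x - a)))" by (rule two_plus_power2_le_cosh)
        also have "\<dots> = exp (- s * a) * exp (s * A x) + exp (s * a) * exp (- s * A x)"
          by (simp add: exp_add[symmetric] algebra_simps)
        finally show "2 + s\<^sup>2 * ((A x)\<^sup>2 - 2 * a * A x + a\<^sup>2) \<le> exp (- s * a) * exp (s * A x) + exp (s * a) * exp (- s * A x)" .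
      qed (use iA Pint[of s] Pint[of "- s"] in auto)
      also have "\<dots> = exp (- s * a) * P s + exp (s * a) * P (- s)"
        using Pint[of s] Pint[of "- s"] by (simp add: P_def)
      finally show ?thesis .
    qed
    have "(LINT y|mu n V. 2 + s\<^sup>2 * (m2 - 2 * A y * m1 + (A y)\<^sup>2)) \<le> (LINT y|mu n V. exp (- s * A y) * P s + exp (s * A y) * P (- s))"
      using inner iA Pint[of s] Pint[of "- s"] by (intro integral_mono) auto
    also have "\<dots> = 2 * (P s * P (- s))"
      using Pint[of s] Pint[of "- s"] by (simp add: P_def)
    also have "(LINT y|mu n V. 2 + s\<^sup>2 * (m2 - 2 * A y * m1 + (A y)\<^sup>2)) = 2 + s\<^sup>2 * (m2 - 2 * m1 * m1 + m2)"
      using iA by (simp add: m1_def m2_def prob_space)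
    finally show ?thesis by (simp add: varm_def m1_def m2_def power2_eq_square algebra_simps)
  qed
  \<comment> \<open>Upper and lower bound at \<open>s = sqrt h\<close>. The second order bound for
    \<open>exp\<close>, divided by \<open>h\<close>, leaves an error that vanishes with
    \<open>h\<close>.\<close>
  have key: "varm (mu n V) A \<le> b + h * b\<^sup>2" if h: "0 < h" "h * b \<le> 1" for h
  proof -
    have "1 + h * varm (mu n V) A \<le> exp (h * b)"
      using order_trans[OF lower[of "sqrt h"] upper[of "sqrt h"]] h by simp
    also have "\<dots> \<le> 1 + h * b + (h * b)\<^sup>2" using h b0 by (intro exp_bound) auto
    also have "\<dots> = 1 + h * (b + h * b\<^sup>2)" by (simp add: power2_eq_square algebra_simps)
    finally show ?thesis using h by simp
  qed
  have "varm (mu n V) A \<le> b"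
  proof (rule field_le_epsilon)
    fix e :: real assume "0 < e"
    define h where "h = min (1 / (b + 1)) (e / (b\<^sup>2 + 1))"
    have h: "0 < h" "h \<le> 1 / (b + 1)" "h \<le> e / (b\<^sup>2 + 1)" using b0 \<open>0 < e\<close> by (auto simp: h_def add_nonneg_pos)
    have "h * b \<le> 1 / (b + 1) * b" using h b0 by (intro mult_right_mono) auto
    also have "\<dots> \<le> 1" using b0 by (simp add: field_simps)
    finally have hb: "h * b \<le> 1" .
    have "h * b\<^sup>2 \<le> e / (b\<^sup>2 + 1) * b\<^sup>2" using h by (intro mult_right_mono) auto
    also have "\<dots> \<le> e" using \<open>0 < e\<close> by (simp add: field_simps add_pos_nonneg)
    finally show "varm (mu n V) A \<le> b + e" using key[OF h(1) hb] by simp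
  qed
  then show ?thesis by (simp add: A_def[abs_def] b_def)
qed

section \<open>Induction for the deficit\<close>

lemma varm_nonneg:
  assumes "prob_space M" "integrable M f" "integrable M (\<lambda>x. (f x)\<^sup>2)"
  shows "0 \<le> varm M f"
proof -
  interpret prob_space M by fact
  show ?thesis
    using variance_positive[of f] variance_eq[OF assms(2,3)] by (simp add: varm_def)
qed

lemma varm_cmult_add:
  assumes [simp]: "integrable M f" "integrable M g" "integrable M (\<lambda>x. (f x)\<^sup>2)" "integrable M (\<lambda>x. (g x)\<^sup>2)"
    "integrable M (\<lambda>x. f x * g x)"
  shows "varm M (\<lambda>x. a * f x + g x) =
    a\<^sup>2 * varm M f + 2 * a * ((LINT x|M. f x * g x) - (LINT x|M. f x) * (LINT x|M. g x)) + varm M g"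
proof -
  have "(a * f x + g x)\<^sup>2 = a\<^sup>2 * (f x)\<^sup>2 + 2 * a * (f x * g x) + (g x)\<^sup>2" for x
    by (simp add: power2_eq_square algebra_simps)
  then show ?thesis
    by (simp add: varm_def) (simp add: power2_eq_square algebra_simps)
qed

lemma varm_add_const:
  assumes "prob_space M" and [simp]: "integrable M f" "integrable M (\<lambda>x. (f x)\<^sup>2)"
  shows "varm M (\<lambda>x. f x + c) = varm M f"
proof -
  interpret prob_space M by fact
  have "(f x + c)\<^sup>2 = (f x)\<^sup>2 + 2 * c * f x + c\<^sup>2" for x
    by (simp add: power2_eq_square algebra_simps)
  then show ?thesis
    by (simp add: varm_def prob_space) (simp add: power2_eq_square algebra_simps)
qed

lemma lin_growth_integrable:
  assumes pot: "pot n \<epsilon> L V G" and f: "lin_growth n f"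
  shows "integrable (mu n V) f" "integrable (mu n V) (\<lambda>x. (f x)\<^sup>2)"
  by (intro integrable_mu[OF pot] lin_growth_imp_quad lin_growth_power2 f)+

lemma lin_growth_slice_gradient:
  assumes "pot (Suc n) \<epsilon> L V G"
  shows "lin_growth n (\<lambda>x. G (x(n := t)) n)"
  by (rule lin_growth_slice[where f = "\<lambda>x. G x n", OF pot_lin_growth[OF assms]]) simp

section \<open>Conditional means of the coordinates\<close>

lemma DERIV_mean:
  assumes pot: "pot (Suc n) \<epsilon> L V G" and i: "i < n"
  shows "((\<lambda>t. LINT x|mu n (sl n V t). x i) has_real_derivative
     - ((LINT x|mu n (sl n V t). x i * G (x(n := t)) n) - (LINT x|mu n (sl n V t). x i) * marg' n V G t)) (at t)"
proof -
  note slice = pot_slice[OF pot]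
  let ?w = "\<lambda>t. part n (sl n V t)"
  let ?N = "\<lambda>t. LINT x|lebesgue_Rn n. x i * exp (- V (x(n := t)))"
  define N' where "N' = - (LINT x|lebesgue_Rn n. x i * G (x(n := t)) n * exp (- V (x(n := t))))"
  define w' where "w' = - (LINT x|lebesgue_Rn n. G (x(n := t)) n * exp (- V (x(n := t))))"
  note [measurable] = measurable_Rn_component[OF i] measurable_slice_gradient[OF pot, of n t]
  have w: "?w t \<noteq> 0" using part_pos[OF slice, of t] by simp
  have m: "(\<lambda>t. LINT x|mu n (sl n V t). x i) = (\<lambda>t. ?N t / ?w t)"
    by (rule ext, subst integral_mu[OF slice]) auto
  have "((\<lambda>t. ?N t / ?w t) has_real_derivative (N' * ?w t - ?N t * w') / (?w t * ?w t)) (at t)"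
    unfolding N'_def w'_def
    by (intro DERIV_divide DERIV_integral_slice[OF pot lin_growth_component[OF i]] DERIV_part_slice[OF pot] w)
  moreover have "(N' * ?w t - ?N t * w') / (?w t * ?w t) =
      - ((LINT x|mu n (sl n V t). x i * G (x(n := t)) n) - (LINT x|mu n (sl n V t). x i) * marg' n V G t)"
    unfolding marg'_def using w
    by (simp add: integral_mu[OF slice] N'_def w'_def field_simps)
  ultimately show ?thesis unfolding m by simp
qed

text \<open>Duality: the derivatives themselves serve as coefficients \<open>v\<close> of a linear
  form \<open>A\<close>, whose covariance with \<open>g\<close> is then \<open>- S\<close>.
  Nonnegativity of the variance of \<open>\<epsilon> * A + g\<close>, with at most
  \<open>S / \<epsilon>\<close> for the variance of \<open>A\<close>, gives
  \<open>\<epsilon> * S \<le> varm M g\<close>. Bounding the form as a whole, not its coordinates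
  one by one, is what avoids a factor \<open>n\<close>.\<close>

lemma sum_mean_deriv_le:
  assumes pot: "pot (Suc n) \<epsilon> L V G"
  shows "(\<Sum>i<n. (- ((LINT x|mu n (sl n V t). x i * G (x(n := t)) n) - (LINT x|mu n (sl n V t). x i) * marg' n V G t))\<^sup>2)
     \<le> varm (mu n (sl n V t)) (\<lambda>x. G (x(n := t)) n) / \<epsilon>"
proof -
  note slice = pot_slice[OF pot, of t]
  define M where "M = mu n (sl n V t)"
  define g where "g x = G (x(n := t)) n" for x
  have lin_g: "lin_growth n g"
    unfolding g_def[abs_def] by (rule lin_growth_slice_gradient[OF pot])
  define v where "v i = - ((LINT x|M. x i * g x) - (LINT x|M. x i) * (LINT x|M. g x))" for i
  define A where "A x = (\<Sum>i<n. v i * x i)" for x :: "nat \<Rightarrow> real"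
  define S where "S = (\<Sum>i<n. (v i)\<^sup>2)"
  have lin_A: "lin_growth n A"
    unfolding A_def[abs_def] by (intro lin_growth_sum lin_growth_cmult lin_growth_component) auto
  note iA = lin_growth_integrable[OF slice lin_A, folded M_def]
  note ig = lin_growth_integrable[OF slice lin_g, folded M_def]
  have iAg: "integrable M (\<lambda>x. A x * g x)"
    unfolding M_def by (intro integrable_mu[OF slice] lin_growth_mult lin_A lin_g)
  have ii: "integrable M (\<lambda>x. x i)" "integrable M (\<lambda>x. x i * g x)" if "i < n" for i
    unfolding M_def using that
    by (intro integrable_mu[OF slice] lin_growth_imp_quad lin_growth_mult lin_growth_component lin_g; simp)+
  have \<epsilon>: "0 < \<epsilon>" using pot_pos[OF pot] by simp
  have e1: "(LINT x|M. A x * g x) = (\<Sum>i<n. v i * (LINT x|M. x i * g x))"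
    unfolding A_def sum_distrib_right mult.assoc using ii by (subst Bochner_Integration.integral_sum) auto
  have e2: "(LINT x|M. A x) = (\<Sum>i<n. v i * (LINT x|M. x i))"
    unfolding A_def using ii by (subst Bochner_Integration.integral_sum) auto
  have "(LINT x|M. A x * g x) - (LINT x|M. A x) * (LINT x|M. g x)
      = (\<Sum>i<n. v i * ((LINT x|M. x i * g x) - (LINT x|M. x i) * (LINT x|M. g x)))"
    unfolding e1 e2 by (simp add: sum_distrib_right sum_subtractf right_diff_distrib mult.assoc)
  also have "\<dots> = - S"
    unfolding S_def sum_negf[symmetric] by (intro sum.cong) (auto simp: v_def power2_eq_square algebra_simps)
  finally have cov: "(LINT x|M. A x * g x) - (LINT x|M. A x) * (LINT x|M. g x) = - S" .
  have "lin_growth n (\<lambda>x. \<epsilon> * A x + g x)" by (intro lin_growth_add lin_growth_cmult lin_A lin_g)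
  note iag = lin_growth_integrable[OF slice this, folded M_def]
  have "0 \<le> varm M (\<lambda>x. \<epsilon> * A x + g x)"
    using iag prob_space_mu[OF slice] by (intro varm_nonneg) (auto simp: M_def)
  also have "\<dots> = \<epsilon>\<^sup>2 * varm M A - 2 * \<epsilon> * S + varm M g"
    using varm_cmult_add[OF iA(1) ig(1) iA(2) ig(2) iAg, of \<epsilon>] unfolding cov by simp
  also have "varm M A \<le> S / \<epsilon>"
    using varm_linear_le[OF slice, of v] by (simp add: A_def[abs_def] S_def M_def)
  finally have "0 \<le> \<epsilon>\<^sup>2 * (S / \<epsilon>) - 2 * \<epsilon> * S + varm M g"
    using \<epsilon> by (simp add: mult_left_mono)
  moreover have "\<epsilon>\<^sup>2 * (S / \<epsilon>) = \<epsilon> * S" using \<epsilon> by (simp add: power2_eq_square)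
  ultimately have "\<epsilon> * S \<le> varm M g" by linarith
  then have "S \<le> varm M g / \<epsilon>" using \<epsilon> by (simp add: field_simps)
  then show ?thesis by (simp add: S_def v_def M_def g_def[abs_def] marg'_def)
qed

text \<open>Law of total variance for the disintegration along the last coordinate. Square
  integrability of the conditional means follows from nonnegativity of the fibre variances.\<close>

lemma varm_mu_Suc:
  assumes pot: "pot (Suc n) \<epsilon> L V G" and f: "lin_growth (Suc n) f"
  shows "integrable (nu (marg n V)) (\<lambda>t. varm (mu n (sl n V t)) (sl n f t))"
    and "integrable (nu (marg n V)) (\<lambda>t. (LINT x|mu n (sl n V t). f (x(n := t)))\<^sup>2)"
    and "varm (mu (Suc n) V) f = (LINT t|nu (marg n V). varm (mu n (sl n V t)) (sl n f t))
       + varm (nu (marg n V)) (\<lambda>t. LINT x|mu n (sl n V t). f (x(n := t)))"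
proof -
  note slice = pot_slice[OF pot] and pot1 = pot1_marg[OF pot]
  define N where "N = nu (marg n V)"
  define e1 where "e1 t = (LINT x|mu n (sl n V t). f (x(n := t)))" for t
  define e2 where "e2 t = (LINT x|mu n (sl n V t). (f (x(n := t)))\<^sup>2)" for t
  note F1 = integral_mu_Suc[OF pot lin_growth_imp_quad[OF f], folded e1_def N_def]
  note F2 = integral_mu_Suc[OF pot lin_growth_power2[OF f], folded e2_def N_def]
  have v: "varm (mu n (sl n V t)) (sl n f t) = e2 t - (e1 t)\<^sup>2" for t
    by (simp add: varm_def e1_def e2_def)
  have v0: "0 \<le> e2 t - (e1 t)\<^sup>2" for t
    unfolding v[symmetric]
    by (intro varm_nonneg prob_space_mu[OF slice] lin_growth_integrable[OF slice] lin_growth_slice f)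
  have i1: "integrable N (\<lambda>t. (e1 t)\<^sup>2)"
  proof (rule Bochner_Integration.integrable_bound[OF F2(1)])
    show "(\<lambda>t. (e1 t)\<^sup>2) \<in> borel_measurable N"
      using borel_measurable_integrable[OF F1(1)] by measurable
    show "AE t in N. norm ((e1 t)\<^sup>2) \<le> norm (e2 t)"
    proof (rule AE_I2)
      fix t
      show "norm ((e1 t)\<^sup>2) \<le> norm (e2 t)" using v0[of t] zero_le_power2[of "e1 t"] by simp
    qed
  qed
  show "integrable (nu (marg n V)) (\<lambda>t. varm (mu n (sl n V t)) (sl n f t))"
    using i1 F2(1) unfolding v N_def[symmetric] by simp
  show "integrable (nu (marg n V)) (\<lambda>t. (LINT x|mu n (sl n V t). f (x(n := t)))\<^sup>2)"
    using i1 unfolding e1_def N_def .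
  show "varm (mu (Suc n) V) f = (LINT t|nu (marg n V). varm (mu n (sl n V t)) (sl n f t))
       + varm (nu (marg n V)) (\<lambda>t. LINT x|mu n (sl n V t). f (x(n := t)))"
    unfolding v N_def[symmetric] e1_def[symmetric]
    using i1 F1 F2 by (simp add: varm_def)
qed

text \<open>One factor \<open>1 / \<epsilon>\<close> comes from the Poincare inequality for the
  marginal, the other from \<open>sum_mean_deriv_le\<close>. The latter is applied to the sum over
  all coordinates at once, under the integral, so the dimension does not appear.\<close>

lemma sum_varm_mean_le:
  assumes pot: "pot (Suc n) \<epsilon> L V G"
  shows "(\<Sum>i<n. varm (nu (marg n V)) (\<lambda>t. LINT x|mu n (sl n V t). x i))
    \<le> (LINT t|nu (marg n V). varm (mu n (sl n V t)) (\<lambda>x. G (x(n := t)) n)) / \<epsilon>\<^sup>2"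
proof -
  note slice = pot_slice[OF pot] and pot1 = pot1_marg[OF pot]
  have \<epsilon>: "0 < \<epsilon>" using pot_pos[OF pot] by simp
  define N where "N = nu (marg n V)"
  define m where "m i t = (LINT x|mu n (sl n V t). x i)" for i t
  define m' where "m' i t = - ((LINT x|mu n (sl n V t). x i * G (x(n := t)) n) - m i t * marg' n V G t)" for i t
  define vg where "vg t = varm (mu n (sl n V t)) (\<lambda>x. G (x(n := t)) n)" for t
  have linG: "lin_growth (Suc n) (\<lambda>x. G x n)" by (rule pot_lin_growth[OF pot]) simp
  have ivg: "integrable N vg" unfolding vg_def N_def by (rule varm_mu_Suc(1)[OF pot linG])
  have le: "(\<Sum>i<n. (m' i t)\<^sup>2) \<le> vg t / \<epsilon>" for t
    using sum_mean_deriv_le[OF pot, of t] by (simp only: m'_def m_def vg_def)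
  have im': "integrable N (\<lambda>t. (m' i t)\<^sup>2)" if i: "i < n" for i
  proof (rule Bochner_Integration.integrable_bound)
    show "integrable N (\<lambda>t. vg t / \<epsilon>)" using ivg by simp
    have li: "lin_growth (Suc n) (\<lambda>x. x i)" using i by (intro lin_growth_component) simp
    have "integrable N (\<lambda>t. LINT x|mu n (sl n V t). (x(n := t)) i * G (x(n := t)) n)"
      unfolding N_def by (rule integral_mu_Suc(1)[OF pot lin_growth_mult[OF li linG]])
    then have [measurable]: "(\<lambda>t. LINT x|mu n (sl n V t). x i * G (x(n := t)) n) \<in> borel_measurable N"
      using i by simp
    have "integrable N (\<lambda>t. LINT x|mu n (sl n V t). (x(n := t)) i)"
      unfolding N_def by (rule integral_mu_Suc(1)[OF pot lin_growth_imp_quad[OF li]])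
    then have [measurable]: "m i \<in> borel_measurable N"
      unfolding m_def[abs_def] using i by simp
    have [measurable]: "marg' n V G \<in> borel_measurable N"
      unfolding N_def using pot1_measurable(2)[OF pot1] measurable_cong_sets[OF sets_nu[OF pot1] refl] by blast
    show "(\<lambda>t. (m' i t)\<^sup>2) \<in> borel_measurable N" unfolding m'_def by measurable
    show "AE t in N. norm ((m' i t)\<^sup>2) \<le> norm (vg t / \<epsilon>)"
    proof (rule AE_I2)
      fix t
      have "(m' i t)\<^sup>2 \<le> (\<Sum>i<n. (m' i t)\<^sup>2)" using i by (intro member_le_sum) auto
      then have "(m' i t)\<^sup>2 \<le> vg t / \<epsilon>" using le[of t] by (rule order_trans)
      from order_trans[OF this abs_ge_self]
      show "norm ((m' i t)\<^sup>2) \<le> norm (vg t / \<epsilon>)" unfolding real_norm_def by simp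
    qed
  qed
  have "varm N (m i) \<le> (LINT t|N. (m' i t)\<^sup>2) / \<epsilon>" if i: "i < n" for i
  proof -
    have li: "lin_growth (Suc n) (\<lambda>x. x i)" using i by (intro lin_growth_component) simp
    have "integrable N (\<lambda>t. (m i t)\<^sup>2)"
      using varm_mu_Suc(2)[OF pot li] i by (simp add: m_def N_def)
    then show ?thesis
      unfolding varm_def N_def
      using DERIV_mean[OF pot i, folded m_def, folded m'_def] im'[OF i]
      by (intro poincare_1d[OF pot1]) (auto simp: N_def)
  qed
  then have "(\<Sum>i<n. varm N (m i)) \<le> (\<Sum>i<n. (LINT t|N. (m' i t)\<^sup>2) / \<epsilon>)"
    by (intro sum_mono) auto
  also have "\<dots> = (LINT t|N. (\<Sum>i<n. (m' i t)\<^sup>2)) / \<epsilon>"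
    using im' by (subst Bochner_Integration.integral_sum) (auto simp: sum_divide_distrib)
  also have "\<dots> \<le> (LINT t|N. vg t / \<epsilon>) / \<epsilon>"
    using \<epsilon> le im' ivg by (intro divide_right_mono integral_mono) auto
  also have "\<dots> = (LINT t|N. vg t) / \<epsilon>\<^sup>2" by (simp add: power2_eq_square)
  finally show ?thesis by (simp add: m_def[abs_def] vg_def N_def)
qed

section \<open>Fisher information and entropy along the disintegration\<close>

definition fish :: "nat \<Rightarrow> ((nat \<Rightarrow> real) \<Rightarrow> real) \<Rightarrow> ((nat \<Rightarrow> real) \<Rightarrow> nat \<Rightarrow> real) \<Rightarrow> real"
  where "fish n V G = (LINT x|mu n V. (\<Sum>i<n. (G x i - x i)\<^sup>2))"

text \<open>Relative entropy of \<open>mu n V\<close> with respect to the Gaussian, as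
  \<open>fish\<close> is the relative Fisher information. The partition function is part of the
  formula, so it applies to slices as they stand, whatever their mass.\<close>

definition ent :: "nat \<Rightarrow> ((nat \<Rightarrow> real) \<Rightarrow> real) \<Rightarrow> real"
  where "ent n V = (LINT x|mu n V. - V x - ln (part n V) + sqn n x / 2 + real n / 2 * ln (2 * pi))"

lemma quad_growth_ent:
  assumes pot: "pot n \<epsilon> L V G"
  shows "quad_growth n (\<lambda>x. - V x - c + sqn n x / 2 + d)"
  using quad_growth_add[OF quad_growth_add[OF quad_growth_diff[OF quad_growth_uminus[OF pot_quad_growth[OF pot]] quad_growth_const]
      quad_growth_cmult[OF quad_growth_sqn, of n "1/2"]] quad_growth_const] by simp

text \<open>Chain rule for relative entropy: the logarithm of the density splits into the one of the
  fibre and the one of the marginal, here \<open>e1 t\<close>.\<close>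

lemma ent_Suc:
  assumes pot: "pot (Suc n) \<epsilon> L V G"
  shows "integrable (nu (marg n V)) (\<lambda>t. ent n (sl n V t))"
    and "ent (Suc n) V = (LINT t|nu (marg n V). ent n (sl n V t)) + entropy1 (marg n V)"
proof -
  note slice = pot_slice[OF pot] and pot1 = pot1_marg[OF pot]
  define e where "e x = - V x - ln (part (Suc n) V) + sqn (Suc n) x / 2 + real (Suc n) / 2 * ln (2 * pi)" for x
  define e1 where "e1 t = - marg n V t - ln (part1 (marg n V)) + t\<^sup>2 / 2 + ln (2 * pi) / 2" for t
  have qe: "quad_growth (Suc n) e" unfolding e_def[abs_def] by (rule quad_growth_ent[OF pot])
  note I = integral_mu_Suc[OF pot qe]
  have eq: "(LINT x|mu n (sl n V t). e (x(n := t))) = ent n (sl n V t) + e1 t" for t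
  proof -
    interpret prob_space "mu n (sl n V t)" by (rule prob_space_mu[OF slice])
    define k where "k x = - V (x(n := t)) - ln (part n (sl n V t)) + sqn n x / 2 + real n / 2 * ln (2 * pi)" for x
    have ik: "integrable (mu n (sl n V t)) k"
      unfolding k_def[abs_def] by (rule integrable_mu[OF slice quad_growth_ent[OF slice]])
    have "e (x(n := t)) = k x + e1 t" for x
      by (simp add: e_def k_def e1_def marg_def part1_marg[OF pot] sqn_update field_simps)
    then have "(LINT x|mu n (sl n V t). e (x(n := t))) = (LINT x|mu n (sl n V t). k x + e1 t)" by simp
    also have "\<dots> = (LINT x|mu n (sl n V t). k x) + e1 t" using ik by (simp add: prob_space)
    finally show ?thesis by (simp add: ent_def k_def)
  qed
  have "quad_growth1 e1" unfolding e1_def[abs_def]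
    using quad_growth1_add[OF quad_growth1_add[OF quad_growth1_diff[OF quad_growth1_cmult[OF quad_growth1_pot1[OF pot1], of "-1"] quad_growth1_const]
      quad_growth1_cmult[OF lin_growth1_power2[OF lin_growth1_id], of "1/2"]] quad_growth1_const] by simp
  then have ie1: "integrable (nu (marg n V)) e1" by (rule integrable_nu_quad_growth1[OF pot1])
  show i: "integrable (nu (marg n V)) (\<lambda>t. ent n (sl n V t))"
    using Bochner_Integration.integrable_diff[OF I(1) ie1] unfolding eq by simp
  have "ent (Suc n) V = (LINT x|mu (Suc n) V. e x)" by (simp add: ent_def e_def)
  also have "\<dots> = (LINT t|nu (marg n V). ent n (sl n V t)) + (LINT t|nu (marg n V). e1 t)"
    unfolding I(2) eq using i ie1 by simp
  finally show "ent (Suc n) V = (LINT t|nu (marg n V). ent n (sl n V t)) + entropy1 (marg n V)"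
    by (simp add: entropy1_def e1_def)
qed

lemma lin_growth_score:
  "pot n \<epsilon> L V G \<Longrightarrow> i < n \<Longrightarrow> lin_growth n (\<lambda>x. G x i - x i)"
  by (intro lin_growth_diff pot_lin_growth lin_growth_component)

text \<open>The last summand is kept whole. Split on each fibre into squared mean and variance, it
  is the Fisher information of the marginal plus a mean fibre variance, and this surplus is what the
  induction spends.\<close>

lemma fish_Suc:
  assumes pot: "pot (Suc n) \<epsilon> L V G"
  shows "integrable (nu (marg n V)) (\<lambda>t. fish n (sl n V t) (sl n G t))"
    and "integrable (nu (marg n V)) (\<lambda>t. LINT x|mu n (sl n V t). (G (x(n := t)) n - t)\<^sup>2)"
    and "fish (Suc n) V G = (LINT t|nu (marg n V). fish n (sl n V t) (sl n G t))
      + (LINT t|nu (marg n V). LINT x|mu n (sl n V t). (G (x(n := t)) n - t)\<^sup>2)"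
proof -
  have q1: "quad_growth (Suc n) (\<lambda>x. \<Sum>i<n. (G x i - x i)\<^sup>2)"
    using lin_growth_score[OF pot] by (intro quad_growth_sum lin_growth_power2) auto
  have q2: "quad_growth (Suc n) (\<lambda>x. (G x n - x n)\<^sup>2)"
    using lin_growth_score[OF pot, of n] by (intro lin_growth_power2) auto
  note I1 = integral_mu_Suc[OF pot q1] and I2 = integral_mu_Suc[OF pot q2]
  have eq: "(LINT x|mu n (sl n V t). (\<Sum>i<n. (G (x(n := t)) i - (x(n := t)) i)\<^sup>2)) = fish n (sl n V t) (sl n G t)" for t
    unfolding fish_def by (intro Bochner_Integration.integral_cong refl sum.cong) auto
  show "integrable (nu (marg n V)) (\<lambda>t. fish n (sl n V t) (sl n G t))"
    using I1(1) unfolding eq .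
  show "integrable (nu (marg n V)) (\<lambda>t. LINT x|mu n (sl n V t). (G (x(n := t)) n - t)\<^sup>2)"
    using I2(1) by simp
  have "fish (Suc n) V G = (LINT x|mu (Suc n) V. (\<Sum>i<n. (G x i - x i)\<^sup>2)) + (LINT x|mu (Suc n) V. (G x n - x n)\<^sup>2)"
    unfolding fish_def sum.lessThan_Suc
    by (intro Bochner_Integration.integral_add integrable_mu[OF pot] q1 q2)
  then show "fish (Suc n) V G = (LINT t|nu (marg n V). fish n (sl n V t) (sl n G t))
      + (LINT t|nu (marg n V). LINT x|mu n (sl n V t). (G (x(n := t)) n - t)\<^sup>2)"
    unfolding I1(2) I2(2) eq by simp
qed

text \<open>The inner minimum is the constant of \<open>deficit_1d\<close>. The last entry ensures
  \<open>c * (1 + 1 / \<epsilon>\<^sup>2) \<le> 1 / 2\<close>, so that the variance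
  \<open>Wg\<close> of the last score and the terms it dominates cost at most
  \<open>Wg / 2\<close>.\<close>

definition deficit_const :: "real \<Rightarrow> real \<Rightarrow> real"
  where "deficit_const \<epsilon> L = min (min (1 / 4) (\<epsilon> / (4 * sqrt L))) (1 / (2 * (1 + 1 / \<epsilon>\<^sup>2)))"

text \<open>Total variance splits the left side into mean fibre variances and variances of
  conditional means; the chain rules split the right side into fibre deficits, the deficit of the
  marginal and \<open>Wg / 2\<close>. The induction hypothesis pays for the fibre variances of the
  first \<open>n\<close> scores, \<open>deficit_1d\<close> for the conditional mean of the last one,
  and \<open>Wg / 2\<close> for all the rest.\<close>

theorem deficit_ge_variance:
  assumes "pot n \<epsilon> L V G" and L: "1 \<le> L"
  shows "deficit_const \<epsilon> L * (\<Sum>i<n. varm (mu n V) (\<lambda>x. G x i - x i)) \<le> 1 / 2 * fish n V G - ent n V"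
  using assms(1)
proof (induction n arbitrary: V G)
  case 0
  have "part 0 V = exp (- V (\<lambda>_. undefined))" by (simp add: part_def integral_lebesgue_Rn_0)
  moreover have "(\<lambda>x. - V x - ln (part 0 V) + sqn 0 x / 2 + real 0 / 2 * ln (2 * pi)) \<in> borel_measurable (lebesgue_Rn 0)"
    by (rule quad_growth_measurable[OF quad_growth_ent[OF 0]])
  ultimately have "ent 0 V = 0"
    unfolding ent_def by (subst integral_mu[OF 0]) (auto simp: integral_lebesgue_Rn_0 sqn_def)
  then show ?case by (simp add: fish_def)
next
  case (Suc n)
  note pot = Suc.prems
  note slice = pot_slice[OF pot] and pot1 = pot1_marg[OF pot]
  interpret N: prob_space "nu (marg n V)" by (rule prob_space_nu[OF pot1])
  define N where "N = nu (marg n V)"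
  define M where "M t = mu n (sl n V t)" for t
  define c where "c = deficit_const \<epsilon> L"
  have \<epsilon>: "0 < \<epsilon>" using pot_pos[OF pot] by simp
  have c: "0 \<le> c" "c \<le> min (1 / 4) (\<epsilon> / (4 * sqrt L))" "c * (1 + 1 / \<epsilon>\<^sup>2) \<le> 1 / 2"
  proof -
    show "0 \<le> c" "c \<le> min (1 / 4) (\<epsilon> / (4 * sqrt L))"
      using \<epsilon> L by (auto simp: c_def deficit_const_def intro!: add_nonneg_nonneg)
    have p: "0 < 1 + 1 / \<epsilon>\<^sup>2" using \<epsilon> by (intro add_pos_pos) auto
    have "c * (1 + 1 / \<epsilon>\<^sup>2) \<le> (1 / (2 * (1 + 1 / \<epsilon>\<^sup>2))) * (1 + 1 / \<epsilon>\<^sup>2)"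
      using p by (intro mult_right_mono) (auto simp: c_def deficit_const_def)
    also have "\<dots> = 1 / 2" using p by simp
    finally show "c * (1 + 1 / \<epsilon>\<^sup>2) \<le> 1 / 2" .
  qed
  define g where "g i x = G x i - x i" for i and x :: "nat \<Rightarrow> real"
  have lin: "lin_growth (Suc n) (g i)" if "i < Suc n" for i
    unfolding g_def[abs_def] by (rule lin_growth_score[OF pot that])
  define vt where "vt i t = varm (M t) (sl n (g i) t)" for i t
  define et where "et i t = (LINT x|M t. g i (x(n := t)))" for i t
  have ivt: "integrable N (vt i)" if "i < Suc n" for i
    using varm_mu_Suc(1)[OF pot lin[OF that]] by (simp add: N_def vt_def[abs_def] M_def del: fun_upd_apply)
  have var: "varm (mu (Suc n) V) (g i) = (LINT t|N. vt i t) + varm N (et i)" if "i < Suc n" for i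
    using varm_mu_Suc(3)[OF pot lin[OF that]] by (simp add: N_def vt_def[abs_def] et_def[abs_def] M_def del: fun_upd_apply)
  define Wg where "Wg = (LINT t|N. vt n t)"
  have Wg0: "0 \<le> Wg"
    unfolding Wg_def vt_def M_def
    by (intro Bochner_Integration.integral_nonneg varm_nonneg prob_space_mu[OF slice] lin_growth_integrable[OF slice]
        lin_growth_slice lin) simp_all
  have et_n: "et n t = marg' n V G t - t" for t
  proof -
    interpret prob_space "mu n (sl n V t)" by (rule prob_space_mu[OF slice])
    have "integrable (mu n (sl n V t)) (\<lambda>x. G (x(n := t)) n)"
      by (rule lin_growth_integrable(1)[OF slice lin_growth_slice_gradient[OF pot]])
    then show ?thesis
      by (simp add: et_def g_def M_def marg'_def prob_space)
  qed
  \<comment> \<open>The first \<open>n\<close> partial derivatives form the gradient of the slice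
    potential and have mean zero on the fibre; of the score only \<open>- x i\<close>
    remains.\<close>
  have et_i: "et i t = - (LINT x|M t. x i)" if i: "i < n" for i t
  proof -
    have "integrable (M t) (\<lambda>x. G (x(n := t)) i)" "integrable (M t) (\<lambda>x. x i)"
      unfolding M_def
      by (rule lin_growth_integrable(1)[OF slice pot_lin_growth[OF slice i]],
          rule lin_growth_integrable(1)[OF slice lin_growth_component[OF i]])
    moreover have "(LINT x|M t. G (x(n := t)) i) = 0"
      unfolding M_def by (rule integral_gradient_eq_0[OF slice i])
    ultimately show ?thesis
      using i by (simp add: et_def g_def)
  qed
  have vt_n: "vt n t = varm (M t) (\<lambda>x. G (x(n := t)) n)" for t
  proof -
    have "varm (M t) (\<lambda>x. G (x(n := t)) n + - t) = varm (M t) (\<lambda>x. G (x(n := t)) n)"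
      unfolding M_def
      by (intro varm_add_const prob_space_mu[OF slice] lin_growth_integrable[OF slice] lin_growth_slice_gradient[OF pot])
    then show ?thesis by (simp add: vt_def g_def)
  qed
  have "(\<Sum>i<n. varm N (et i)) = (\<Sum>i<n. varm N (\<lambda>t. LINT x|M t. x i))"
    using et_i by (intro sum.cong refl) (simp add: varm_def)
  also have "\<dots> \<le> Wg / \<epsilon>\<^sup>2"
    using sum_varm_mean_le[OF pot] unfolding Wg_def vt_n by (simp add: N_def M_def del: fun_upd_apply)
  finally have means: "(\<Sum>i<n. varm N (et i)) \<le> Wg / \<epsilon>\<^sup>2" .
  have fibre: "c * (\<Sum>i<n. vt i t) \<le> 1 / 2 * fish n (sl n V t) (sl n G t) - ent n (sl n V t)" for t
  proof -
    have "vt i t = varm (M t) (\<lambda>x. G (x(n := t)) i - x i)" if "i < n" for i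
      using that by (simp add: vt_def g_def)
    then show ?thesis using Suc.IH[OF slice[of t]] by (simp add: c_def M_def del: fun_upd_apply)
  qed
  have "c * (\<Sum>i<n. (LINT t|N. vt i t)) = (LINT t|N. c * (\<Sum>i<n. vt i t))"
    using ivt by (subst integral_mult_right_zero, subst Bochner_Integration.integral_sum) auto
  also have "\<dots> \<le> (LINT t|N. 1 / 2 * fish n (sl n V t) (sl n G t) - ent n (sl n V t))"
    using fibre ivt fish_Suc(1)[OF pot] ent_Suc(1)[OF pot]
    by (intro integral_mono) (auto simp: N_def simp del: fun_upd_apply)
  also have "\<dots> = 1 / 2 * (LINT t|N. fish n (sl n V t) (sl n G t)) - (LINT t|N. ent n (sl n V t))"
    using fish_Suc(1)[OF pot] ent_Suc(1)[OF pot] by (simp add: N_def del: fun_upd_apply)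
  finally have fibres: "c * (\<Sum>i<n. (LINT t|N. vt i t))
      \<le> 1 / 2 * (LINT t|N. fish n (sl n V t) (sl n G t)) - (LINT t|N. ent n (sl n V t))" .
  have q1: "lin_growth1 (\<lambda>t. marg' n V G t - t)"
    by (intro lin_growth1_diff lin_growth1_pot1_slope[OF pot1] lin_growth1_id)
  have "0 \<le> varm N (et n)"
    unfolding et_n N_def
    by (intro varm_nonneg N.prob_space_axioms integrable_nu_quad_growth1[OF pot1] lin_growth1_imp_quad lin_growth1_power2 q1)
  then have "c * varm N (et n) \<le> min (1 / 4) (\<epsilon> / (4 * sqrt L)) * varm N (et n)"
    using c by (intro mult_right_mono) auto
  also have "\<dots> \<le> 1 / 2 * (LINT t|N. (et n t)\<^sup>2) - entropy1 (marg n V)"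
    using deficit_1d(1)[OF pot1 L] by (simp add: varm_def et_n N_def)
  finally have one: "c * varm N (et n) \<le> 1 / 2 * (LINT t|N. (et n t)\<^sup>2) - entropy1 (marg n V)" .
  have "c * (1 + 1 / \<epsilon>\<^sup>2) * Wg \<le> 1 / 2 * Wg" using c Wg0 by (intro mult_right_mono)
  moreover have "c * (Wg / \<epsilon>\<^sup>2 + Wg) = c * (1 + 1 / \<epsilon>\<^sup>2) * Wg" by (simp add: algebra_simps)
  ultimately have two: "c * (Wg / \<epsilon>\<^sup>2 + Wg) \<le> 1 / 2 * Wg" by linarith
  have three: "c * (\<Sum>i<n. varm N (et i)) \<le> c * (Wg / \<epsilon>\<^sup>2)"
    using means c by (intro mult_left_mono)
  \<comment> \<open>The surplus of the Fisher information over its fibre and marginal parts; it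
    enters the deficit with the factor 1/2.\<close>
  have Wg: "Wg = (LINT t|N. LINT x|M t. (G (x(n := t)) n - t)\<^sup>2) - (LINT t|N. (et n t)\<^sup>2)"
  proof -
    have "vt n = (\<lambda>t. (LINT x|M t. (G (x(n := t)) n - t)\<^sup>2) - (et n t)\<^sup>2)"
      by (simp add: fun_eq_iff vt_def varm_def et_def g_def)
    moreover have "integrable N (\<lambda>t. (et n t)\<^sup>2)"
      using varm_mu_Suc(2)[OF pot lin[of n]] by (simp add: N_def et_def M_def del: fun_upd_apply)
    ultimately show ?thesis
      unfolding Wg_def using fish_Suc(2)[OF pot] by (simp add: N_def M_def del: fun_upd_apply)
  qed
  have "c * (\<Sum>i<Suc n. varm (mu (Suc n) V) (g i))
     = c * (\<Sum>i<n. (LINT t|N. vt i t)) + c * (\<Sum>i<n. varm N (et i)) + c * Wg + c * varm N (et n)"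
    using var by (simp add: sum.distrib Wg_def algebra_simps)
  also have "\<dots> \<le> 1 / 2 * fish (Suc n) V G - ent (Suc n) V"
  proof -
    have "fish (Suc n) V G = (LINT t|N. fish n (sl n V t) (sl n G t)) + (LINT t|N. LINT x|M t. (G (x(n := t)) n - t)\<^sup>2)"
      "ent (Suc n) V = (LINT t|N. ent n (sl n V t)) + entropy1 (marg n V)"
      unfolding N_def M_def by (rule fish_Suc(3)[OF pot], rule ent_Suc(2)[OF pot])
    then show ?thesis
      using fibres one two[unfolded distrib_left] three Wg by linarith
  qed
  finally show ?case by (simp add: c_def g_def[abs_def])
qed

section \<open>The Knothe map\<close>

lemma density_quantile_measurable:
  assumes g: "pos_density g"
  shows "density_quantile g \<in> borel_measurable borel"
proof -
  \<comment> \<open>Off the open interval the quantile is one constant, so it is a continuous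
    function extended by a constant.\<close>
  have out: "density_quantile g p = (THE y. False)" if "p \<notin> {0<..<1}" for p
  proof -
    have "density_cdf g y \<noteq> p" for y
      using density_cdf_bounds[OF g, of y] that by auto
    then show ?thesis by (simp add: density_quantile_def)
  qed
  have "(\<lambda>p. if p \<in> {0<..<1} then density_quantile g p else (THE y. False)) \<in> borel_measurable borel"
    by (rule borel_measurable_continuous_on_if)
       (use density_quantile_isCont[OF g] in \<open>auto intro!: continuous_at_imp_continuous_on\<close>)
  also have "(\<lambda>p. if p \<in> {0<..<1} then density_quantile g p else (THE y. False)) = density_quantile g"
    using out by auto
  finally show ?thesis .
qed

text \<open>The components of the Knothe map depend on the other coordinates through a potential.
  Writing the distribution function as a parametrized integral \<open>F\<close> gives measurability
  in \<open>x\<close>, and the quantile function of the fixed target \<open>g\<close> is measurable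
  by itself.\<close>

lemma transport_measurable_param:
  assumes [measurable]: "(\<lambda>(x, s). W x s) \<in> borel_measurable (N \<Otimes>\<^sub>M lborel)"
    and [measurable]: "c \<in> borel_measurable N" and g: "pos_density g"
  shows "(\<lambda>x. transport (gibbs1 (W x)) g (c x)) \<in> borel_measurable N"
proof -
  note [measurable] = density_quantile_measurable[OF g]
  have [measurable]: "(\<lambda>x. part1 (W x)) \<in> borel_measurable N"
    unfolding part1_def by measurable
  define F where "F x t = (\<integral>\<^sup>+s. (if s \<le> t then ennreal (exp (- W x s) / part1 (W x)) else 0) \<partial>lborel)" for x t
  have cdf: "density_cdf (gibbs1 (W x)) t = enn2real (F x t)" if x: "x \<in> space N" for x t
  proof -
    have [measurable]: "W x \<in> borel_measurable borel"
      using measurable_compose[OF measurable_Pair1'[OF x] assms(1)] by simp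
    show ?thesis
      unfolding density_cdf_def cdf_def measure_def gibbs1_def[abs_def] F_def
      by (subst emeasure_density) (auto intro!: arg_cong[where f = enn2real] nn_integral_cong split: split_indicator)
  qed
  have [measurable]: "(\<lambda>x. F x (c x)) \<in> borel_measurable N"
    unfolding F_def by measurable
  have "(\<lambda>x. density_quantile g (enn2real (F x (c x)))) \<in> borel_measurable N"
    by measurable
  then show ?thesis
    by (subst measurable_cong[where g = "\<lambda>x. density_quantile g (enn2real (F x (c x)))"])
       (simp_all add: transport_def cdf)
qed

definition insn :: "nat \<Rightarrow> nat \<Rightarrow> (nat \<Rightarrow> real) \<Rightarrow> (nat \<Rightarrow> real) \<Rightarrow> nat \<Rightarrow> real"
  where "insn n i y x = (\<lambda>j\<in>{..<n}. if j < i then y j else x j)"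

text \<open>Up to an additive constant, \<open>knothe_pot n V i x\<close> is the potential of the conditional law of the
  coordinate \<open>i\<close> given the coordinates \<open>x j\<close> with \<open>j > i\<close>.\<close>

definition knothe_pot :: "nat \<Rightarrow> ((nat \<Rightarrow> real) \<Rightarrow> real) \<Rightarrow> nat \<Rightarrow> (nat \<Rightarrow> real) \<Rightarrow> real \<Rightarrow> real"
  where "knothe_pot n V i x s = - ln (part i (\<lambda>y. V (insn n i y (x(i := s)))))"

text \<open>Triangular: component \<open>i\<close> depends on the coordinates \<open>x j\<close>
  with \<open>j \<ge> i\<close> only. The closed form allows measurability to be checked one
  coordinate at a time; the recursion on the dimension is recovered in
  \<open>knothe_update\<close>.\<close>

definition knothe :: "nat \<Rightarrow> ((nat \<Rightarrow> real) \<Rightarrow> real) \<Rightarrow> (nat \<Rightarrow> real) \<Rightarrow> nat \<Rightarrow> real"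
  where "knothe n V x = (\<lambda>i\<in>{..<n}. transport (gibbs1 (knothe_pot n V i x)) std_normal_density (x i))"

lemma measurable_knothe_pot:
  assumes [measurable]: "V \<in> borel_measurable (lebesgue_Rn n)" and i: "i < n"
  shows "(\<lambda>(x, s). knothe_pot n V i x s) \<in> borel_measurable (lebesgue_Rn n \<Otimes>\<^sub>M lborel)"
proof -
  interpret sigma_finite_measure "lebesgue_Rn i" by (rule sigma_finite_lebesgue_Rn)
  have ins: "(\<lambda>(p, y). insn n i y ((fst p)(i := snd p))) \<in> measurable ((lebesgue_Rn n \<Otimes>\<^sub>M lborel) \<Otimes>\<^sub>M lebesgue_Rn i) (lebesgue_Rn n)"
    unfolding insn_def case_prod_unfold lebesgue_Rn_def[of n]
  proof (rule measurable_restrict)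
    fix j assume j: "j \<in> {..<n}"
    show "(\<lambda>q. if j < i then snd q j else ((fst (fst q))(i := snd (fst q))) j)
        \<in> measurable ((Pi\<^sub>M {..<n} (\<lambda>_. lborel) \<Otimes>\<^sub>M lborel) \<Otimes>\<^sub>M lebesgue_Rn i) lborel"
    proof (cases "j < i")
      case True
      then show ?thesis
        using measurable_compose[OF measurable_snd measurable_Rn_component[OF True]] by simp
    next
      case False
      show ?thesis
      proof (cases "j = i")
        case True
        then show ?thesis by simp
      next
        case False
        have "(\<lambda>q. fst (fst q) j) \<in> measurable ((Pi\<^sub>M {..<n} (\<lambda>_. lborel) \<Otimes>\<^sub>M lborel) \<Otimes>\<^sub>M lebesgue_Rn i) lborel"
          using j by measurable
        then show ?thesis using False \<open>\<not> j < i\<close> by simp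
      qed
    qed
  qed
  note [measurable] = measurable_compose[OF ins assms(1)]
  have "(\<lambda>p. LINT y|lebesgue_Rn i. exp (- V (insn n i y ((fst p)(i := snd p))))) \<in> borel_measurable (lebesgue_Rn n \<Otimes>\<^sub>M lborel)"
  proof (rule borel_measurable_lebesgue_integral)
    have "(\<lambda>q. exp (- V (case q of (p, y) \<Rightarrow> insn n i y ((fst p)(i := snd p))))) \<in> borel_measurable ((lebesgue_Rn n \<Otimes>\<^sub>M lborel) \<Otimes>\<^sub>M lebesgue_Rn i)"
      by measurable
    then show "(\<lambda>(p, y). exp (- V (insn n i y ((fst p)(i := snd p))))) \<in> borel_measurable ((lebesgue_Rn n \<Otimes>\<^sub>M lborel) \<Otimes>\<^sub>M lebesgue_Rn i)"
      by (simp add: case_prod_unfold)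
  qed
  then have "(\<lambda>p. - ln (LINT y|lebesgue_Rn i. exp (- V (insn n i y ((fst p)(i := snd p)))))) \<in> borel_measurable (lebesgue_Rn n \<Otimes>\<^sub>M lborel)"
    by measurable
  then show ?thesis by (simp add: knothe_pot_def part_def case_prod_unfold)
qed

lemma measurable_knothe:
  assumes "V \<in> borel_measurable (lebesgue_Rn n)"
  shows "knothe n V \<in> measurable (lebesgue_Rn n) (lebesgue_Rn n)"
proof -
  have "(\<lambda>x. \<lambda>i\<in>{..<n}. transport (gibbs1 (knothe_pot n V i x)) std_normal_density (x i))
      \<in> measurable (lebesgue_Rn n) (Pi\<^sub>M {..<n} (\<lambda>_. lborel))"
  proof (rule measurable_restrict)
    fix i assume i: "i \<in> {..<n}"
    then have "(\<lambda>x. transport (gibbs1 (knothe_pot n V i x)) std_normal_density (x i)) \<in> borel_measurable (lebesgue_Rn n)"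
      by (intro transport_measurable_param measurable_knothe_pot[OF assms] measurable_Rn_component pos_density_std_normal) auto
    then show "(\<lambda>x. transport (gibbs1 (knothe_pot n V i x)) std_normal_density (x i)) \<in> measurable (lebesgue_Rn n) lborel"
      by simp
  qed
  then show ?thesis unfolding knothe_def[abs_def] lebesgue_Rn_def[of n] .
qed

text \<open>For \<open>i < n\<close> fixing the last coordinate turns the conditional potentials
  into those of the slice; for \<open>i = n\<close> all other coordinates are integrated out, which
  leaves the marginal.\<close>

lemma knothe_update:
  assumes x: "x \<in> Rn n"
  shows "knothe (Suc n) V (x(n := t)) =
    (knothe n (sl n V t) x)(n := transport (gibbs1 (marg n V)) std_normal_density t)"
proof
  fix i
  consider "i < n" | "i = n" | "n < i" by linarith
  then show "knothe (Suc n) V (x(n := t)) i =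
    ((knothe n (sl n V t) x)(n := transport (gibbs1 (marg n V)) std_normal_density t)) i"
  proof cases
    case 1
    have "insn (Suc n) i y ((x(n := t))(i := s)) = (insn n i y (x(i := s)))(n := t)" for y s
      using 1 by (auto simp: insn_def fun_eq_iff)
    then have "knothe_pot (Suc n) V i (x(n := t)) = knothe_pot n (sl n V t) i x"
      by (intro ext) (simp only: knothe_pot_def)
    then show ?thesis using 1 by (simp add: knothe_def)
  next
    case 2
    have ins: "insn (Suc n) n y ((x(n := t))(n := s)) = y(n := s)" if "y \<in> Rn n" for y s
      using that x by (auto simp: insn_def fun_eq_iff Rn_def PiE_iff extensional_def)
    have "part n (\<lambda>y. V (insn (Suc n) n y ((x(n := t))(n := s)))) = part n (sl n V s)" for s
      unfolding part_def by (intro Bochner_Integration.integral_cong) (simp_all only: ins space_lebesgue_Rn)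
    then have "knothe_pot (Suc n) V n (x(n := t)) = marg n V"
      by (intro ext) (simp only: knothe_pot_def marg_def)
    then show ?thesis using 2 by (simp add: knothe_def)
  next
    case 3
    then show ?thesis by (simp add: knothe_def)
  qed
qed

section \<open>Push-forward and cost of the Knothe map\<close>

lemma nn_integral_mu_Suc:
  assumes pot: "pot (Suc n) \<epsilon> L V G" and f: "f \<in> borel_measurable (lebesgue_Rn (Suc n))"
  shows "(\<integral>\<^sup>+x. f x \<partial>mu (Suc n) V) =
    (\<integral>\<^sup>+t. ennreal (gibbs1 (marg n V) t) * (\<integral>\<^sup>+x. f (x(n := t)) \<partial>mu n (sl n V t)) \<partial>lborel)"
proof -
  note slice = pot_slice[OF pot]
  note [measurable] = pot_measurable[OF pot] f
  have "(\<integral>\<^sup>+x. f x \<partial>mu (Suc n) V) = (\<integral>\<^sup>+x. ennreal (exp (- V x) / part (Suc n) V) * f x \<partial>lebesgue_Rn (Suc n))"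
    unfolding mu_def by (subst nn_integral_density) auto
  also have "\<dots> = (\<integral>\<^sup>+t. (\<integral>\<^sup>+x. ennreal (exp (- V (x(n := t))) / part (Suc n) V) * f (x(n := t)) \<partial>lebesgue_Rn n) \<partial>lborel)"
    by (rule nn_integral_lebesgue_Rn_Suc) measurable
  also have "\<dots> = (\<integral>\<^sup>+t. ennreal (gibbs1 (marg n V) t) * (\<integral>\<^sup>+x. f (x(n := t)) \<partial>mu n (sl n V t)) \<partial>lborel)"
  proof (intro nn_integral_cong)
    fix t
    note [measurable] = measurable_compose[OF measurable_Rn_slice[of n t] f] pot_measurable[OF slice, of t]
    have w: "0 < part n (sl n V t)" "0 < part (Suc n) V" by (rule part_pos[OF slice], rule part_pos[OF pot])
    have g: "gibbs1 (marg n V) t = part n (sl n V t) / part (Suc n) V"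
      by (simp only: gibbs1_def exp_marg[OF pot] part1_marg[OF pot])
    have "(\<integral>\<^sup>+x. ennreal (exp (- V (x(n := t))) / part (Suc n) V) * f (x(n := t)) \<partial>lebesgue_Rn n)
       = (\<integral>\<^sup>+x. ennreal (gibbs1 (marg n V) t) * (ennreal (exp (- V (x(n := t))) / part n (sl n V t)) * f (x(n := t))) \<partial>lebesgue_Rn n)"
      unfolding g mult.assoc[symmetric] using w
      by (intro nn_integral_cong arg_cong2[where f = "(*)"] refl) (simp add: ennreal_mult[symmetric] del: fun_upd_apply)
    also have "\<dots> = ennreal (gibbs1 (marg n V) t) * (\<integral>\<^sup>+x. ennreal (exp (- V (x(n := t))) / part n (sl n V t)) * f (x(n := t)) \<partial>lebesgue_Rn n)"
      by (rule nn_integral_cmult) measurable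
    also have "(\<integral>\<^sup>+x. ennreal (exp (- V (x(n := t))) / part n (sl n V t)) * f (x(n := t)) \<partial>lebesgue_Rn n) = (\<integral>\<^sup>+x. f (x(n := t)) \<partial>mu n (sl n V t))"
      unfolding mu_def by (subst nn_integral_density) simp_all
    finally show "(\<integral>\<^sup>+x. ennreal (exp (- V (x(n := t))) / part (Suc n) V) * f (x(n := t)) \<partial>lebesgue_Rn n)
       = ennreal (gibbs1 (marg n V) t) * (\<integral>\<^sup>+x. f (x(n := t)) \<partial>mu n (sl n V t))" .
  qed
  finally show ?thesis .
qed

lemma sets_gauss: "sets (gauss n) = sets (lebesgue_Rn n)"
  by (simp add: gauss_def)

lemma measurable_gauss: "borel_measurable (gauss n) = borel_measurable (lebesgue_Rn n)"
  by (rule measurable_cong_sets[OF sets_gauss refl])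

lemma nn_integral_gauss:
  assumes [measurable]: "f \<in> borel_measurable (lebesgue_Rn n)"
  shows "(\<integral>\<^sup>+x. f x \<partial>gauss n) = (\<integral>\<^sup>+x. ennreal ((2 * pi) powr (- real n / 2) * exp (- sqn n x / 2)) * f x \<partial>lebesgue_Rn n)"
proof -
  note [measurable] = borel_measurable_sqn[of n]
  show ?thesis unfolding gauss_def norm_Rn_power2 by (subst nn_integral_density) auto
qed

lemma nn_integral_gauss_Suc:
  assumes f: "f \<in> borel_measurable (lebesgue_Rn (Suc n))"
  shows "(\<integral>\<^sup>+x. f x \<partial>gauss (Suc n)) =
    (\<integral>\<^sup>+t. ennreal (std_normal_density t) * (\<integral>\<^sup>+x. f (x(n := t)) \<partial>gauss n) \<partial>lborel)"
proof -
  note [measurable] = f borel_measurable_sqn[of "Suc n"] borel_measurable_sqn[of n]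
  have "(\<integral>\<^sup>+x. f x \<partial>gauss (Suc n)) = (\<integral>\<^sup>+t. (\<integral>\<^sup>+x. ennreal ((2 * pi) powr (- real (Suc n) / 2) * exp (- sqn (Suc n) (x(n := t)) / 2)) * f (x(n := t)) \<partial>lebesgue_Rn n) \<partial>lborel)"
    unfolding nn_integral_gauss[OF f] by (rule nn_integral_lebesgue_Rn_Suc) measurable
  also have "\<dots> = (\<integral>\<^sup>+t. ennreal (std_normal_density t) * (\<integral>\<^sup>+x. f (x(n := t)) \<partial>gauss n) \<partial>lborel)"
  proof (intro nn_integral_cong)
    fix t
    note m[measurable] = measurable_compose[OF measurable_Rn_slice[of n t] f]
    have "(2 * pi) powr (- real (Suc n) / 2) = (2 * pi) powr (- real n / 2) * (1 / sqrt (2 * pi))"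
    proof -
      have "- real (Suc n) / 2 = - real n / 2 + - (1 / 2)" by (simp add: field_simps)
      then have "(2 * pi) powr (- real (Suc n) / 2) = (2 * pi) powr (- real n / 2) * (2 * pi) powr (- (1 / 2))"
        by (simp only: powr_add)
      then show ?thesis by (simp add: powr_minus powr_half_sqrt field_simps)
    qed
    note powr = this
    have eq: "(2 * pi) powr (- real (Suc n) / 2) * exp (- sqn (Suc n) (x(n := t)) / 2)
        = std_normal_density t * ((2 * pi) powr (- real n / 2) * exp (- sqn n x / 2))" for x
    proof -
      have "- sqn (Suc n) (x(n := t)) / 2 = - t\<^sup>2 / 2 + - sqn n x / 2"
        unfolding sqn_update by (simp add: field_simps)
      then have "exp (- sqn (Suc n) (x(n := t)) / 2) = exp (- t\<^sup>2 / 2) * exp (- sqn n x / 2)"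
        by (simp only: exp_add)
      then show ?thesis unfolding powr std_normal_density_def by (simp only: mult_ac)
    qed
    have "(\<integral>\<^sup>+x. ennreal ((2 * pi) powr (- real (Suc n) / 2) * exp (- sqn (Suc n) (x(n := t)) / 2)) * f (x(n := t)) \<partial>lebesgue_Rn n)
       = (\<integral>\<^sup>+x. ennreal (std_normal_density t) * (ennreal ((2 * pi) powr (- real n / 2) * exp (- sqn n x / 2)) * f (x(n := t))) \<partial>lebesgue_Rn n)"
      unfolding eq mult.assoc[symmetric]
      by (intro nn_integral_cong arg_cong2[where f = "(*)"] refl) (simp add: ennreal_mult[symmetric] mult.assoc)
    also have "\<dots> = ennreal (std_normal_density t) * (\<integral>\<^sup>+x. f (x(n := t)) \<partial>gauss n)"
      unfolding nn_integral_gauss[OF m] by (rule nn_integral_cmult) measurable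
    finally show "(\<integral>\<^sup>+x. ennreal ((2 * pi) powr (- real (Suc n) / 2) * exp (- sqn (Suc n) (x(n := t)) / 2)) * f (x(n := t)) \<partial>lebesgue_Rn n)
       = ennreal (std_normal_density t) * (\<integral>\<^sup>+x. f (x(n := t)) \<partial>gauss n)" .
  qed
  finally show ?thesis .
qed

text \<open>On the fibre over \<open>t\<close> the induction hypothesis replaces the slice measure
  by a Gaussian, with the last coordinate already moved to \<open>\<tau> t\<close>. The
  one-dimensional transport then changes the law of \<open>t\<close>.\<close>

lemma nn_integral_knothe:
  assumes "pot n \<epsilon> L V G" "f \<in> borel_measurable (lebesgue_Rn n)"
  shows "(\<integral>\<^sup>+x. f (knothe n V x) \<partial>mu n V) = (\<integral>\<^sup>+x. f x \<partial>gauss n)"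
  using assms
proof (induction n arbitrary: V G f)
  case 0
  interpret prob_space "mu 0 V" by (rule prob_space_mu[OF 0(1)])
  have k: "knothe 0 V x = (\<lambda>_. undefined)" for x by (auto simp: knothe_def)
  have "(\<integral>\<^sup>+x. f x \<partial>gauss 0) = f (\<lambda>_. undefined)"
    unfolding nn_integral_gauss[OF 0(2)]
    by (simp add: lebesgue_Rn_def PiM_empty nn_integral_count_space_finite sqn_def)
  then show ?case by (simp add: k emeasure_space_1)
next
  case (Suc n)
  note pot = Suc.prems(1) and f = Suc.prems(2)
  note slice = pot_slice[OF pot] and pot1 = pot1_marg[OF pot]
  define \<tau> where "\<tau> = transport (gibbs1 (marg n V)) std_normal_density"
  define \<Psi> where "\<Psi> s = (\<integral>\<^sup>+x. f (x(n := s)) \<partial>gauss n)" for s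
  interpret L: sigma_finite_measure "lebesgue_Rn n" by (rule sigma_finite_lebesgue_Rn)
  note [measurable] = f borel_measurable_sqn[of n] measurable_Rn_update[of n]
    gibbs1_measurable[OF pot1]
  have m: "(\<lambda>x. f (x(n := s))) \<in> borel_measurable (lebesgue_Rn n)" for s
    by (rule measurable_compose[OF measurable_Rn_slice f])
  have \<Psi>m [measurable]: "\<Psi> \<in> borel_measurable borel"
  proof -
    have "(\<lambda>s. \<integral>\<^sup>+x. ennreal ((2 * pi) powr (- real n / 2) * exp (- sqn n x / 2)) * f (case (s, x) of (s, x) \<Rightarrow> x(n := s)) \<partial>lebesgue_Rn n) \<in> borel_measurable lborel"
      by measurable
    then show ?thesis unfolding \<Psi>_def[abs_def] nn_integral_gauss[OF m] by simp
  qed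
  have \<tau>m [measurable]: "\<tau> \<in> borel_measurable borel"
    unfolding \<tau>_def using transport_isCont[OF pos_density_gibbs1[OF pot1] pos_density_std_normal]
    by (auto intro!: borel_measurable_continuous_onI continuous_at_imp_continuous_on)
  have inner: "(\<integral>\<^sup>+x. f (knothe (Suc n) V (x(n := t))) \<partial>mu n (sl n V t)) = \<Psi> (\<tau> t)" for t
  proof -
    have "(\<integral>\<^sup>+x. f (knothe (Suc n) V (x(n := t))) \<partial>mu n (sl n V t)) =
        (\<integral>\<^sup>+x. f ((knothe n (sl n V t) x)(n := \<tau> t)) \<partial>mu n (sl n V t))"
      by (intro nn_integral_cong) (simp only: space_mu[OF slice] knothe_update \<tau>_def)
    also have "\<dots> = \<Psi> (\<tau> t)"
      unfolding \<Psi>_def by (rule Suc.IH[OF slice m])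
    finally show ?thesis .
  qed
  have "(\<integral>\<^sup>+x. f (knothe (Suc n) V x) \<partial>mu (Suc n) V) =
      (\<integral>\<^sup>+t. ennreal (gibbs1 (marg n V) t) * \<Psi> (\<tau> t) \<partial>lborel)"
    by (subst nn_integral_mu_Suc[OF pot measurable_compose[OF measurable_knothe[OF pot_measurable[OF pot]] f]])
       (simp only: inner)
  also have "\<dots> = (\<integral>\<^sup>+t. \<Psi> (\<tau> t) \<partial>density lborel (\<lambda>t. ennreal (gibbs1 (marg n V) t)))"
    by (subst nn_integral_density) auto
  also have "\<dots> = (\<integral>\<^sup>+s. \<Psi> s \<partial>distr (density lborel (\<lambda>t. ennreal (gibbs1 (marg n V) t))) borel \<tau>)"
    by (subst nn_integral_distr) auto
  also have "\<dots> = (\<integral>\<^sup>+s. ennreal (std_normal_density s) * \<Psi> s \<partial>lborel)"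
    unfolding \<tau>_def distr_transport[OF pos_density_gibbs1[OF pot1] pos_density_std_normal]
    by (subst nn_integral_density) auto
  also have "\<dots> = (\<integral>\<^sup>+x. f x \<partial>gauss (Suc n))"
    unfolding nn_integral_gauss_Suc[OF f] \<Psi>_def ..
  finally show ?case .
qed

lemma distr_knothe:
  assumes pot: "pot n \<epsilon> L V G"
  shows "distr (mu n V) (gauss n) (knothe n V) = gauss n"
proof (rule measure_eqI)
  fix A assume "A \<in> sets (distr (mu n V) (gauss n) (knothe n V))"
  then have A [measurable]: "A \<in> sets (lebesgue_Rn n)" by (simp add: sets_gauss)
  have k: "knothe n V \<in> measurable (mu n V) (gauss n)"
    using measurable_knothe[OF pot_measurable[OF pot]]
    by (simp add: measurable_cong_sets[OF sets_mu[OF pot] sets_gauss])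
  have "emeasure (distr (mu n V) (gauss n) (knothe n V)) A = (\<integral>\<^sup>+x. indicator A x \<partial>distr (mu n V) (gauss n) (knothe n V))"
    using A by (simp add: sets_gauss)
  also have "\<dots> = (\<integral>\<^sup>+x. indicator A (knothe n V x) \<partial>mu n V)"
    using A by (intro nn_integral_distr[OF k]) (simp add: measurable_gauss)
  also have "\<dots> = (\<integral>\<^sup>+x. indicator A x \<partial>gauss n)"
    by (rule nn_integral_knothe[OF pot]) simp
  also have "\<dots> = emeasure (gauss n) A" using A by (simp add: sets_gauss)
  finally show "emeasure (distr (mu n V) (gauss n) (knothe n V)) A = emeasure (gauss n) A" .
qed simp

text \<open>The squared distance is additive over coordinates, hence the cost splits into a mean of
  fibre costs and the cost of \<tau>. Both are compared with the matching parts of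
  \<open>fish\<close>, so the factor 4 does not grow with the dimension.\<close>

lemma knothe_cost_le:
  assumes "pot n \<epsilon> L V G" "1 \<le> L"
  shows "(\<integral>\<^sup>+x. ennreal (sqn n (\<lambda>i. knothe n V x i - x i)) \<partial>mu n V) \<le> ennreal (4 * fish n V G)"
  using assms(1)
proof (induction n arbitrary: V G)
  case 0
  then show ?case by (simp add: sqn_def)
next
  case (Suc n)
  note pot = Suc.prems
  note slice = pot_slice[OF pot] and pot1 = pot1_marg[OF pot]
  define \<tau> where "\<tau> = transport (gibbs1 (marg n V)) std_normal_density"
  define F where "F t = fish n (sl n V t) (sl n G t)" for t
  have F0: "0 \<le> F t" for t
    unfolding F_def fish_def by (intro Bochner_Integration.integral_nonneg sum_nonneg) auto
  note FS = fish_Suc[OF pot, folded F_def]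
  have cost_m: "(\<lambda>x. sqn n (\<lambda>i. knothe n V x i - x i)) \<in> borel_measurable (lebesgue_Rn n)"
    if V: "V \<in> borel_measurable (lebesgue_Rn n)" for n V
  proof -
    have "(\<lambda>x. knothe n V x i) \<in> borel_measurable (lebesgue_Rn n)" if "i < n" for i
      by (rule measurable_compose[OF measurable_knothe[OF V] measurable_Rn_component[OF that]])
    then show ?thesis
      unfolding sqn_def by (intro borel_measurable_sum borel_measurable_power borel_measurable_diff measurable_Rn_component) auto
  qed
  have inner: "(\<integral>\<^sup>+x. ennreal (sqn (Suc n) (\<lambda>i. knothe (Suc n) V (x(n := t)) i - (x(n := t)) i)) \<partial>mu n (sl n V t))
      \<le> ennreal (4 * F t + (\<tau> t - t)\<^sup>2)" for t
  proof -
    interpret prob_space "mu n (sl n V t)" by (rule prob_space_mu[OF slice])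
    have [measurable]: "(\<lambda>x. sqn n (\<lambda>i. knothe n (sl n V t) x i - x i)) \<in> borel_measurable (mu n (sl n V t))"
      unfolding measurable_mu[OF slice] by (rule cost_m[OF pot_measurable[OF slice]])
    have "(\<integral>\<^sup>+x. ennreal (sqn (Suc n) (\<lambda>i. knothe (Suc n) V (x(n := t)) i - (x(n := t)) i)) \<partial>mu n (sl n V t))
       = (\<integral>\<^sup>+x. ennreal (sqn n (\<lambda>i. knothe n (sl n V t) x i - x i)) + ennreal ((\<tau> t - t)\<^sup>2) \<partial>mu n (sl n V t))"
    proof (intro nn_integral_cong)
      fix x assume "x \<in> space (mu n (sl n V t))"
      then have x: "x \<in> Rn n" by (simp only: space_mu[OF slice])
      have "sqn (Suc n) (\<lambda>i. knothe (Suc n) V (x(n := t)) i - (x(n := t)) i) = sqn n (\<lambda>i. knothe n (sl n V t) x i - x i) + (\<tau> t - t)\<^sup>2"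
        unfolding knothe_update[OF x] by (simp add: sqn_def \<tau>_def)
      then show "ennreal (sqn (Suc n) (\<lambda>i. knothe (Suc n) V (x(n := t)) i - (x(n := t)) i)) = ennreal (sqn n (\<lambda>i. knothe n (sl n V t) x i - x i)) + ennreal ((\<tau> t - t)\<^sup>2)"
        by (simp only: ennreal_plus sqn_nonneg zero_le_power2)
    qed
    also have "\<dots> = (\<integral>\<^sup>+x. ennreal (sqn n (\<lambda>i. knothe n (sl n V t) x i - x i)) \<partial>mu n (sl n V t)) + ennreal ((\<tau> t - t)\<^sup>2)"
      by (subst nn_integral_add) (simp_all add: emeasure_space_1)
    also have "\<dots> \<le> ennreal (4 * F t) + ennreal ((\<tau> t - t)\<^sup>2)"
      unfolding F_def by (intro add_mono Suc.IH slice order_refl)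
    also have "\<dots> = ennreal (4 * F t + (\<tau> t - t)\<^sup>2)" using F0[of t] by simp
    finally show ?thesis .
  qed
  have lin: "lin_growth1 (\<lambda>t. \<tau> t - t)" "lin_growth1 (\<lambda>t. marg' n V G t - t)"
    unfolding \<tau>_def
    by (intro lin_growth1_diff transport_to_normal_1d(5)[OF pot1] lin_growth1_pot1_slope[OF pot1] lin_growth1_id)+
  have i2: "integrable (nu (marg n V)) (\<lambda>t. (\<tau> t - t)\<^sup>2)"
    by (intro integrable_nu_quad_growth1[OF pot1] lin_growth1_power2 lin)
  have i3: "integrable (nu (marg n V)) (\<lambda>t. (marg' n V G t - t)\<^sup>2)"
    by (intro integrable_nu_quad_growth1[OF pot1] lin_growth1_power2 lin)
  have "(\<integral>\<^sup>+x. ennreal (sqn (Suc n) (\<lambda>i. knothe (Suc n) V x i - x i)) \<partial>mu (Suc n) V)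
     = (\<integral>\<^sup>+t. ennreal (gibbs1 (marg n V) t) * (\<integral>\<^sup>+x. ennreal (sqn (Suc n) (\<lambda>i. knothe (Suc n) V (x(n := t)) i - (x(n := t)) i)) \<partial>mu n (sl n V t)) \<partial>lborel)"
    by (rule nn_integral_mu_Suc[OF pot measurable_compose[OF cost_m[OF pot_measurable[OF pot]] measurable_ennreal]])
  also have "\<dots> \<le> (\<integral>\<^sup>+t. ennreal (gibbs1 (marg n V) t) * ennreal (4 * F t + (\<tau> t - t)\<^sup>2) \<partial>lborel)"
    by (intro nn_integral_mono mult_left_mono inner) simp
  also have "\<dots> = (\<integral>\<^sup>+t. ennreal (4 * F t + (\<tau> t - t)\<^sup>2) \<partial>nu (marg n V))"
  proof -
    have "(\<lambda>t. ennreal (4 * F t + (\<tau> t - t)\<^sup>2)) \<in> borel_measurable (nu (marg n V))"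
      using borel_measurable_integrable[OF FS(1)] borel_measurable_integrable[OF i2] by measurable
    then have "(\<lambda>t. ennreal (4 * F t + (\<tau> t - t)\<^sup>2)) \<in> borel_measurable lborel"
      by (simp add: measurable_cong_sets[OF sets_nu[OF pot1] refl])
    then show ?thesis
      unfolding nu_def using gibbs1_measurable[OF pot1] by (subst nn_integral_density) auto
  qed
  also have "\<dots> = ennreal (LINT t|nu (marg n V). 4 * F t + (\<tau> t - t)\<^sup>2)"
    using FS(1) i2 F0 by (intro nn_integral_eq_integral) auto
  also have "(LINT t|nu (marg n V). 4 * F t + (\<tau> t - t)\<^sup>2) = 4 * (LINT t|nu (marg n V). F t) + (LINT t|nu (marg n V). (\<tau> t - t)\<^sup>2)"
    using FS(1) i2 by simp
  also have "ennreal \<dots> \<le> ennreal (4 * fish (Suc n) V G)"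
  proof (rule ennreal_leI)
    have "(LINT t|nu (marg n V). (\<tau> t - t)\<^sup>2) \<le> 4 * (LINT t|nu (marg n V). (marg' n V G t - t)\<^sup>2)"
      unfolding \<tau>_def by (rule deficit_1d(2)[OF pot1 \<open>1 \<le> L\<close>])
    \<comment> \<open>Jensen's inequality on each fibre: \<open>marg' n V G t\<close> is the fibre
      mean of the last partial derivative.\<close>
    also have "(LINT t|nu (marg n V). (marg' n V G t - t)\<^sup>2) \<le> (LINT t|nu (marg n V). LINT x|mu n (sl n V t). (G (x(n := t)) n - t)\<^sup>2)"
    proof (rule integral_mono[OF i3 FS(2)])
      fix t
      interpret prob_space "mu n (sl n V t)" by (rule prob_space_mu[OF slice])
      have lg: "lin_growth n (\<lambda>x. G (x(n := t)) n - t)"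
        by (intro lin_growth_diff lin_growth_slice_gradient[OF pot] lin_growth_const)
      have "0 \<le> varm (mu n (sl n V t)) (\<lambda>x. G (x(n := t)) n - t)"
        by (intro varm_nonneg prob_space_mu[OF slice] lin_growth_integrable[OF slice] lg)
      moreover have "integrable (mu n (sl n V t)) (\<lambda>x. G (x(n := t)) n)"
        by (rule lin_growth_integrable(1)[OF slice lin_growth_slice_gradient[OF pot]])
      ultimately show "(marg' n V G t - t)\<^sup>2 \<le> (LINT x|mu n (sl n V t). (G (x(n := t)) n - t)\<^sup>2)"
        by (simp add: varm_def marg'_def prob_space del: fun_upd_apply)
    qed
    finally show "4 * (LINT t|nu (marg n V). F t) + (LINT t|nu (marg n V). (\<tau> t - t)\<^sup>2) \<le> 4 * fish (Suc n) V G"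
      unfolding FS(3) by simp
  qed
  finally show ?case .
qed

text \<open>The law of the pair of \<open>x\<close> and \<open>knothe n V x\<close> is a coupling,
  and its cost bounds the infimum.\<close>

lemma W2_squared_le_fish:
  assumes pot: "pot n \<epsilon> L V G" and L: "1 \<le> L"
  shows "W2_squared n (mu n V) (gauss n) \<le> ennreal (4 * fish n V G)"
proof -
  let ?P = "mu n V \<Otimes>\<^sub>M gauss n"
  let ?T = "\<lambda>x. (x, knothe n V x)"
  have k: "knothe n V \<in> measurable (mu n V) (gauss n)"
    using measurable_knothe[OF pot_measurable[OF pot]]
    by (simp add: measurable_cong_sets[OF sets_mu[OF pot] sets_gauss])
  have T [measurable]: "?T \<in> measurable (mu n V) ?P"
    using k by measurable
  have c: "distr (mu n V) ?P ?T \<in> couplings (mu n V) (gauss n)"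
  proof -
    have "distr (distr (mu n V) ?P ?T) (mu n V) fst = distr (mu n V) (mu n V) (fst \<circ> ?T)"
      by (rule distr_distr) measurable
    also have "fst \<circ> ?T = (\<lambda>x. x)" by (simp add: comp_def)
    finally have 1: "distr (distr (mu n V) ?P ?T) (mu n V) fst = mu n V" by (simp add: distr_id)
    have "distr (distr (mu n V) ?P ?T) (gauss n) snd = distr (mu n V) (gauss n) (snd \<circ> ?T)"
      by (rule distr_distr) measurable
    also have "snd \<circ> ?T = knothe n V" by (simp add: comp_def)
    finally have 2: "distr (distr (mu n V) ?P ?T) (gauss n) snd = gauss n" by (simp add: distr_knothe[OF pot])
    show ?thesis using 1 2 by (simp add: couplings_def)
  qed
  have d: "(dist_Rn n x y)\<^sup>2 = sqn n (\<lambda>i. y i - x i)" for x y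
    unfolding dist_Rn_def norm_Rn_power2 by (simp add: sqn_def power2_commute)
  have dm: "(\<lambda>(x, y). ennreal ((dist_Rn n x y)\<^sup>2)) \<in> borel_measurable ?P"
  proof -
    have "(\<lambda>p. fst p i) \<in> borel_measurable ?P" "(\<lambda>p. snd p i) \<in> borel_measurable ?P" if "i < n" for i
      using measurable_Rn_component[OF that]
      by (auto intro!: measurable_compose[OF measurable_fst] measurable_compose[OF measurable_snd]
          simp: measurable_mu[OF pot] measurable_gauss)
    then have "(\<lambda>p. ennreal (\<Sum>i<n. (snd p i - fst p i)\<^sup>2)) \<in> borel_measurable ?P"
      by (intro measurable_compose[OF _ measurable_ennreal] borel_measurable_sum borel_measurable_power borel_measurable_diff) auto
    then show ?thesis by (simp add: d sqn_def case_prod_unfold)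
  qed
  have "W2_squared n (mu n V) (gauss n) \<le> (\<integral>\<^sup>+ (x, y). ennreal ((dist_Rn n x y)\<^sup>2) \<partial>distr (mu n V) ?P ?T)"
    unfolding W2_squared_def by (rule INF_lower[OF c])
  also have "\<dots> = (\<integral>\<^sup>+x. ennreal (sqn n (\<lambda>i. knothe n V x i - x i)) \<partial>mu n V)"
    using dm by (subst nn_integral_distr[OF T]) (simp_all add: d)
  also have "\<dots> \<le> ennreal (4 * fish n V G)" by (rule knothe_cost_le[OF pot L])
  finally show ?thesis .
qed

section \<open>Reduction from almost everywhere Hessian bounds\<close>

lemma dist_Rn_power2: "(dist_Rn n x y)\<^sup>2 = sqn n (\<lambda>i. x i - y i)"
  unfolding dist_Rn_def norm_Rn_power2 ..

lemma dist_Rn_nonneg: "0 \<le> dist_Rn n x y"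
  by (simp add: dist_Rn_def norm_Rn_def L2_set_nonneg)

lemma dist_Rn_le:
  assumes "\<And>i. i < n \<Longrightarrow> \<bar>x i - y i\<bar> \<le> r"
  shows "dist_Rn n x y \<le> real n * r"
proof -
  have "dist_Rn n x y \<le> (\<Sum>i<n. \<bar>x i - y i\<bar>)"
    unfolding dist_Rn_def norm_Rn_def by (rule L2_set_le_sum_abs)
  also have "\<dots> \<le> (\<Sum>i<n. r)" by (intro sum_mono assms) auto
  finally show ?thesis by simp
qed

lemma abs_le_dist_Rn:
  assumes "i < n"
  shows "\<bar>x i - y i\<bar> \<le> dist_Rn n x y"
proof -
  have "(x i - y i)\<^sup>2 \<le> (\<Sum>j<n. (x j - y j)\<^sup>2)" using assms by (intro member_le_sum) auto
  then show ?thesis unfolding dist_Rn_def norm_Rn_def L2_set_def by (intro real_le_rsqrt) simp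
qed

lemma translate_in_Rn: "translate n a x \<in> Rn n"
  by (simp add: translate_def Rn_def)

lemma translate_0: "x \<in> Rn n \<Longrightarrow> translate n (\<lambda>i. 0 * v i) x = x"
  by (auto simp: translate_def Rn_def PiE_iff extensional_def fun_eq_iff)

lemma translate_translate:
  "translate n (\<lambda>i. s * v i) (translate n (\<lambda>i. t * v i) x) = translate n (\<lambda>i. (t + s) * v i) x"
  by (auto simp: translate_def fun_eq_iff algebra_simps)

lemma translate_diff: "x \<in> Rn n \<Longrightarrow> y \<in> Rn n \<Longrightarrow> translate n (\<lambda>i. 1 * (y i - x i)) x = y"
  by (auto simp: translate_def Rn_def PiE_iff extensional_def fun_eq_iff)

text \<open>Continuity is phrased with \<open>dist_Rn\<close>, whereas the measurable sets come from
  a product. Rounding all coordinates down to multiples of \<open>1 / 2 ^ k\<close> turns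
  \<open>f\<close> into a measurable function with countably many values, and continuity gives
  convergence at every point.\<close>

lemma borel_measurable_dist_continuous:
  fixes f :: "(nat \<Rightarrow> real) \<Rightarrow> real"
  assumes c: "\<And>x e. x \<in> Rn n \<Longrightarrow> 0 < e \<Longrightarrow> \<exists>d>0. \<forall>y\<in>Rn n. dist_Rn n y x < d \<longrightarrow> \<bar>f y - f x\<bar> < e"
  shows "f \<in> borel_measurable (lebesgue_Rn n)"
proof -
  define Q where "Q = PiE {..<n} (\<lambda>_. UNIV :: int set)"
  define m where "m k x = (\<lambda>i\<in>{..<n}. \<lfloor>2 ^ k * x i\<rfloor>)" for k :: nat and x :: "nat \<Rightarrow> real"
  define r where "r k a = (\<lambda>i\<in>{..<n}. real_of_int (a i) / 2 ^ k)" for k :: nat and a :: "nat \<Rightarrow> int"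
  have Q: "countable Q" unfolding Q_def by (intro countable_PiE) auto
  have m: "m k \<in> measurable (lebesgue_Rn n) (count_space Q)" for k
    unfolding measurable_count_space_eq_countable[OF Q]
  proof (intro conjI ballI)
    show "m k \<in> space (lebesgue_Rn n) \<rightarrow> Q" by (auto simp: m_def Q_def)
    fix a assume a: "a \<in> Q"
    have "m k -` {a} \<inter> space (lebesgue_Rn n) = {x \<in> space (lebesgue_Rn n). \<forall>i\<in>{..<n}. \<lfloor>2 ^ k * x i\<rfloor> = a i}"
      using a by (auto simp: m_def Q_def fun_eq_iff PiE_iff extensional_def)
    also have "\<dots> \<in> sets (lebesgue_Rn n)"
    proof (intro sets.sets_Collect_finite_All)
      fix i assume "i \<in> {..<n}"
      then have [measurable]: "(\<lambda>x. x i) \<in> borel_measurable (lebesgue_Rn n)" by (intro measurable_Rn_component) auto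
      show "{x \<in> space (lebesgue_Rn n). \<lfloor>2 ^ k * x i\<rfloor> = a i} \<in> sets (lebesgue_Rn n)" by measurable
    qed simp
    finally show "m k -` {a} \<inter> space (lebesgue_Rn n) \<in> sets (lebesgue_Rn n)" .
  qed
  show ?thesis
  proof (rule borel_measurable_LIMSEQ_real)
    show "(\<lambda>x. f (r k (m k x))) \<in> borel_measurable (lebesgue_Rn n)" for k
      by (rule measurable_compose[OF m]) simp
    fix x assume "x \<in> space (lebesgue_Rn n)"
    then have x: "x \<in> Rn n" by (simp add: space_lebesgue_Rn)
    have rR: "r k a \<in> Rn n" for k a by (simp add: r_def Rn_def)
    have dist: "dist_Rn n (r k (m k x)) x \<le> real n * (1 / 2 ^ k)" for k
    proof (rule dist_Rn_le)
      fix i assume i: "i < n"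
      have "\<bar>real_of_int \<lfloor>2 ^ k * x i\<rfloor> - 2 ^ k * x i\<bar> \<le> 1" by linarith
      then have "\<bar>(real_of_int \<lfloor>2 ^ k * x i\<rfloor> - 2 ^ k * x i) / 2 ^ k\<bar> \<le> 1 / 2 ^ k"
        by (simp add: divide_right_mono)
      then show "\<bar>r k (m k x) i - x i\<bar> \<le> 1 / 2 ^ k"
        using i by (simp add: r_def m_def diff_divide_distrib)
    qed
    have lim: "(\<lambda>k. real n * (1 / 2 ^ k)) \<longlonglongrightarrow> 0"
      by (intro tendsto_mult_right_zero LIMSEQ_divide_realpow_zero) simp
    show "(\<lambda>k. f (r k (m k x))) \<longlonglongrightarrow> f x"
    proof (rule LIMSEQ_I)
      fix e :: real assume "0 < e"
      obtain d where d: "0 < d" "\<And>y. y \<in> Rn n \<Longrightarrow> dist_Rn n y x < d \<Longrightarrow> \<bar>f y - f x\<bar> < e"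
        using c[OF x \<open>0 < e\<close>] by blast
      obtain N where N: "\<And>k. N \<le> k \<Longrightarrow> real n * (1 / 2 ^ k) < d"
        using order_tendstoD(2)[OF lim \<open>0 < d\<close>] by (auto simp: eventually_sequentially)
      show "\<exists>N. \<forall>k\<ge>N. norm (f (r k (m k x)) - f x) < e"
      proof (intro exI[of _ N] allI impI)
        fix k assume "N \<le> k"
        then have "dist_Rn n (r k (m k x)) x < d" using le_less_trans[OF dist N] by blast
        then show "norm (f (r k (m k x)) - f x) < e" using d(2)[OF rR] by simp
      qed
    qed
  qed
qed

lemma borel_measurable_lipschitz:
  fixes f :: "(nat \<Rightarrow> real) \<Rightarrow> real"
  assumes "\<And>x y. x \<in> Rn n \<Longrightarrow> y \<in> Rn n \<Longrightarrow> \<bar>f x - f y\<bar> \<le> K * dist_Rn n x y"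
  shows "f \<in> borel_measurable (lebesgue_Rn n)"
proof (rule borel_measurable_dist_continuous)
  fix x and e :: real assume x: "x \<in> Rn n" and "0 < e"
  show "\<exists>d>0. \<forall>y\<in>Rn n. dist_Rn n y x < d \<longrightarrow> \<bar>f y - f x\<bar> < e"
  proof (intro exI[of _ "e / (\<bar>K\<bar> + 1)"] conjI ballI impI)
    show "0 < e / (\<bar>K\<bar> + 1)" using \<open>0 < e\<close> by simp
    fix y assume y: "y \<in> Rn n" and d: "dist_Rn n y x < e / (\<bar>K\<bar> + 1)"
    have "\<bar>f y - f x\<bar> \<le> (\<bar>K\<bar> + 1) * dist_Rn n y x"
      using assms[OF y x] mult_right_mono[OF abs_ge_self[of K] dist_Rn_nonneg[of n y x]] dist_Rn_nonneg[of n y x]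
      by (simp add: algebra_simps)
    also have "\<dots> < e" using d by (simp add: pos_less_divide_eq mult.commute)
    finally show "\<bar>f y - f x\<bar> < e" .
  qed
qed

lemma has_gradient_DERIV:
  assumes g: "has_gradient n f g x" and x: "x \<in> Rn n"
  shows "((\<lambda>s. f (translate n (\<lambda>i. s * v i) x)) has_real_derivative (\<Sum>i<n. g i * v i)) (at 0)"
proof -
  define D where "D = (\<Sum>i<n. g i * v i)"
  define w where "w = norm_Rn n v"
  have w0: "0 \<le> w" by (simp add: w_def norm_Rn_def)
  have dist: "dist_Rn n (translate n (\<lambda>i. s * v i) x) x = \<bar>s\<bar> * w" for s
  proof -
    have "dist_Rn n (translate n (\<lambda>i. s * v i) x) x = L2_set (\<lambda>i. s * v i) {..<n}"
      unfolding dist_Rn_def norm_Rn_def by (intro L2_set_cong) (auto simp: translate_def)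
    also have "\<dots> = sqrt (s\<^sup>2 * (\<Sum>i<n. (v i)\<^sup>2))"
      by (simp add: L2_set_def power_mult_distrib sum_distrib_left)
    finally show ?thesis by (simp add: w_def norm_Rn_def L2_set_def real_sqrt_mult)
  qed
  have lin: "(\<Sum>i<n. g i * (translate n (\<lambda>i. s * v i) x i - x i)) = s * D" for s
    by (auto simp: D_def sum_distrib_left translate_def intro!: sum.cong)
  have f0: "f (translate n (\<lambda>i. 0 * v i) x) = f x" using translate_0[OF x] by simp
  have "((\<lambda>h. (f (translate n (\<lambda>i. (0 + h) * v i) x) - f (translate n (\<lambda>i. 0 * v i) x)) / h) \<longlongrightarrow> D) (at 0)"
    unfolding f0
  proof (rule LIM_I)
    fix r :: real assume r: "0 < r"
    \<comment> \<open>The \<open>+ 1\<close>, here and in the radius below, keeps the denominators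
      positive when \<open>w = 0\<close>.\<close>
    define e where "e = r / (2 * (w + 1))"
    have e: "0 < e" "e * w < r" using r w0 by (auto simp: e_def field_simps intro: add_nonneg_pos)
    obtain d where d: "0 < d" "\<And>y. y \<in> Rn n \<Longrightarrow> dist_Rn n y x < d \<Longrightarrow>
        \<bar>f y - f x - (\<Sum>i<n. g i * (y i - x i))\<bar> \<le> e * dist_Rn n y x"
      using g e(1) unfolding has_gradient_def by blast
    show "\<exists>s>0. \<forall>h. h \<noteq> 0 \<and> norm (h - 0) < s \<longrightarrow> norm ((f (translate n (\<lambda>i. (0 + h) * v i) x) - f x) / h - D) < r"
    proof (intro exI[of _ "d / (w + 1)"] conjI allI impI)
      show "0 < d / (w + 1)" using d w0 by simp
      fix h :: real assume h: "h \<noteq> 0 \<and> norm (h - 0) < d / (w + 1)"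
      let ?y = "translate n (\<lambda>i. h * v i) x"
      have "\<bar>h\<bar> * w \<le> \<bar>h\<bar> * (w + 1)" by (simp add: mult_left_mono)
      also have "\<dots> < d" using h w0 by (simp add: pos_less_divide_eq)
      finally have "\<bar>f ?y - f x - h * D\<bar> \<le> e * (\<bar>h\<bar> * w)"
        using d(2)[OF translate_in_Rn, of "\<lambda>i. h * v i" x] unfolding dist lin by simp
      then have "\<bar>f ?y - f x - h * D\<bar> / \<bar>h\<bar> \<le> e * (\<bar>h\<bar> * w) / \<bar>h\<bar>" by (rule divide_right_mono) simp
      also have "\<dots> = e * w" using h by simp
      also have "\<bar>f ?y - f x - h * D\<bar> / \<bar>h\<bar> = norm ((f ?y - f x) / h - D)"
        using h by (simp add: abs_divide[symmetric] diff_divide_distrib del: abs_divide)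
      finally show "norm ((f (translate n (\<lambda>i. (0 + h) * v i) x) - f x) / h - D) < r"
        using e by simp
    qed
  qed
  then show ?thesis unfolding DERIV_def D_def .
qed

text \<open>Averaging over small boxes turns the almost everywhere bound on the derivative of \<open>u\<close> in
  direction \<open>v\<close> into a bound everywhere, since the averages are differentiable by dominated
  convergence.\<close>

lemma AE_directional_derivative_lower_bound:
  fixes u :: "(nat \<Rightarrow> real) \<Rightarrow> real"
  assumes lip: "\<And>y z. y \<in> Rn n \<Longrightarrow> z \<in> Rn n \<Longrightarrow> \<bar>u y - u z\<bar> \<le> K * dist_Rn n y z"
    and ae: "AE z in lebesgue_Rn n. \<exists>d\<ge>\<alpha>. ((\<lambda>s. u (translate n (\<lambda>i. s * v i) z)) has_real_derivative d) (at 0)"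
    and x: "x \<in> Rn n" and t: "0 \<le> t"
  shows "\<alpha> * t \<le> u (translate n (\<lambda>i. t * v i) x) - u x"
proof -
  let ?L = "lebesgue_Rn n"
  define T where "T s = translate n (\<lambda>i. s * v i)" for s
  have TR: "T s z \<in> Rn n" for s z by (simp add: T_def translate_in_Rn)
  have T0: "z \<in> Rn n \<Longrightarrow> T 0 z = z" for z unfolding T_def by (rule translate_0)
  have TT: "T s (T r z) = T (r + s) z" for s r z by (simp only: T_def translate_translate)
  have [measurable]: "T s \<in> measurable ?L ?L" for s by (simp add: T_def measurable_translate)
  have [measurable]: "u \<in> borel_measurable ?L" by (rule borel_measurable_lipschitz[OF lip])
  define w where "w = norm_Rn n v"
  have "0 \<le> w" by (simp add: w_def norm_Rn_def)
  have distT: "dist_Rn n (T s z) (T r z) = \<bar>s - r\<bar> * w" for s r z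
  proof -
    have "dist_Rn n (T s z) (T r z) = L2_set (\<lambda>i. (s - r) * v i) {..<n}"
      unfolding dist_Rn_def norm_Rn_def by (intro L2_set_cong) (auto simp: T_def translate_def algebra_simps)
    also have "\<dots> = sqrt ((s - r)\<^sup>2 * (\<Sum>i<n. (v i)\<^sup>2))"
      by (simp add: L2_set_def power_mult_distrib sum_distrib_left)
    finally show ?thesis by (simp add: w_def norm_Rn_def L2_set_def real_sqrt_mult)
  qed
  \<comment> \<open>Translation invariance moves the exceptional null set: at each fixed
    \<open>r\<close>, almost every starting point \<open>z\<close> is differentiable at
    \<open>T r z\<close>.\<close>
  have aeT: "AE z in ?L. \<exists>d\<ge>\<alpha>. ((\<lambda>s. u (T (r + s) z)) has_real_derivative d) (at 0)" for r
  proof -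
    have "AE z in distr ?L ?L (T r). \<exists>d\<ge>\<alpha>. ((\<lambda>s. u (T s z)) has_real_derivative d) (at 0)"
      using ae unfolding T_def distr_translate .
    from AE_distrD[OF _ this] show ?thesis by (simp add: TT)
  qed
  \<comment> \<open>The error is the price for replacing the values of \<open>u\<close> at
    \<open>x\<close> and at \<open>T t x\<close> by averages over translates of a box with side
    \<open>r\<close>; it disappears as \<open>r\<close> tends to 0.\<close>
  have bound: "\<alpha> * t \<le> u (T t x) - u x + 2 * (\<bar>K\<bar> * (real n * r))" if r: "0 < r" for r
  proof -
    define B where "B = PiE {..<n} (\<lambda>i. {x i..x i + r})"
    have B [measurable]: "B \<in> sets ?L"
      unfolding B_def lebesgue_Rn_def by (intro sets_PiM_I_finite) auto
    have BR: "z \<in> B \<Longrightarrow> z \<in> Rn n" for z by (auto simp: B_def Rn_def PiE_iff)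
    have "emeasure ?L B = (\<Prod>i<n. ennreal r)"
      unfolding B_def lebesgue_Rn_def using r by (subst lborel_PiM.emeasure_PiM) auto
    then have emB: "emeasure ?L B = ennreal (r ^ n)" using r by (simp add: ennreal_power)
    define vol where "vol = r ^ n"
    have vol: "0 < vol" "measure ?L B = vol" using r emB by (auto simp: vol_def measure_def)
    have iB: "integrable ?L (\<lambda>z. c * indicator B z)" for c :: real
      using emB by (intro integrable_mult_right integrable_real_indicator) auto
    have intB: "(LINT z|?L. c * indicator B z) = c * vol" for c :: real
      using vol(2) sets.sets_into_space[OF B] by (simp add: Int_absorb2)
    have close: "\<bar>u (T s z) - u (T s x)\<bar> \<le> \<bar>K\<bar> * (real n * r)" if z: "z \<in> B" for s z
    proof -
      have "dist_Rn n (T s z) (T s x) \<le> real n * r"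
      proof (rule dist_Rn_le)
        fix i assume "i < n"
        with z have "z i \<in> {x i..x i + r}" by (auto simp: B_def PiE_iff)
        then show "\<bar>T s z i - T s x i\<bar> \<le> r" using \<open>i < n\<close> by (auto simp: T_def translate_def)
      qed
      then have "\<bar>K\<bar> * dist_Rn n (T s z) (T s x) \<le> \<bar>K\<bar> * (real n * r)" by (simp add: mult_left_mono)
      moreover have "K * dist_Rn n (T s z) (T s x) \<le> \<bar>K\<bar> * dist_Rn n (T s z) (T s x)"
        by (intro mult_right_mono dist_Rn_nonneg) simp
      ultimately show ?thesis using lip[OF TR TR, of s z s x] by linarith
    qed
    define f where "f s z = u (T s z) * indicator B z" for s z
    have fm [measurable]: "f s \<in> borel_measurable ?L" for s unfolding f_def by measurable
    have fi: "integrable ?L (f s)" for s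
    proof (rule Bochner_Integration.integrable_bound[OF iB[of "\<bar>u (T s x)\<bar> + \<bar>K\<bar> * (real n * r)"]])
      show "AE z in ?L. norm (f s z) \<le> norm ((\<bar>u (T s x)\<bar> + \<bar>K\<bar> * (real n * r)) * indicator B z)"
      proof (rule AE_I2)
        fix z
        show "norm (f s z) \<le> norm ((\<bar>u (T s x)\<bar> + \<bar>K\<bar> * (real n * r)) * indicator B z)"
          using close[of z s] r by (auto simp: f_def indicator_def)
      qed
    qed simp
    define A where "A s = (LINT z|?L. f s z)" for s
    \<comment> \<open>A limit along one fixed sequence is measurable without further assumptions,
      and it agrees with the derivative wherever that exists.\<close>
    define D where "D s z = lim (\<lambda>k. (f (s + 1 / real (Suc k)) z - f s z) / (1 / real (Suc k)))" for s z
    have Dm: "D s \<in> borel_measurable ?L" for s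
      unfolding D_def[abs_def] by (intro borel_measurable_lim_metric) measurable
    have Dlim: "AE z in ?L. ((\<lambda>h. (f (s + h) z - f s z) / h) \<longlongrightarrow> D s z) (at 0) \<and> \<alpha> * indicator B z \<le> D s z" for s
      using aeT[of s]
    proof (rule AE_mp, intro AE_I2 impI)
      fix z assume "\<exists>d\<ge>\<alpha>. ((\<lambda>h. u (T (s + h) z)) has_real_derivative d) (at 0)"
      then obtain d where d: "\<alpha> \<le> d" "((\<lambda>h. u (T (s + h) z)) has_real_derivative d) (at 0)" by blast
      have "((\<lambda>h. (u (T (s + h) z) - u (T s z)) / h * indicator B z) \<longlongrightarrow> d * indicator B z) (at 0)"
        using d(2) unfolding DERIV_def by (intro tendsto_mult_right) simp
      then have l: "((\<lambda>h. (f (s + h) z - f s z) / h) \<longlongrightarrow> d * indicator B z) (at 0)"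
        by (simp add: f_def left_diff_distrib[symmetric])
      have "(\<lambda>k. 1 / real (Suc k)) \<longlonglongrightarrow> 0" using LIMSEQ_inverse_real_of_nat by (simp add: inverse_eq_divide)
      then have "filterlim (\<lambda>k. 1 / real (Suc k)) (at 0) sequentially"
        by (simp add: filterlim_at)
      from filterlim_compose[OF l this] have "D s z = d * indicator B z"
        unfolding D_def by (rule limI)
      then show "((\<lambda>h. (f (s + h) z - f s z) / h) \<longlongrightarrow> D s z) (at 0) \<and> \<alpha> * indicator B z \<le> D s z"
        using l d(1) by (auto simp: indicator_def)
    qed
    have dq: "\<bar>(f (s + h) z - f s z) / h\<bar> \<le> (\<bar>K\<bar> * w) * indicator B z" if "h \<noteq> 0" for s h z
    proof (cases "z \<in> B")
      case True
      have "\<bar>u (T (s + h) z) - u (T s z)\<bar> \<le> K * (\<bar>h\<bar> * w)"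
        using lip[OF TR TR, of "s + h" z s z] unfolding distT by simp
      also have "\<dots> \<le> \<bar>K\<bar> * (\<bar>h\<bar> * w)" using \<open>0 \<le> w\<close> by (intro mult_right_mono) auto
      finally show ?thesis using True that by (simp add: f_def divide_le_eq mult.commute mult.left_commute)
    qed (simp add: f_def)
    have Dint: "integrable ?L (D s)" for s
    proof (rule Bochner_Integration.integrable_bound[OF iB[of "\<bar>K\<bar> * w"] Dm])
      show "AE z in ?L. norm (D s z) \<le> norm (\<bar>K\<bar> * w * indicator B z)"
        using Dlim[of s]
      proof (rule AE_mp, intro AE_I2 impI)
        fix z assume "((\<lambda>h. (f (s + h) z - f s z) / h) \<longlongrightarrow> D s z) (at 0) \<and> \<alpha> * indicator B z \<le> D s z"
        then have "((\<lambda>h. \<bar>(f (s + h) z - f s z) / h\<bar>) \<longlongrightarrow> \<bar>D s z\<bar>) (at 0)"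
          by (intro tendsto_rabs) auto
        then have "\<bar>D s z\<bar> \<le> \<bar>K\<bar> * w * indicator B z"
          by (rule tendsto_upperbound) (auto simp: eventually_at_filter dq simp del: abs_divide)
        then show "norm (D s z) \<le> norm (\<bar>K\<bar> * w * indicator B z)" by simp
      qed
    qed
    have Ad: "(A has_real_derivative (LINT z|?L. D s z)) (at s)" for s
      unfolding DERIV_def tendsto_at_iff_sequentially comp_def
    proof (intro allI impI)
      fix X :: "nat \<Rightarrow> real" assume X: "\<forall>i. X i \<in> UNIV - {0}" "X \<longlonglongrightarrow> 0"
      have "(\<lambda>k. LINT z|?L. (f (s + X k) z - f s z) / X k) \<longlonglongrightarrow> (LINT z|?L. D s z)"
      proof (rule integral_dominated_convergence[OF Dm _ iB[of "\<bar>K\<bar> * w"]])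
        show "AE z in ?L. (\<lambda>k. (f (s + X k) z - f s z) / X k) \<longlonglongrightarrow> D s z"
          using Dlim[of s]
        proof (rule AE_mp, intro AE_I2 impI)
          fix z assume "((\<lambda>h. (f (s + h) z - f s z) / h) \<longlongrightarrow> D s z) (at 0) \<and> \<alpha> * indicator B z \<le> D s z"
          then show "(\<lambda>k. (f (s + X k) z - f s z) / X k) \<longlonglongrightarrow> D s z"
            using X unfolding tendsto_at_iff_sequentially comp_def by blast
        qed
        show "AE z in ?L. norm ((f (s + X k) z - f s z) / X k) \<le> \<bar>K\<bar> * w * indicator B z" for k
          using dq[of "X k" s] X(1) by (intro AE_I2) (simp del: abs_divide)
      qed measurable
      moreover have "(LINT z|?L. (f (s + X k) z - f s z) / X k) = (A (s + X k) - A s) / X k" for k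
        using fi by (simp add: A_def)
      ultimately show "(\<lambda>k. (A (s + X k) - A s) / X k) \<longlonglongrightarrow> (LINT z|?L. D s z)" by (simp only:)
    qed
    have "\<alpha> * vol \<le> (LINT z|?L. D s z)" for s
      unfolding intB[symmetric]
    proof (rule integral_mono_AE[OF iB Dint])
      show "AE z in ?L. \<alpha> * indicator B z \<le> D s z" using Dlim[of s] by (rule AE_mp) (intro AE_I2, auto)
    qed
    then have "A 0 - \<alpha> * vol * 0 \<le> A t - \<alpha> * vol * t"
      by (intro deriv_nonneg_imp_mono[of 0 t "\<lambda>s. A s - \<alpha> * vol * s" "\<lambda>s. (LINT z|?L. D s z) - \<alpha> * vol"])
         (auto intro!: derivative_eq_intros Ad t)
    moreover have "A t \<le> (u (T t x) + \<bar>K\<bar> * (real n * r)) * vol"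
      unfolding A_def intB[symmetric]
    proof (rule integral_mono[OF fi iB])
      fix z show "f t z \<le> (u (T t x) + \<bar>K\<bar> * (real n * r)) * indicator B z"
        using close[of z t] by (auto simp: f_def indicator_def)
    qed
    moreover have "(u x - \<bar>K\<bar> * (real n * r)) * vol \<le> A 0"
      unfolding A_def intB[symmetric]
    proof (rule integral_mono[OF iB fi])
      fix z show "(u x - \<bar>K\<bar> * (real n * r)) * indicator B z \<le> f 0 z"
        using close[of z 0] by (auto simp: f_def indicator_def T0 x)
    qed
    ultimately have "(\<alpha> * t) * vol \<le> (u (T t x) - u x + 2 * (\<bar>K\<bar> * (real n * r))) * vol"
      by (simp add: algebra_simps)
    then show ?thesis using vol(1) by (simp only: mult_le_cancel_right_pos)
  qed
  have "\<alpha> * t \<le> u (T t x) - u x"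
  proof (rule field_le_epsilon)
    fix e :: real assume "0 < e"
    define r where "r = e / (2 * (\<bar>K\<bar> * real n + 1))"
    have p: "0 < \<bar>K\<bar> * real n + 1" by (intro add_nonneg_pos) auto
    have r: "0 < r" using \<open>0 < e\<close> p by (simp add: r_def)
    have "2 * (\<bar>K\<bar> * (real n * r)) = (\<bar>K\<bar> * real n) * (2 * r)" by simp
    also have "\<dots> \<le> (\<bar>K\<bar> * real n + 1) * (2 * r)" using r by (intro mult_right_mono) auto
    also have "\<dots> = e"
    proof -
      have "a * (2 * (e / (2 * a))) = e" if "0 < a" for a :: real using that by simp
      from this[OF p] show ?thesis unfolding r_def .
    qed
    finally show "\<alpha> * t \<le> u (T t x) - u x + e" using bound[OF r] by simp
  qed
  then show ?thesis by (simp add: T_def)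
qed

section \<open>From Hessian bounds to quadratic Taylor bounds\<close>

lemma C11_borel_measurable:
  assumes "C11 n h"
  shows "h \<in> borel_measurable (lebesgue_Rn n)"
proof (rule borel_measurable_dist_continuous)
  fix x and e :: real assume x: "x \<in> Rn n" and e: "0 < e"
  define c where "c = (\<Sum>i<n. \<bar>grad h x i\<bar>) + 1"
  have c: "0 < c" by (auto simp: c_def intro: add_nonneg_pos sum_nonneg)
  have "has_gradient n h (grad h x) x" using assms x by (simp add: C11_def)
  then obtain d where d: "0 < d" "\<And>y. y \<in> Rn n \<Longrightarrow> dist_Rn n y x < d \<Longrightarrow>
      \<bar>h y - h x - (\<Sum>i<n. grad h x i * (y i - x i))\<bar> \<le> 1 * dist_Rn n y x"
    unfolding has_gradient_def by (metis zero_less_one)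
  show "\<exists>d>0. \<forall>y\<in>Rn n. dist_Rn n y x < d \<longrightarrow> \<bar>h y - h x\<bar> < e"
  proof (intro exI[of _ "min d (e / c)"] conjI ballI impI)
    show "0 < min d (e / c)" using d e c by simp
    fix y assume y: "y \<in> Rn n" and dist: "dist_Rn n y x < min d (e / c)"
    have "\<bar>\<Sum>i<n. grad h x i * (y i - x i)\<bar> \<le> (\<Sum>i<n. \<bar>grad h x i * (y i - x i)\<bar>)" by (rule sum_abs)
    also have "\<dots> \<le> (\<Sum>i<n. \<bar>grad h x i\<bar> * dist_Rn n y x)"
      unfolding abs_mult by (intro sum_mono mult_left_mono abs_le_dist_Rn) auto
    also have "\<dots> = (\<Sum>i<n. \<bar>grad h x i\<bar>) * dist_Rn n y x" by (simp add: sum_distrib_right)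
    finally have "\<bar>h y - h x\<bar> \<le> c * dist_Rn n y x"
      using d(2)[OF y] dist by (simp add: c_def distrib_right)
    also have "\<dots> < e" using dist c by (simp add: pos_less_divide_eq mult.commute)
    finally show "\<bar>h y - h x\<bar> < e" .
  qed
qed

text \<open>The segment from \<open>x\<close> to \<open>y\<close> may lie inside the null set
  without Hessian, so the averaged estimate is applied to the derivative \<open>u\<close> in the
  fixed direction \<open>v = y - x\<close>. It shows that \<open>u\<close> increases along the
  segment at a rate between \<open>a * S\<close> and \<open>b * S\<close>; one integration gives the
  factor 1/2.\<close>

lemma grad_taylor_bounds:
  assumes C: "C11 n h"
    and ae: "AE x in lebesgue_Rn n. \<exists>H. has_hessian n h H x \<and>
        loewner_le n (scalar_matrix a) H \<and> loewner_le n H (scalar_matrix b)"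
    and xy: "x \<in> Rn n" "y \<in> Rn n"
  shows "a / 2 * sqn n (\<lambda>i. y i - x i) \<le> h y - h x - (\<Sum>i<n. grad h x i * (y i - x i))"
    and "h y - h x - (\<Sum>i<n. grad h x i * (y i - x i)) \<le> b / 2 * sqn n (\<lambda>i. y i - x i)"
proof -
  define v where "v i = y i - x i" for i
  define S where "S = sqn n v"
  define u where "u z = (\<Sum>i<n. grad h z i * v i)" for z
  define T where "T t = translate n (\<lambda>i. t * v i)" for t
  obtain L where L: "\<And>x y. x \<in> Rn n \<Longrightarrow> y \<in> Rn n \<Longrightarrow> dist_Rn n (grad h x) (grad h y) \<le> L * dist_Rn n x y"
    using C unfolding C11_def by blast
  have lip: "\<bar>u p - u q\<bar> \<le> (norm_Rn n v * L) * dist_Rn n p q" if "p \<in> Rn n" "q \<in> Rn n" for p q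
  proof -
    have "u p - u q = (\<Sum>i<n. (grad h p i - grad h q i) * v i)"
      by (simp add: u_def sum_subtractf left_diff_distrib)
    then have "\<bar>u p - u q\<bar> \<le> (\<Sum>i<n. \<bar>grad h p i - grad h q i\<bar> * \<bar>v i\<bar>)"
      using sum_abs[of "\<lambda>i. (grad h p i - grad h q i) * v i" "{..<n}"] by (simp add: abs_mult)
    also have "\<dots> \<le> dist_Rn n (grad h p) (grad h q) * norm_Rn n v"
      unfolding dist_Rn_def norm_Rn_def by (rule L2_set_mult_ineq)
    also have "\<dots> \<le> (L * dist_Rn n p q) * norm_Rn n v"
      by (intro mult_right_mono L that) (simp add: norm_Rn_def)
    finally show ?thesis by (simp add: mult_ac)
  qed
  have scal: "(\<Sum>i<n. \<Sum>j<n. scalar_matrix c i j * v i * v j) = c * S" for c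
  proof -
    have "(\<Sum>j<n. scalar_matrix c i j * v i * v j) = c * (v i)\<^sup>2" if "i < n" for i
    proof -
      have "(\<Sum>j<n. scalar_matrix c i j * v i * v j) = (\<Sum>j<n. if i = j then c * (v i)\<^sup>2 else 0)"
        by (intro sum.cong) (auto simp: scalar_matrix_def power2_eq_square)
      then show ?thesis using that by simp
    qed
    then show ?thesis by (simp add: S_def sqn_def sum_distrib_left)
  qed
  have ae': "AE z in lebesgue_Rn n. \<exists>d. a * S \<le> d \<and> d \<le> b * S \<and> ((\<lambda>s. u (T s z)) has_real_derivative d) (at 0)"
  proof (rule AE_mp[OF ae], intro AE_I2 impI)
    fix z assume "z \<in> space (lebesgue_Rn n)"
    then have z: "z \<in> Rn n" by (simp add: space_lebesgue_Rn)
    assume "\<exists>H. has_hessian n h H z \<and> loewner_le n (scalar_matrix a) H \<and> loewner_le n H (scalar_matrix b)"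
    then obtain H where H: "has_hessian n h H z" "loewner_le n (scalar_matrix a) H" "loewner_le n H (scalar_matrix b)"
      by blast
    define d where "d = (\<Sum>i<n. \<Sum>j<n. H i j * v i * v j)"
    have "((\<lambda>s. grad h (T s z) i) has_real_derivative (\<Sum>j<n. H i j * v j)) (at 0)" if "i < n" for i
      unfolding T_def using H(1) that by (intro has_gradient_DERIV[OF _ z]) (simp add: has_hessian_def)
    then have "((\<lambda>s. u (T s z)) has_real_derivative (\<Sum>i<n. (\<Sum>j<n. H i j * v j) * v i)) (at 0)"
      unfolding u_def by (intro DERIV_sum DERIV_cmult_right) auto
    moreover have "(\<Sum>i<n. (\<Sum>j<n. H i j * v j) * v i) = d"
      by (simp add: d_def sum_distrib_right sum_distrib_left mult_ac)
    moreover have "a * S \<le> d" "d \<le> b * S"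
      using H(2,3) unfolding loewner_le_def scal[symmetric] d_def by blast+
    ultimately show "\<exists>d. a * S \<le> d \<and> d \<le> b * S \<and> ((\<lambda>s. u (T s z)) has_real_derivative d) (at 0)"
      by auto
  qed
  have lower: "a * S * t \<le> u (T t x) - u x" if "0 \<le> t" for t
    unfolding T_def
  proof (rule AE_directional_derivative_lower_bound[OF lip _ xy(1) that])
    show "AE z in lebesgue_Rn n. \<exists>d\<ge>a * S. ((\<lambda>s. u (translate n (\<lambda>i. s * v i) z)) has_real_derivative d) (at 0)"
      by (rule AE_mp[OF ae']) (intro AE_I2, auto simp: T_def)
  qed
  have upper: "u (T t x) - u x \<le> b * S * t" if "0 \<le> t" for t
  proof -
    have "- (b * S) * t \<le> - u (translate n (\<lambda>i. t * v i) x) - - u x"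
    proof (rule AE_directional_derivative_lower_bound[of n "\<lambda>z. - u z" "norm_Rn n v * L", OF _ _ xy(1) that])
      show "\<bar>- u p - - u q\<bar> \<le> norm_Rn n v * L * dist_Rn n p q" if "p \<in> Rn n" "q \<in> Rn n" for p q
        using lip[OF that] by (simp add: abs_minus_commute)
      show "AE z in lebesgue_Rn n. \<exists>d\<ge>- (b * S). ((\<lambda>s. - u (translate n (\<lambda>i. s * v i) z)) has_real_derivative d) (at 0)"
      proof (rule AE_mp[OF ae'], intro AE_I2 impI)
        fix z assume "\<exists>d. a * S \<le> d \<and> d \<le> b * S \<and> ((\<lambda>s. u (T s z)) has_real_derivative d) (at 0)"
        then obtain d where "d \<le> b * S" "((\<lambda>s. u (T s z)) has_real_derivative d) (at 0)" by blast
        then show "\<exists>d\<ge>- (b * S). ((\<lambda>s. - u (translate n (\<lambda>i. s * v i) z)) has_real_derivative d) (at 0)"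
          by (intro exI[of _ "- d"]) (auto simp: T_def intro!: derivative_eq_intros)
      qed
    qed
    then show ?thesis by (simp add: T_def)
  qed
  define q where "q t = h (T t x)" for t
  have qd: "(q has_real_derivative u (T t x)) (at t)" for t
  proof -
    have Tx: "T t x \<in> Rn n" by (simp add: T_def translate_in_Rn)
    then have "has_gradient n h (grad h (T t x)) (T t x)" using C by (simp add: C11_def)
    from has_gradient_DERIV[OF this Tx, of v]
    have "((\<lambda>s. q (s + t)) has_real_derivative u (T t x)) (at 0)"
      by (simp add: q_def T_def u_def translate_translate add.commute)
    then show ?thesis using DERIV_shift[of q "u (T t x)" 0 t] by simp
  qed
  have q01: "q 0 = h x" "q 1 = h y"
    using translate_0[OF xy(1), of v] translate_diff[OF xy] by (simp_all add: q_def T_def v_def)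
  have "q 0 - u x * 0 - a * S / 2 * 0\<^sup>2 \<le> q 1 - u x * 1 - a * S / 2 * 1\<^sup>2"
    by (rule deriv_nonneg_imp_mono[of 0 1 "\<lambda>t. q t - u x * t - a * S / 2 * t\<^sup>2" "\<lambda>t. u (T t x) - u x - a * S * t"])
       (use lower in \<open>auto intro!: derivative_eq_intros qd\<close>)
  moreover have "u x * 0 + b * S / 2 * 0\<^sup>2 - q 0 \<le> u x * 1 + b * S / 2 * 1\<^sup>2 - q 1"
    by (rule deriv_nonneg_imp_mono[of 0 1 "\<lambda>t. u x * t + b * S / 2 * t\<^sup>2 - q t" "\<lambda>t. u x + b * S * t - u (T t x)"])
       (use upper in \<open>auto intro!: derivative_eq_intros qd simp: algebra_simps\<close>)
  ultimately show "a / 2 * sqn n (\<lambda>i. y i - x i) \<le> h y - h x - (\<Sum>i<n. grad h x i * (y i - x i))"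
    "h y - h x - (\<Sum>i<n. grad h x i * (y i - x i)) \<le> b / 2 * sqn n (\<lambda>i. y i - x i)"
    unfolding q01 S_def u_def v_def by simp_all
qed

lemma lin_growth_grad:
  assumes C: "C11 n h" and i: "i < n"
  shows "lin_growth n (\<lambda>x. grad h x i)"
proof -
  define o' where "o' = (\<lambda>i\<in>{..<n}. 0 :: real)"
  have o: "o' \<in> Rn n" by (simp add: o'_def Rn_def)
  obtain L where L: "\<And>x y. x \<in> Rn n \<Longrightarrow> y \<in> Rn n \<Longrightarrow> dist_Rn n (grad h x) (grad h y) \<le> L * dist_Rn n x y"
    using C unfolding C11_def by blast
  have lip: "\<bar>grad h x i - grad h y i\<bar> \<le> L * dist_Rn n x y" if "x \<in> Rn n" "y \<in> Rn n" for x y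
    using order_trans[OF abs_le_dist_Rn[OF i] L[OF that]] .
  have [measurable]: "(\<lambda>x. grad h x i) \<in> borel_measurable (lebesgue_Rn n)"
    by (rule borel_measurable_lipschitz[OF lip])
  have "lin_growth n (\<lambda>x. grad h x i - grad h o' i)"
  proof (rule lin_growthI[of _ _ "L\<^sup>2"])
    fix x assume x: "x \<in> Rn n"
    have "\<bar>grad h x i - grad h o' i\<bar>\<^sup>2 \<le> (L * dist_Rn n x o')\<^sup>2"
      by (intro power_mono lip x o) simp
    also have "\<dots> = L\<^sup>2 * sqn n x"
      unfolding power_mult_distrib dist_Rn_power2 by (simp add: sqn_def o'_def)
    finally show "(grad h x i - grad h o' i)\<^sup>2 \<le> L\<^sup>2 * (1 + sqn n x)" by (simp add: distrib_left add_increasing)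
  qed measurable
  from lin_growth_add[OF this lin_growth_const[of n "grad h o' i"]] show ?thesis by simp
qed

text \<open>Adding \<open>sqn n x / 2\<close> raises both Hessian bounds by one: the lower one
  becomes positive, and the upper one exceeds 1, as the one-dimensional deficit estimate
  requires.\<close>

lemma pot_of_C11:
  assumes C: "C11 n h" and e: "0 < \<epsilon>" "0 < M"
    and ae: "AE x in lebesgue_Rn n. \<exists>H. has_hessian n h H x \<and>
        loewner_le n (scalar_matrix (-1 + \<epsilon>)) H \<and> loewner_le n H (scalar_matrix M)"
  shows "pot n \<epsilon> (1 + M) (\<lambda>x. h x + sqn n x / 2) (\<lambda>x i. grad h x i + x i)"
  unfolding pot_def
proof (intro conjI ballI allI impI)
  show "0 < \<epsilon>" "0 < 1 + M" using e by auto
  note [measurable] = C11_borel_measurable[OF C] borel_measurable_sqn[of n]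
  show "(\<lambda>x. h x + sqn n x / 2) \<in> borel_measurable (lebesgue_Rn n)" by measurable
  show "lin_growth n (\<lambda>x. grad h x i + x i)" if "i < n" for i
    by (intro lin_growth_add lin_growth_grad[OF C] lin_growth_component that)
  fix x y assume xy: "x \<in> Rn n" "y \<in> Rn n"
  note t = grad_taylor_bounds[OF C ae xy]
  have "(\<Sum>i<n. (y i)\<^sup>2 / 2 - (x i)\<^sup>2 / 2 - x i * (y i - x i)) = (\<Sum>i<n. (y i - x i)\<^sup>2 / 2)"
    by (intro sum.cong) (auto simp: power2_eq_square field_simps)
  then have "sqn n y / 2 - sqn n x / 2 - (\<Sum>i<n. x i * (y i - x i)) = sqn n (\<lambda>i. y i - x i) / 2"
    by (simp add: sqn_def sum_subtractf sum_divide_distrib)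
  then have eq: "h y + sqn n y / 2 - (h x + sqn n x / 2) - (\<Sum>i<n. (grad h x i + x i) * (y i - x i))
     = (h y - h x - (\<Sum>i<n. grad h x i * (y i - x i))) + sqn n (\<lambda>i. y i - x i) / 2"
    by (simp add: distrib_right sum.distrib)
  show "\<epsilon> / 2 * sqn n (\<lambda>i. y i - x i) \<le> h y + sqn n y / 2 - (h x + sqn n x / 2) - (\<Sum>i<n. (grad h x i + x i) * (y i - x i))"
    unfolding eq using t(1) by (simp add: field_simps)
  show "h y + sqn n y / 2 - (h x + sqn n x / 2) - (\<Sum>i<n. (grad h x i + x i) * (y i - x i)) \<le> (1 + M) / 2 * sqn n (\<lambda>i. y i - x i)"
    unfolding eq using t(2) by (simp add: field_simps)
qed

lemma grad_exp_minus:
  assumes C: "C11 n h" and x: "x \<in> Rn n" and i: "i < n"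
  shows "grad (\<lambda>x. exp (- h x)) x i = - exp (- h x) * grad h x i"
proof -
  define v where "v j = (if j = i then 1 else 0 :: real)" for j
  have T: "translate n (\<lambda>j. s * v j) x = x(i := s + x i)" for s
    using x i by (auto simp: translate_def v_def fun_eq_iff Rn_def PiE_iff extensional_def)
  have sum: "(\<Sum>j<n. grad h x j * v j) = grad h x i"
    using i by (simp add: v_def if_distrib cong: if_cong)
  have "has_gradient n h (grad h x) x" using C x by (simp add: C11_def)
  from has_gradient_DERIV[OF this x, of v]
  have "((\<lambda>s. h (x(i := s + x i))) has_real_derivative grad h x i) (at 0)"
    unfolding T sum .
  then have "((\<lambda>t. h (x(i := t))) has_real_derivative grad h x i) (at (x i))"
    using DERIV_shift[of "\<lambda>t. h (x(i := t))" "grad h x i" 0 "x i"] by simp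
  then have "((\<lambda>t. exp (- h (x(i := t)))) has_real_derivative - exp (- h x) * grad h x i) (at (x i))"
    by (auto intro!: derivative_eq_intros)
  then show ?thesis unfolding grad_def by (rule DERIV_imp_deriv)
qed

lemma deficit_const_pos: "0 < \<epsilon> \<Longrightarrow> 0 < L \<Longrightarrow> 0 < deficit_const \<epsilon> L"
  by (auto simp: deficit_const_def intro!: add_pos_pos divide_pos_pos mult_pos_pos)

section \<open>Translation into the terms of the theorem\<close>

context
  fixes n :: nat and \<epsilon> M :: real and h :: "(nat \<Rightarrow> real) \<Rightarrow> real"
  assumes C: "C11 n h" and e: "0 < \<epsilon>" "0 < M"
    and ae: "AE x in lebesgue_Rn n. \<exists>H. has_hessian n h H x \<and>
        loewner_le n (scalar_matrix (-1 + \<epsilon>)) H \<and> loewner_le n H (scalar_matrix M)"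
    and mass: "(LINT x|gauss n. exp (- h x)) = 1"
begin

private definition "V = (\<lambda>x. h x + sqn n x / 2)"
private definition "G = (\<lambda>x i. grad h x i + x i)"

private lemma pot: "pot n \<epsilon> (1 + M) V G"
  unfolding V_def G_def by (rule pot_of_C11[OF C e ae])

private lemma h_measurable [measurable]: "h \<in> borel_measurable (lebesgue_Rn n)"
  by (rule C11_borel_measurable[OF C])

private lemma integral_gauss:
  assumes [measurable]: "F \<in> borel_measurable (lebesgue_Rn n)"
  shows "(LINT x|gauss n. F x) = (2 * pi) powr (- real n / 2) * (LINT x|lebesgue_Rn n. F x * exp (- sqn n x / 2))"
proof -
  note [measurable] = borel_measurable_sqn[of n]
  have "(LINT x|gauss n. F x) = (LINT x|lebesgue_Rn n. (2 * pi) powr (- real n / 2) * exp (- sqn n x / 2) * F x)"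
    unfolding gauss_def norm_Rn_power2 by (subst integral_density) auto
  also have "\<dots> = (LINT x|lebesgue_Rn n. (2 * pi) powr (- real n / 2) * (F x * exp (- sqn n x / 2)))"
    by (intro Bochner_Integration.integral_cong) (auto simp: mult_ac)
  finally show ?thesis by simp
qed

private lemma exp_V: "exp (- V x) = exp (- h x) * exp (- sqn n x / 2)"
  by (simp add: V_def exp_add[symmetric])

text \<open>Unit mass of \<open>exp (- h x)\<close> identifies the partition function of
  \<open>V\<close> with the Gaussian one, so the constants cancel in densities and in the
  entropy.\<close>

private lemma part_V: "(2 * pi) powr (- real n / 2) * part n V = 1"
  using mass unfolding part_def exp_V by (subst (asm) integral_gauss) simp_all

private lemma integral_f:
  assumes [measurable]: "F \<in> borel_measurable (lebesgue_Rn n)"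
  shows "(LINT x|gauss n. F x * exp (- h x)) = (LINT x|mu n V. F x)"
proof -
  have "(LINT x|gauss n. F x * exp (- h x)) = (2 * pi) powr (- real n / 2) * (LINT x|lebesgue_Rn n. F x * exp (- V x))"
    by (subst integral_gauss) (simp_all add: exp_V mult.assoc)
  also have "\<dots> = (LINT x|lebesgue_Rn n. F x * exp (- V x)) / part n V"
    using part_V part_pos[OF pot] by (simp add: field_simps)
  finally show ?thesis by (simp add: integral_mu[OF pot])
qed

private lemma density_f: "density (gauss n) (\<lambda>x. ennreal (exp (- h x))) = mu n V"
proof -
  note [measurable] = borel_measurable_sqn[of n]
  have "density (gauss n) (\<lambda>x. ennreal (exp (- h x)))
     = density (lebesgue_Rn n) (\<lambda>x. ennreal ((2 * pi) powr (- real n / 2) * exp (- sqn n x / 2)) * ennreal (exp (- h x)))"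
    unfolding gauss_def norm_Rn_power2 by (subst density_density_eq) auto
  also have "(\<lambda>x. ennreal ((2 * pi) powr (- real n / 2) * exp (- sqn n x / 2)) * ennreal (exp (- h x)))
      = (\<lambda>x. ennreal (exp (- V x) / part n V))"
  proof
    fix x
    have "(2 * pi) powr (- real n / 2) * exp (- sqn n x / 2) * exp (- h x) = exp (- V x) / part n V"
      using part_V part_pos[OF pot] by (simp add: exp_V field_simps)
    then show "ennreal ((2 * pi) powr (- real n / 2) * exp (- sqn n x / 2)) * ennreal (exp (- h x)) = ennreal (exp (- V x) / part n V)"
      by (simp add: ennreal_mult[symmetric])
  qed
  finally show ?thesis by (simp add: mu_def)
qed

private lemma fisher_f: "fisher n (\<lambda>x. exp (- h x)) = fish n V G"
proof -
  have [measurable]: "(\<lambda>x. \<Sum>i<n. (grad h x i)\<^sup>2) \<in> borel_measurable (lebesgue_Rn n)"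
    using lin_growth_measurable[OF lin_growth_grad[OF C]] by (intro borel_measurable_sum borel_measurable_power) auto
  have "fisher n (\<lambda>x. exp (- h x)) = (LINT x|gauss n. (\<Sum>i<n. (grad h x i)\<^sup>2) * exp (- h x))"
    unfolding fisher_def norm_Rn_power2
  proof (intro Bochner_Integration.integral_cong refl)
    fix x assume "x \<in> space (gauss n)"
    then have x: "x \<in> Rn n" by (simp add: gauss_def space_lebesgue_Rn)
    have "sqn n (grad (\<lambda>x. exp (- h x)) x) = (\<Sum>i<n. (exp (- h x))\<^sup>2 * (grad h x i)\<^sup>2)"
      unfolding sqn_def by (intro sum.cong) (auto simp: grad_exp_minus[OF C x] power_mult_distrib)
    also have "\<dots> = (\<Sum>i<n. (grad h x i)\<^sup>2) * exp (- h x) * exp (- h x)"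
      by (simp add: sum_distrib_left[symmetric] power2_eq_square)
    finally show "sqn n (grad (\<lambda>x. exp (- h x)) x) / exp (- h x) = (\<Sum>i<n. (grad h x i)\<^sup>2) * exp (- h x)" by simp
  qed
  also have "\<dots> = fish n V G" by (simp add: integral_f fish_def G_def)
  finally show ?thesis .
qed

text \<open>With the Gaussian value of the partition function the integrand of \<open>ent\<close>
  collapses to \<open>- h x\<close>, the logarithm of the density; the term with the total mass is
  \<open>ln 1\<close>.\<close>

private lemma entropy_f: "entropy_gauss n (\<lambda>x. exp (- h x)) = ent n V"
proof -
  have "ln (part n V) = real n / 2 * ln (2 * pi)"
  proof -
    have "ln ((2 * pi) powr (- real n / 2) * part n V) = - real n / 2 * ln (2 * pi) + ln (part n V)"
      using part_pos[OF pot] by (simp add: ln_mult_pos ln_powr)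
    then show ?thesis unfolding part_V by simp
  qed
  then have "- V x - ln (part n V) + sqn n x / 2 + real n / 2 * ln (2 * pi) = - h x" for x
    by (simp add: V_def[THEN fun_cong])
  then have "ent n V = (LINT x|mu n V. - h x)" by (simp only: ent_def)
  also have "\<dots> = (LINT x|gauss n. - h x * exp (- h x))" by (rule integral_f[symmetric]) simp
  finally show ?thesis using mass by (simp add: entropy_gauss_def mult.commute)
qed

lemma W2_le_deficit:
  assumes bary: "\<And>i. i < n \<Longrightarrow> (LINT x|gauss n. x i * exp (- h x)) = 0"
  shows "W2 n (density (gauss n) (\<lambda>x. ennreal (exp (- h x)))) (gauss n)
    \<le> ennreal (sqrt (4 / deficit_const \<epsilon> (1 + M)) * sqrt (lsi_deficit n (\<lambda>x. exp (- h x))))"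
proof -
  define c where "c = deficit_const \<epsilon> (1 + M)"
  define \<delta> where "\<delta> = lsi_deficit n (\<lambda>x. exp (- h x))"
  have c: "0 < c" unfolding c_def using e by (intro deficit_const_pos) auto
  have "varm (mu n V) (\<lambda>x. G x i - x i) = (LINT x|mu n V. (G x i - x i)\<^sup>2)" if i: "i < n" for i
  proof -
    have "(LINT x|mu n V. x i) = 0"
      using bary[OF i] integral_f[OF measurable_Rn_component[OF i]] by simp
    moreover have "(LINT x|mu n V. G x i - x i) = (LINT x|mu n V. G x i) - (LINT x|mu n V. x i)"
      by (intro Bochner_Integration.integral_diff lin_growth_integrable(1)[OF pot] pot_lin_growth[OF pot]
          lin_growth_component i)
    ultimately show ?thesis
      using integral_gradient_eq_0[OF pot i] by (simp add: varm_def)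
  qed
  moreover have "fish n V G = (\<Sum>i<n. (LINT x|mu n V. (G x i - x i)\<^sup>2))"
    unfolding fish_def using lin_growth_integrable(2)[OF pot lin_growth_score[OF pot]]
    by (intro Bochner_Integration.integral_sum) auto
  ultimately have "c * fish n V G \<le> 1 / 2 * fish n V G - ent n V"
    using deficit_ge_variance[OF pot] e by (simp add: c_def)
  then have "c * fish n V G \<le> \<delta>" by (simp add: \<delta>_def lsi_deficit_def fisher_f entropy_f)
  then have fish: "4 * fish n V G \<le> 4 / c * \<delta>" using c by (simp add: field_simps)
  have W: "W2_squared n (mu n V) (gauss n) \<le> ennreal (4 * fish n V G)"
    using e by (intro W2_squared_le_fish[OF pot]) simp
  \<comment> \<open>Finiteness selects the real branch in the definition of
    \<open>W2\<close>.\<close>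
  then have "W2_squared n (mu n V) (gauss n) \<noteq> \<infinity>" by (auto simp: top_unique)
  then have "W2 n (mu n V) (gauss n) = ennreal (sqrt (enn2real (W2_squared n (mu n V) (gauss n))))"
    by (simp add: W2_def)
  also have "\<dots> \<le> ennreal (sqrt (4 / c * \<delta>))"
  proof (intro ennreal_leI real_sqrt_le_mono)
    have "0 \<le> 4 * fish n V G" unfolding fish_def by (intro mult_nonneg_nonneg Bochner_Integration.integral_nonneg sum_nonneg) auto
    with W have "enn2real (W2_squared n (mu n V) (gauss n)) \<le> 4 * fish n V G" by (intro enn2real_leI)
    then show "enn2real (W2_squared n (mu n V) (gauss n)) \<le> 4 / c * \<delta>" using fish by (rule order_trans)
  qed
  finally show ?thesis unfolding density_f real_sqrt_mult c_def \<delta>_def .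
qed

end

theorem corollary1p2:
  fixes \<epsilon> M :: real
  assumes "\<epsilon> > 0" and "M > 0"
  shows "\<exists>C>0. \<forall>n\<ge>1. \<forall>f\<in>\<F> n \<epsilon> M.
    (LINT x|gauss n. f x) = 1 \<longrightarrow>
    (\<forall>i<n. (LINT x|gauss n. x i * f x) = 0) \<longrightarrow>
    W2 n (density (gauss n) (\<lambda>x. ennreal (f x))) (gauss n) \<le> ennreal (C * sqrt (lsi_deficit n f))"
proof (intro exI[of _ "sqrt (4 / deficit_const \<epsilon> (1 + M))"] conjI allI impI ballI)
  show "0 < sqrt (4 / deficit_const \<epsilon> (1 + M))" using deficit_const_pos[of \<epsilon> "1 + M"] assms by simp
  fix n f assume f: "f \<in> \<F> n \<epsilon> M" and mass: "(LINT x|gauss n. f x) = 1"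
    and bary: "\<forall>i<n. (LINT x|gauss n. x i * f x) = 0"
  from f obtain h where h: "f = (\<lambda>x. exp (- h x))" "C11 n h"
    "AE x in lebesgue_Rn n. \<exists>H. has_hessian n h H x \<and>
        loewner_le n (scalar_matrix (-1 + \<epsilon>)) H \<and> loewner_le n H (scalar_matrix M)"
    unfolding \<F>_def by blast
  show "W2 n (density (gauss n) (\<lambda>x. ennreal (f x))) (gauss n)
      \<le> ennreal (sqrt (4 / deficit_const \<epsilon> (1 + M)) * sqrt (lsi_deficit n f))"
    using mass bary unfolding h(1) by (intro W2_le_deficit[OF h(2) assms h(3)]) auto
qed

end
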